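(* Let $\mathbf{A}$ be a unital $\mathrm{C}^*$-algebra with a c.e. presentation $\mathbf{A}^\#$. Then there is a c.e. presentation $\mathcal{D}(\mathbf{A}^\#)$ of the Murray–von Neumann semigroup $\mathcal{D}(\mathbf{A})$ that is computably supported by $\mathbf{A}^\#$.
   Context: A presentation $\mathbf{A}^\#$ of $\mathbf{A}$ is a sequence in $\mathbf{A}$ (special points) generating a dense $*$-subalgebra; rational points are $*$-polynomials with $\mathbb{Q}(i)$ coefficients and no constant term in special points, effectively enumerated. $\mathbf{A}^\#$ is c.e. if an algorithm given a rational point $q$ enumerates a decreasing sequence of rationals converging to $\|q\|$. An element $a$ is a computable point of a presentation if an algorithm, given $k$, outputs a rational point within $2^{-k}$ of $a$; a code of it is an index of $a$. $M_n(\mathbf{A}^\#)$ is the presentation of $M_n(\mathbf{A})$ whose special points are the matrices with one special point of $\mathbf{A}^\#$ in entry $(r,s)$ and $0$ elsewhere. $\mathcal{D}(\mathbf{A})$ is the abelian semigroup of Murray–von Neumann classes $[p]$ of projections $p\in\bigcup_nM_n(\mathbf{A})$ with operation induced by $p\oplus q=\mathrm{diag}(p,q)$. Let $D_\omega$ be the free semigroup on $x_0,x_1,\ldots$, computably identified with $\mathbb{N}$. A presentation of a semigroup $S$ is a pair $(S,\nu)$ with $\nu:D_\omega\to S$ an epimorphism; $w$ is a label of $\nu(w)$; it is c.e. if $\{(w,w'):\nu(w)=\nu(w')\}$ is c.e. A presentation $S^\#$ of $\mathcal{D}(\mathbf{A})$ is computably supported by $\mathbf{A}^\#$ if there is an algorithm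 which, given $w\in D_\omega$, computes $n,e\in\mathbb{N}$ such that $e$ is an $M_n(\mathbf{A}^\#)$-index of a projection $p\in M_n(\mathbf{A})$ with $w$ an $S^\#$-label of $[p]$. *)

theory Defs
  imports
    "HOL-Analysis.Elementary_Topology"
    "HOL-Library.Nat_Bijection"
    "Jordan_Normal_Form.Matrix"
begin

section \<open>Partial recursive functions\<close>

text \<open>
  Programs for the unary partial recursive functions. Several arguments are passed through the
  Cantor pairing \<^const>\<open>prod_encode\<close>. \<open>PMu f\<close> is unbounded minimisation: on input \<open>x\<close> it returns
  the least \<open>n\<close> such that \<open>f (x, n) = 0\<close> and \<open>f (x, m)\<close> is defined for all \<open>m < n\<close>.
\<close>

datatype prog =
    PZero | PSucc | PFst | PSnd
  | PPair prog prog | PComp prog prog | PRec prog prog | PMu prog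

inductive evaluates :: "prog \<Rightarrow> nat \<Rightarrow> nat \<Rightarrow> bool" where
  zero: "evaluates PZero x 0"
| succ: "evaluates PSucc x (Suc x)"
| first: "evaluates PFst (prod_encode (a, b)) a"
| second: "evaluates PSnd (prod_encode (a, b)) b"
| pair: "evaluates f x a \<Longrightarrow> evaluates g x b \<Longrightarrow> evaluates (PPair f g) x (prod_encode (a, b))"
| comp: "evaluates g x y \<Longrightarrow> evaluates f y z \<Longrightarrow> evaluates (PComp f g) x z"
| rec_0: "evaluates f a y \<Longrightarrow> evaluates (PRec f g) (prod_encode (a, 0)) y"
| rec_Suc: "evaluates (PRec f g) (prod_encode (a, n)) y
    \<Longrightarrow> evaluates g (prod_encode (a, prod_encode (n, y))) z
    \<Longrightarrow> evaluates (PRec f g) (prod_encode (a, Suc n)) z"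
| mu: "evaluates f (prod_encode (x, n)) 0
    \<Longrightarrow> (\<And>m. m < n \<Longrightarrow> \<exists>y. evaluates f (prod_encode (x, m)) (Suc y))
    \<Longrightarrow> evaluates (PMu f) x n"

text \<open>Goedel numbering of programs (a bijection with the natural numbers).\<close>

primrec prog_code :: "prog \<Rightarrow> nat" where
  "prog_code PZero = 0"
| "prog_code PSucc = 1"
| "prog_code PFst = 2"
| "prog_code PSnd = 3"
| "prog_code (PPair f g) = 4 + 4 * prod_encode (prog_code f, prog_code g)"
| "prog_code (PComp f g) = 5 + 4 * prod_encode (prog_code f, prog_code g)"
| "prog_code (PRec f g) = 6 + 4 * prod_encode (prog_code f, prog_code g)"
| "prog_code (PMu f) = 7 + 4 * prog_code f"

definition computable :: "(nat \<Rightarrow> nat) \<Rightarrow> bool" where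
  "computable f \<longleftrightarrow> (\<exists>c. \<forall>x. evaluates c x (f x))"

definition ce_set :: "nat set \<Rightarrow> bool" where
  "ce_set A \<longleftrightarrow> (\<exists>c. \<forall>x. x \<in> A \<longleftrightarrow> (\<exists>y. evaluates c x y))"


section \<open>C*-algebras\<close>

class cstar_algebra = real_normed_algebra + banach +
  fixes scaleC :: "complex \<Rightarrow> 'a \<Rightarrow> 'a" (infixr \<open>*\<^sub>C\<close> 75)
    and adj :: "'a \<Rightarrow> 'a"
  assumes scaleC_add_right: "c *\<^sub>C (x + y) = c *\<^sub>C x + c *\<^sub>C y"
    and scaleC_add_left: "(c + d) *\<^sub>C x = c *\<^sub>C x + d *\<^sub>C x"
    and scaleC_scaleC: "c *\<^sub>C d *\<^sub>C x = (c * d) *\<^sub>C x"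
    and scaleC_of_real: "complex_of_real r *\<^sub>C x = r *\<^sub>R x"
    and norm_scaleC: "norm (c *\<^sub>C x) = cmod c * norm x"
    and scaleC_mult_left: "(c *\<^sub>C x) * y = c *\<^sub>C (x * y)"
    and scaleC_mult_right: "x * (c *\<^sub>C y) = c *\<^sub>C (x * y)"
    and adj_add: "adj (x + y) = adj x + adj y"
    and adj_scaleC: "adj (c *\<^sub>C x) = cnj c *\<^sub>C adj x"
    and adj_mult: "adj (x * y) = adj y * adj x"
    and adj_adj: "adj (adj x) = x"
    and cstar_identity: "norm (adj x * x) = (norm x)\<^sup>2"

text \<open>The zero algebra is not excluded (\<^class>\<open>monoid_mult\<close> does not require \<open>0 \<noteq> 1\<close>).\<close>

class unital_cstar_algebra = cstar_algebra + monoid_mult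


section \<open>Matrix algebras\<close>

definition mat_adj :: "'a::cstar_algebra mat \<Rightarrow> 'a mat" where
  "mat_adj M = map_mat adj (transpose_mat M)"

text \<open>
  The C*-norm of \<open>M\<^sub>n(A)\<close> is the operator norm for its action on the Hilbert \<open>A\<close>-module \<open>A\<^sup>n\<close>,
  whose norm comes from the \<open>A\<close>-valued inner product \<open>\<langle>v, w\<rangle> = \<Sum>\<^sub>i v\<^sub>i* w\<^sub>i\<close>.
\<close>

definition module_norm :: "'a::cstar_algebra vec \<Rightarrow> real" where
  "module_norm v = sqrt (norm (\<Sum>i<dim_vec v. adj (vec_index v i) * vec_index v i))"

definition mat_norm :: "'a::cstar_algebra mat \<Rightarrow> real" where
  "mat_norm M = (SUP v \<in> {v \<in> carrier_vec (dim_col M). module_norm v \<le> 1}. module_norm (M *\<^sub>v v))"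


section \<open>Presentations of C*-algebras\<close>

text \<open>
  The operations used to evaluate rational points, collected in a record so that the same
  definitions apply to \<open>A\<close> and to all the algebras \<open>M\<^sub>n(A)\<close>.
\<close>

record 'b star_ops =
  op_zero :: 'b
  op_add :: "'b \<Rightarrow> 'b \<Rightarrow> 'b"
  op_scale :: "complex \<Rightarrow> 'b \<Rightarrow> 'b"
  op_mult :: "'b \<Rightarrow> 'b \<Rightarrow> 'b"
  op_adj :: "'b \<Rightarrow> 'b"
  op_norm :: "'b \<Rightarrow> real"

definition cstar_ops :: "'a::cstar_algebra star_ops" where
  "cstar_ops = \<lparr>op_zero = 0, op_add = (+), op_scale = scaleC, op_mult = (*), op_adj = adj,
     op_norm = norm\<rparr>"

definition mat_ops :: "nat \<Rightarrow> 'a::cstar_algebra mat star_ops" where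
  "mat_ops n = \<lparr>op_zero = 0\<^sub>m n n, op_add = (+), op_scale = (\<lambda>c. map_mat (scaleC c)),
     op_mult = (*), op_adj = mat_adj, op_norm = mat_norm\<rparr>"

text \<open>
  Numbering of the rational points over a sequence \<open>s\<close> of special points. A literal is \<open>s i\<close> or its
  adjoint, a term is a coefficient in \<open>\<rat>(i)\<close> times a nonempty product of literals (hence there is no
  constant term), and a rational point is a finite sum of terms.
\<close>

definition literal_of :: "'b star_ops \<Rightarrow> (nat \<Rightarrow> 'b) \<Rightarrow> nat \<Rightarrow> 'b" where
  "literal_of B s l = (case sum_decode l of Inl i \<Rightarrow> s i | Inr i \<Rightarrow> op_adj B (s i))"

definition gauss_rat :: "nat \<Rightarrow> complex" where
  "gauss_rat k = (case prod_decode k of (a, b) \<Rightarrow>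
     Complex (of_rat (nat_to_rat_surj a)) (of_rat (nat_to_rat_surj b)))"

definition term_of :: "'b star_ops \<Rightarrow> (nat \<Rightarrow> 'b) \<Rightarrow> nat \<Rightarrow> 'b" where
  "term_of B s t = (case prod_decode t of (k, m) \<Rightarrow> case prod_decode m of (l, ls) \<Rightarrow>
     op_scale B (gauss_rat k)
       (foldl (\<lambda>x j. op_mult B x (literal_of B s j)) (literal_of B s l) (list_decode ls)))"

definition rational_point :: "'b star_ops \<Rightarrow> (nat \<Rightarrow> 'b) \<Rightarrow> nat \<Rightarrow> 'b" where
  "rational_point B s q = foldr (\<lambda>t x. op_add B (term_of B s t) x) (list_decode q) (op_zero B)"

inductive_set generated_star_subalgebra :: "(nat \<Rightarrow> 'a::cstar_algebra) \<Rightarrow> 'a set"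
  for s :: "nat \<Rightarrow> 'a" where
  gen_zero: "0 \<in> generated_star_subalgebra s"
| gen_special: "s i \<in> generated_star_subalgebra s"
| gen_add: "x \<in> generated_star_subalgebra s \<Longrightarrow> y \<in> generated_star_subalgebra s
    \<Longrightarrow> x + y \<in> generated_star_subalgebra s"
| gen_scaleC: "x \<in> generated_star_subalgebra s \<Longrightarrow> c *\<^sub>C x \<in> generated_star_subalgebra s"
| gen_mult: "x \<in> generated_star_subalgebra s \<Longrightarrow> y \<in> generated_star_subalgebra s
    \<Longrightarrow> x * y \<in> generated_star_subalgebra s"
| gen_adj: "x \<in> generated_star_subalgebra s \<Longrightarrow> adj x \<in> generated_star_subalgebra s"

definition cstar_presentation :: "(nat \<Rightarrow> 'a::cstar_algebra) \<Rightarrow> bool" where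
  "cstar_presentation s \<longleftrightarrow> closure (generated_star_subalgebra s) = UNIV"

definition ce_cstar_presentation :: "(nat \<Rightarrow> 'a::cstar_algebra) \<Rightarrow> bool" where
  "ce_cstar_presentation s \<longleftrightarrow> cstar_presentation s \<and>
     (\<exists>f. computable f \<and> (\<forall>q. let r = (\<lambda>k. real_of_rat (nat_to_rat_surj (f (prod_encode (q, k)))))
        in decseq r \<and> r \<longlonglongrightarrow> norm (rational_point cstar_ops s q)))"

text \<open>\<open>e\<close> is an index of \<open>x\<close> as a computable point of the presentation of \<open>B\<close> given by \<open>s\<close>.\<close>

definition point_index :: "'b star_ops \<Rightarrow> (nat \<Rightarrow> 'b) \<Rightarrow> nat \<Rightarrow> 'b \<Rightarrow> bool" where
  "point_index B s e x \<longleftrightarrow> (\<exists>c. e = prog_code c \<and>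
     (\<forall>k. \<exists>q. evaluates c k q \<and>
        op_norm B (op_add B x (op_scale B (-1) (rational_point B s q))) < 1 / 2 ^ k))"

text \<open>
  The special points of \<open>M\<^sub>n(A\<^sup>#)\<close>: for \<open>r, t < n\<close>, the one with number \<open>k * n\<^sup>2 + r * n + t\<close> is the
  matrix with \<open>s k\<close> in entry \<open>(r, t)\<close> and \<open>0\<close> elsewhere.
\<close>

definition mat_special :: "nat \<Rightarrow> (nat \<Rightarrow> 'a::cstar_algebra) \<Rightarrow> nat \<Rightarrow> 'a mat" where
  "mat_special n s m = mat n n (\<lambda>(i, j).
     if i = m div n mod n \<and> j = m mod n then s (m div (n * n)) else 0)"


section \<open>The Murray--von Neumann semigroup\<close>

definition mat_projections :: "nat \<Rightarrow> 'a::cstar_algebra mat set" where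
  "mat_projections n = {p \<in> carrier_mat n n. p * p = p \<and> mat_adj p = p}"

definition projections :: "'a::cstar_algebra mat set" where
  "projections = (\<Union>n\<in>{1..}. mat_projections n)"

definition mvn_equiv :: "('a::cstar_algebra mat \<times> 'a mat) set" where
  "mvn_equiv = {(p, q). p \<in> projections \<and> q \<in> projections \<and>
     (\<exists>v \<in> carrier_mat (dim_row q) (dim_row p). mat_adj v * v = p \<and> v * mat_adj v = q)}"

definition mvn_class :: "'a::cstar_algebra mat \<Rightarrow> 'a mat set" where
  "mvn_class p = mvn_equiv `` {p}"

definition mvn_semigroup :: "'a::cstar_algebra mat set set" where
  "mvn_semigroup = projections // mvn_equiv"

definition diag_sum :: "'a::zero mat \<Rightarrow> 'a mat \<Rightarrow> 'a mat" where
  "diag_sum p q = four_block_mat p (0\<^sub>m (dim_row p) (dim_col q)) (0\<^sub>m (dim_row q) (dim_col p)) q"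

definition mvn_add :: "'a::cstar_algebra mat set \<Rightarrow> 'a mat set \<Rightarrow> 'a mat set" where
  "mvn_add X Y = (\<Union>p\<in>X. \<Union>q\<in>Y. mvn_class (diag_sum p q))"


section \<open>Presentations of semigroups\<close>

text \<open>
  \<open>D\<^sub>\<omega>\<close>: nonempty words under concatenation, the letter \<open>x\<^sub>i\<close> being represented by \<open>i\<close>. Words are
  passed to programs through \<^const>\<open>list_encode\<close>.
\<close>

definition D_omega :: "nat list set" where
  "D_omega = {w. w \<noteq> []}"

definition semigroup_presentation :: "'s set \<Rightarrow> ('s \<Rightarrow> 's \<Rightarrow> 's) \<Rightarrow> (nat list \<Rightarrow> 's) \<Rightarrow> bool" where
  "semigroup_presentation S opr \<nu> \<longleftrightarrow> \<nu> ` D_omega = S \<and>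
     (\<forall>w\<in>D_omega. \<forall>w'\<in>D_omega. \<nu> (w @ w') = opr (\<nu> w) (\<nu> w'))"

definition ce_semigroup_presentation :: "'s set \<Rightarrow> ('s \<Rightarrow> 's \<Rightarrow> 's) \<Rightarrow> (nat list \<Rightarrow> 's) \<Rightarrow> bool" where
  "ce_semigroup_presentation S opr \<nu> \<longleftrightarrow> semigroup_presentation S opr \<nu> \<and>
     ce_set {prod_encode (list_encode w, list_encode w') | w w'.
       w \<in> D_omega \<and> w' \<in> D_omega \<and> \<nu> w = \<nu> w'}"

definition computably_supported ::
    "(nat list \<Rightarrow> 'a::cstar_algebra mat set) \<Rightarrow> (nat \<Rightarrow> 'a) \<Rightarrow> bool" where
  "computably_supported \<nu> s \<longleftrightarrow> (\<exists>c. \<forall>w\<in>D_omega. \<exists>n e.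
     evaluates c (list_encode w) (prod_encode (n, e)) \<and> n \<ge> 1 \<and>
     (\<exists>p\<in>mat_projections n. point_index (mat_ops n) (mat_special n s) e p \<and> \<nu> w = mvn_class p))"

end

theory Submission
  imports
    Defs
    "HOL-Analysis.Elementary_Metric_Spaces"
    "HOL-Real_Asymp.Real_Asymp"
begin

text \<open>
  A dyadic self-adjoint matrix \<open>h\<close> over the special points with \<open>h\<^sup>2 - h\<close> small determines a
  projection, the limit of the iteration \<open>h \<mapsto> 3 h\<^sup>2 - 2 h\<^sup>3\<close>, which converges at a computable
  rate. Smallness can be certified from upper approximations of the norm of \<open>A\<close>, so the certified
  matrices can be enumerated; they are the generators, and words correspond to diagonal sums. Every
  projection is close, hence equivalent, to one obtained in this way. Two projections \<open>p\<close>, \<open>q\<close> are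
  equivalent iff some dyadic \<open>v\<close> makes \<open>p v* q v p - p\<close> and \<open>q v p v* q - q\<close> small, which again can
  be certified, so equality of classes is c.e.

  All estimates use the norm \<open>\<Sum>\<^sub>i\<^sub>j norm (x\<^sub>i\<^sub>j)\<close> of matrices. That it dominates the C*-norm
  rests on \<open>norm (v\<^sub>j)\<^sup>2 \<le> norm (\<Sum>\<^sub>i v\<^sub>i* v\<^sub>i)\<close>, hence on the positivity of \<open>a* a\<close>.
\<close>

text \<open>A c.e. presentation bounds norms from above only, so a strict inequality
  \<open>norm x < r\<close> can be confirmed and an equality never can. This shapes the coding: what
  must hold exactly (self-adjointness, having a given size) is forced by the way a code is read,
  only smallness is tested, and each test names the stage at which the approximations are read,
  which makes it decidable. Since every word must denote a projection, a letter whose test fails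
  denotes 0. In the test for equivalence the bound on \<open>v\<close> is part of the certificate,
  and the precision to which the projections are computed is derived from it. The analytic side
  works without spectra: square roots and inverses are fixed points of contractions, and positivity
  is a norm inequality. The entrywise norm in general violates the C*-identity, so it enters only
  through submultiplicativity, invariance under the involution and completeness of corners.\<close>

section \<open>Contraction fixed points in complete sets\<close>

lemma contraction_fixed_point_mult:
  fixes g c :: "'b::real_normed_algebra"
  assumes S: "complete S" "S \<noteq> {}" and g: "norm g < 1"
    and step: "\<And>y. y \<in> S \<Longrightarrow> c + g * y \<in> S"
  shows "\<exists>y\<in>S. y = c + g * y"
proof -
  \<comment> \<open>The solution stands for the inverse of \<open>1 - g\<close> applied to
    \<open>c\<close> where there may be no unit. The set \<open>S\<close> records side conditions
    such as self-adjointness or commutation, which the solution then inherits.\<close>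
  have "\<exists>!y\<in>S. c + g * y = y"
  proof (rule Banach_fix[where c = "norm g"])
    fix x y
    have "dist (c + g * x) (c + g * y) = norm (g * (x - y))"
      by (simp add: dist_norm algebra_simps)
    then show "dist (c + g * x) (c + g * y) \<le> norm g * dist x y"
      by (simp add: dist_norm norm_mult_ineq)
  qed (use assms in auto)
  then show ?thesis by metis
qed

text \<open>Writing \<open>g = 1 - sqrt (1 - e)\<close> turns \<open>(1 - g)\<^sup>2 = 1 - e\<close> into a fixed point equation, which
  makes sense without a unit and is contractive on the ball of radius \<open>1 - sqrt (1 - norm e)\<close>.\<close>

lemma contraction_fixed_point_sqrt:
  fixes e :: "'b::real_normed_algebra"
  assumes S: "complete S" "0 \<in> S" and e: "norm e < 1"
    and step: "\<And>g. g \<in> S \<Longrightarrow> (1/2) *\<^sub>R (e + g * g) \<in> S"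
  shows "\<exists>g\<in>S. norm g < 1 \<and> g = (1/2) *\<^sub>R (e + g * g)"
proof -
  define r where "r = 1 - sqrt (1 - norm e)"
  \<comment> \<open>\<open>r\<close> solves the scalar equation with \<open>norm e\<close> in place
    of \<open>e\<close>, so the ball is mapped into itself; it is also the Lipschitz constant
    there.\<close>
  have r: "0 \<le> r" "r < 1" and rr: "r = (norm e + r * r) / 2"
    using e by (auto simp: r_def algebra_simps)
  let ?T = "S \<inter> cball 0 r"
  have "\<exists>!g\<in>?T. (1/2) *\<^sub>R (e + g * g) = g"
  proof (rule Banach_fix[where c = r])
    show "complete ?T" using S by (simp add: complete_Int_closed)
    show "?T \<noteq> {}" using S r by auto
    show "(\<lambda>g. (1/2) *\<^sub>R (e + g * g)) ` ?T \<subseteq> ?T"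
    proof safe
      fix g assume g: "g \<in> S" "g \<in> cball 0 r"
      then show "(1/2) *\<^sub>R (e + g * g) \<in> S" using step by blast
      have "norm (g * g) \<le> r * r"
        using g r by (intro order_trans[OF norm_mult_ineq] mult_mono) auto
      then have "norm (e + g * g) \<le> norm e + r * r"
        using norm_triangle_ineq[of e "g * g"] by linarith
      then show "(1/2) *\<^sub>R (e + g * g) \<in> cball 0 r" using rr by auto
    qed
    fix x y assume x: "x \<in> ?T" and y: "y \<in> ?T"
    have "dist ((1/2) *\<^sub>R (e + x * x)) ((1/2) *\<^sub>R (e + y * y)) = norm (x * (x - y) + (x - y) * y) / 2"
      by (simp add: dist_norm algebra_simps flip: scaleR_diff_right)
    also have "\<dots> \<le> (norm (x * (x - y)) + norm ((x - y) * y)) / 2"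
      by (simp add: norm_triangle_ineq)
    also have "norm (x * (x - y)) \<le> r * norm (x - y)"
      using x by (intro order_trans[OF norm_mult_ineq] mult_right_mono) auto
    also have "norm ((x - y) * y) \<le> norm (x - y) * r"
      using y by (intro order_trans[OF norm_mult_ineq] mult_left_mono) auto
    finally show "dist ((1/2) *\<^sub>R (e + x * x)) ((1/2) *\<^sub>R (e + y * y)) \<le> r * dist x y"
      by (simp add: dist_norm algebra_simps)
  qed (use r in auto)
  then obtain g where "g \<in> ?T" "(1/2) *\<^sub>R (e + g * g) = g" by blast
  then show ?thesis using r by (intro bexI[of _ g]) auto
qed

section \<open>Positivity in C*-algebras\<close>

lemma adj_scaleR: "adj (r *\<^sub>R x) = r *\<^sub>R adj (x :: 'a::cstar_algebra)"
  using adj_scaleC[of "complex_of_real r" x] by (simp add: scaleC_of_real)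

lemma adj_zero [simp]: "adj (0 :: 'a::cstar_algebra) = 0"
  using adj_scaleR[of 0 "0::'a"] by simp

lemma adj_minus: "adj (- x) = - adj (x :: 'a::cstar_algebra)"
  using adj_scaleR[of "-1" x] by simp

lemma adj_diff: "adj (x - y) = adj x - adj (y :: 'a::cstar_algebra)"
  using adj_add[of x "- y"] by (simp add: adj_minus)

lemma adj_sum: "adj (sum f A) = (\<Sum>i\<in>A. adj (f i :: 'a::cstar_algebra))"
  by (induction A rule: infinite_finite_induct) (auto simp: adj_add)

lemma norm_adj [simp]: "norm (adj x) = norm (x :: 'a::cstar_algebra)"
proof -
  have *: "norm y \<le> norm (adj y)" for y :: 'a
  proof (cases "norm y = 0")
    case False
    have "norm y * norm y \<le> norm (adj y) * norm y"
      using cstar_identity[of y] norm_mult_ineq[of "adj y" y] by (simp add: power2_eq_square)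
    then show ?thesis using False by (simp add: mult_le_cancel_right)
  qed simp
  from *[of x] *[of "adj x"] show ?thesis by (simp add: adj_adj)
qed

lemma bounded_linear_adj: "bounded_linear (adj :: 'a::cstar_algebra \<Rightarrow> 'a)"
  by (rule bounded_linear_intro[where K = 1]) (auto simp: adj_add adj_scaleR)

lemma adj_one [simp]: "adj (1 :: 'a::unital_cstar_algebra) = 1"
  by (metis adj_adj adj_mult mult_1 mult_1_right)

lemma norm_one_le: "norm (1 :: 'a::unital_cstar_algebra) \<le> 1"
proof -
  have "norm (1::'a) = (norm (1::'a))\<^sup>2" using cstar_identity[of "1::'a"] by simp
  then have "norm (1::'a) * (norm (1::'a) - 1) = 0" by (simp add: power2_eq_square algebra_simps)
  then show ?thesis by auto
qed

lemma norm_one_scaleR_le: "norm (r *\<^sub>R (1 :: 'a::unital_cstar_algebra)) \<le> \<bar>r\<bar>"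
  using mult_left_mono[OF norm_one_le, of "\<bar>r\<bar>"] by simp

lemma adj_power: "adj (x ^ n) = adj (x :: 'a::unital_cstar_algebra) ^ n"
  by (induction n) (auto simp: adj_mult power_commutes)

lemma norm_power_le: "norm ((x :: 'a::unital_cstar_algebra) ^ n) \<le> norm x ^ n"
proof (induction n)
  case (Suc n)
  have "norm (x ^ Suc n) \<le> norm x * norm (x ^ n)" by (simp add: norm_mult_ineq)
  also have "\<dots> \<le> norm x * norm x ^ n" using Suc by (intro mult_left_mono) auto
  finally show ?case by simp
qed (simp add: norm_one_le)

lemma norm_power_two_power:
  assumes "adj (x :: 'a::unital_cstar_algebra) = x"
  shows "norm (x ^ (2 ^ k)) = norm x ^ (2 ^ k)"
proof (induction k)
  case (Suc k)
  have "x ^ (2 ^ Suc k) = adj (x ^ (2 ^ k)) * x ^ (2 ^ k)"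
    by (simp add: adj_power assms mult_2 power_add)
  then have "norm (x ^ (2 ^ Suc k)) = (norm (x ^ (2 ^ k)))\<^sup>2" by (simp add: cstar_identity)
  then show ?case using Suc by (simp add: mult.commute flip: power_mult)
qed simp

text \<open>Replaces the spectral radius formula: for self-adjoint \<open>g\<close> the C*-identity
  makes the norm multiplicative on the powers with exponent \<open>2 ^ k\<close>, and an exponential
  with base above 1 outgrows any linear function.\<close>

lemma norm_le_if_powers_grow_linearly:
  fixes g :: "'a::unital_cstar_algebra"
  assumes g: "adj g = g" and t: "t > 0" and growth: "\<And>n. norm (g ^ n) \<le> (C + real n * M) * t ^ n"
  shows "norm g \<le> t"
proof (rule ccontr)
  assume "\<not> norm g \<le> t"
  define r where "r = norm g / t"
  have r: "r > 1" using \<open>\<not> norm g \<le> t\<close> t by (simp add: r_def)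
  have "filterlim (\<lambda>m. r ^ m - (C + real m * M)) at_top sequentially" using r by real_asymp
  then have "eventually (\<lambda>m. 0 < r ^ m - (C + real m * M)) sequentially"
    unfolding filterlim_at_top_dense by blast
  then obtain m0 where m0: "\<And>m. m \<ge> m0 \<Longrightarrow> r ^ m > C + real m * M"
    by (auto simp: eventually_sequentially)
  have "norm g ^ (2 ^ m0) \<le> (C + real (2 ^ m0) * M) * t ^ (2 ^ m0)"
    using growth[of "2 ^ m0"] norm_power_two_power[OF g] by simp
  then have "r ^ (2 ^ m0) \<le> C + real (2 ^ m0) * M"
    using t by (simp add: r_def power_divide pos_divide_le_eq)
  then show False using m0[of "2 ^ m0"] by (simp add: less_imp_le)
qed

section \<open>The positive cone, described by norms\<close>

text \<open>For self-adjoint \<open>x\<close> the inequality says that the spectrum lies in the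
  interval from 0 to \<open>2 * t\<close>. In this form closure under sums is the triangle
  inequality.\<close>

definition cstar_pos :: "'a::unital_cstar_algebra \<Rightarrow> bool" where
  "cstar_pos x \<longleftrightarrow> adj x = x \<and> (\<exists>t\<ge>0. norm (t *\<^sub>R 1 - x) \<le> t)"

lemma cstar_posI: "adj x = x \<Longrightarrow> t \<ge> 0 \<Longrightarrow> norm (t *\<^sub>R 1 - x) \<le> t \<Longrightarrow> cstar_pos x"
  by (auto simp: cstar_pos_def)

lemma cstar_pos_add: assumes "cstar_pos x" "cstar_pos y" shows "cstar_pos (x + y)"
proof -
  from assms obtain t u where "t \<ge> 0" "norm (t *\<^sub>R 1 - x) \<le> t" "u \<ge> 0" "norm (u *\<^sub>R 1 - y) \<le> u"
    by (auto simp: cstar_pos_def)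
  then have "norm ((t + u) *\<^sub>R 1 - (x + y)) \<le> t + u"
    using norm_triangle_ineq[of "t *\<^sub>R 1 - x" "u *\<^sub>R 1 - y"] by (simp add: algebra_simps)
  then show ?thesis using assms \<open>t \<ge> 0\<close> \<open>u \<ge> 0\<close>
    by (intro cstar_posI[of _ "t + u"]) (auto simp: cstar_pos_def adj_add)
qed

lemma cstar_pos_scaleR: assumes "cstar_pos x" "r \<ge> 0" shows "cstar_pos (r *\<^sub>R x)"
proof -
  from assms obtain t where t: "t \<ge> 0" "norm (t *\<^sub>R 1 - x) \<le> t" by (auto simp: cstar_pos_def)
  have "norm ((r * t) *\<^sub>R 1 - r *\<^sub>R x) = r * norm (t *\<^sub>R 1 - x)"
    using assms(2) by (simp flip: scaleR_scaleR scaleR_diff_right)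
  also have "\<dots> \<le> r * t" using t assms(2) by (intro mult_left_mono) auto
  finally show ?thesis using assms t by (intro cstar_posI[of _ "r * t"]) (auto simp: cstar_pos_def adj_scaleR)
qed

lemma cstar_pos_zero: "cstar_pos 0"
  by (rule cstar_posI[of _ 0]) auto

lemma cstar_pos_sum: "(\<And>i. i \<in> A \<Longrightarrow> cstar_pos (f i)) \<Longrightarrow> cstar_pos (sum f A)"
  by (induction A rule: infinite_finite_induct) (auto simp: cstar_pos_add cstar_pos_zero)

text \<open>Commutation with a further \<open>h\<close> is carried along because later arguments
  need roots commuting with a given element; for instance h + i u is unitary only if
  \<open>h\<close> and \<open>u\<close> commute.\<close>

lemma cstar_sqrt:
  fixes e h :: "'a::unital_cstar_algebra"
  assumes e: "adj e = e" "norm e < 1" and h: "h * e = e * h"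
  obtains u where "adj u = u" "u * u = 1 - e" "h * u = u * h"
proof -
  let ?S = "{g. adj g = g \<and> h * g = g * h}"
  have "closed ?S"
  proof -
    have "continuous_on UNIV (adj :: 'a \<Rightarrow> 'a)"
      by (rule bounded_linear.continuous_on[OF bounded_linear_adj continuous_on_id])
    then have "closed {g::'a. adj g = g}" by (intro closed_Collect_eq) auto
    moreover have "closed {g. h * g = g * h}" by (intro closed_Collect_eq continuous_intros)
    ultimately show ?thesis by (simp add: closed_Collect_conj)
  qed
  then have "\<exists>g\<in>?S. norm g < 1 \<and> g = (1/2) *\<^sub>R (e + g * g)"
  proof (intro contraction_fixed_point_sqrt)
    fix g assume g: "g \<in> ?S"
    have "h * (g * g) = g * g * h" using g by (metis (mono_tags) mem_Collect_eq mult.assoc)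
    then show "(1/2) *\<^sub>R (e + g * g) \<in> ?S"
      using g e h by (auto simp: adj_add adj_scaleR adj_mult algebra_simps)
  qed (use e in \<open>auto simp: complete_eq_closed\<close>)
  then obtain g where g: "adj g = g" "h * g = g * h" "g = (1/2) *\<^sub>R (e + g * g)" by blast
  have "2 *\<^sub>R g = e + g * g" by (subst (1) g(3)) simp
  then have "(1 - g) * (1 - g) = 1 - e" by (simp add: algebra_simps scaleR_2)
  then show ?thesis using g by (intro that[of "1 - g"]) (auto simp: adj_diff algebra_simps)
qed

lemma scaleC_ii_ii: "\<i> *\<^sub>C \<i> *\<^sub>C x = - (x :: 'a::cstar_algebra)"
  using scaleC_of_real[of "-1" x] by (simp add: scaleC_scaleC)

lemma scaleC_diff_right: "c *\<^sub>C (x - y) = c *\<^sub>C x - c *\<^sub>C (y :: 'a::cstar_algebra)"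
  by (metis scaleC_add_right add_diff_cancel diff_add_cancel)

lemma scaleC_minus_left: "(- c) *\<^sub>C x = - (c *\<^sub>C (x :: 'a::cstar_algebra))"
  using scaleC_of_real[of "-1" "c *\<^sub>C x"] by (simp add: scaleC_scaleC)

lemma norm_one_minus_two_square_aux:
  fixes h :: "'a::unital_cstar_algebra"
  assumes h: "adj h = h" "norm h < 1"
  shows "norm (1 - 2 *\<^sub>R (h * h)) \<le> 1"
proof -
  have "norm (h * h) < 1"
    using cstar_identity[of h] h by (simp add: power_less_one_iff abs_square_less_1)
  then obtain u where u: "adj u = u" "u * u = 1 - h * h" "h * u = u * h"
    using cstar_sqrt[of "h * h" h] h by (auto simp: adj_mult mult.assoc)
  \<comment> \<open>\<open>U\<close> is unitary and \<open>2 (2 h\<^sup>2 - 1) = U\<^sup>2 + (U*)\<^sup>2\<close>.\<close>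
  define U where "U = h + \<i> *\<^sub>C u"
  have aU: "adj U = h - \<i> *\<^sub>C u"
    by (simp add: U_def adj_add adj_scaleC h u scaleC_minus_left)
  have "adj U * U = 1"
    unfolding aU unfolding U_def
    by (simp add: algebra_simps scaleC_mult_left scaleC_mult_right scaleC_diff_right scaleC_add_right u scaleC_ii_ii)
  then have "(norm U)\<^sup>2 \<le> 1" using cstar_identity[of U] norm_one_le[where 'a='a] by simp
  then have nU: "norm U \<le> 1" by (simp add: power_le_one_iff abs_square_le_1)
  have "2 *\<^sub>R (1 - 2 *\<^sub>R (h * h)) = - (U * U + adj U * adj U)"
    unfolding aU unfolding U_def
    by (simp add: algebra_simps scaleC_mult_left scaleC_mult_right scaleC_diff_right scaleC_add_right u scaleC_ii_ii scaleR_2)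
  then have "2 * norm (1 - 2 *\<^sub>R (h * h)) = norm (U * U + adj U * adj U)"
    by (metis norm_minus_cancel norm_scaleR abs_numeral)
  also have "\<dots> \<le> norm (U * U) + norm (adj U * adj U)" by (rule norm_triangle_ineq)
  also have "norm (U * U) \<le> 1"
    using mult_mono[OF nU nU] norm_mult_ineq[of U U] by simp
  also have "norm (adj U * adj U) \<le> 1"
    using mult_mono[OF nU nU] norm_mult_ineq[of "adj U" "adj U"] by simp
  finally show ?thesis by simp
qed

lemma norm_minus_two_square_le:
  fixes h :: "'a::unital_cstar_algebra"
  assumes h: "adj h = h" "norm (h * h) < N"
  shows "norm (N *\<^sub>R 1 - 2 *\<^sub>R (h * h)) \<le> N"
proof -
  have N: "N > 0" using h(2) norm_ge_zero[of "h * h"] by linarith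
  let ?k = "(1 / sqrt N) *\<^sub>R h"
  have kk: "?k * ?k = (1 / N) *\<^sub>R (h * h)" using N by simp
  have "(norm ?k)\<^sup>2 = norm (?k * ?k)" using cstar_identity[of ?k] h by (simp only: adj_scaleR)
  also have "\<dots> < 1" using h N by (simp add: kk)
  finally have "norm (1 - 2 *\<^sub>R (?k * ?k)) \<le> 1"
    using h by (intro norm_one_minus_two_square_aux) (auto simp: adj_scaleR abs_square_less_1)
  then have "N * norm (1 - 2 *\<^sub>R (?k * ?k)) \<le> N * 1" using N by (intro mult_left_mono) auto
  then have "norm (N *\<^sub>R (1 - 2 *\<^sub>R (?k * ?k))) \<le> N"
    using N by (simp only: norm_scaleR abs_of_pos mult_1_right)
  moreover have "N *\<^sub>R (1 - 2 *\<^sub>R (?k * ?k)) = N *\<^sub>R 1 - 2 *\<^sub>R (h * h)"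
    unfolding kk using N by (simp add: algebra_simps)
  ultimately show ?thesis by (simp only:)
qed

lemma cstar_pos_square:
  fixes h :: "'a::unital_cstar_algebra"
  assumes "adj h = h" shows "cstar_pos (h * h)"
proof -
  define N where "N = norm (h * h) + 1"
  have "norm (N *\<^sub>R 1 - 2 *\<^sub>R (h * h)) \<le> N"
    using assms by (intro norm_minus_two_square_le) (auto simp: N_def)
  then have "norm ((1/2) *\<^sub>R (N *\<^sub>R 1 - 2 *\<^sub>R (h * h))) \<le> N / 2" by simp
  then have "norm ((N / 2) *\<^sub>R 1 - h * h) \<le> N / 2" by (simp add: algebra_simps)
  then show ?thesis using assms by (intro cstar_posI[of _ "N / 2"]) (auto simp: adj_mult N_def)
qed

text \<open>The witness in \<open>cstar_pos\<close> may always be taken as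
  \<open>norm x / 2\<close>, its smallest possible value. After a shift by a small multiple of 1,
  \<open>x\<close> is a square, to which the bound for squares applies.\<close>

lemma cstar_pos_norm_bound:
  fixes x :: "'a::unital_cstar_algebra"
  assumes x: "cstar_pos x"
  shows "norm (norm x *\<^sub>R 1 - 2 *\<^sub>R x) \<le> norm x"
proof (rule field_le_epsilon)
  fix d :: real assume d: "d > 0"
  define \<delta> where "\<delta> = d / 6"
  have \<delta>: "\<delta> > 0" using d by (simp add: \<delta>_def)
  from x obtain t where t: "t \<ge> 0" "norm (t *\<^sub>R 1 - x) \<le> t" and sx: "adj x = x"
    by (auto simp: cstar_pos_def)
  \<comment> \<open>Here \<open>1 - ?e\<close> is a multiple of
    \<open>x + \<delta> *\<^sub>R 1\<close>, and \<open>\<delta> > 0\<close> is what makes the norm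
    of \<open>?e\<close> smaller than 1.\<close>
  let ?e = "(1 / (t + \<delta>)) *\<^sub>R (t *\<^sub>R 1 - x)"
  have "norm ?e = norm (t *\<^sub>R 1 - x) / (t + \<delta>)" unfolding norm_scaleR using t \<delta> by simp
  then have "norm ?e < 1" using t \<delta> by simp
  then obtain u where u: "adj u = u" "u * u = 1 - ?e"
    using cstar_sqrt[of ?e 1] sx by (auto simp: adj_scaleR adj_diff)
  define h where "h = sqrt (t + \<delta>) *\<^sub>R u"
  have hh: "h * h = x + \<delta> *\<^sub>R 1"
  proof -
    have "h * h = (t + \<delta>) *\<^sub>R 1 - (t + \<delta>) *\<^sub>R ?e"
      using t \<delta> unfolding scaleR_diff_right[symmetric] by (simp add: h_def u del: scaleR_diff_right)
    also have "(t + \<delta>) *\<^sub>R ?e = t *\<^sub>R 1 - x" using t \<delta> unfolding scaleR_scaleR by simp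
    finally show ?thesis by (simp add: algebra_simps)
  qed
  \<comment> \<open>Chosen so that the shift cancels when \<open>2 *\<^sub>R (h * h)\<close> is
    subtracted, while \<open>?N\<close> stays strictly above the norm of
    \<open>h * h\<close>.\<close>
  let ?N = "norm x + 2 * \<delta>"
  have "norm (h * h) < ?N"
    using norm_triangle_ineq[of x "\<delta> *\<^sub>R 1"] norm_one_scaleR_le[of \<delta>, where 'a='a] \<delta>
    unfolding hh by linarith
  then have "norm (?N *\<^sub>R 1 - 2 *\<^sub>R (h * h)) \<le> ?N"
    using u by (intro norm_minus_two_square_le) (auto simp: h_def adj_scaleR)
  moreover have "?N *\<^sub>R 1 - 2 *\<^sub>R (h * h) = norm x *\<^sub>R 1 - 2 *\<^sub>R x"
    unfolding hh by (simp add: algebra_simps)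
  ultimately show "norm (norm x *\<^sub>R 1 - 2 *\<^sub>R x) \<le> norm x + d"
    using \<delta> by (simp add: \<delta>_def)
qed

lemma cstar_pos_norm_mono:
  fixes x y :: "'a::unital_cstar_algebra"
  assumes x: "cstar_pos x" and y: "cstar_pos y"
  shows "norm x \<le> norm (x + y)"
proof (cases "norm x = 0")
  case False
  let ?n = "norm x" and ?m = "norm y" and ?r = "norm (x + y)"
  define u where "u = 2 *\<^sub>R x - ?n *\<^sub>R 1"
  have nu: "norm u \<le> ?n" using cstar_pos_norm_bound[OF x] by (simp add: u_def norm_minus_commute)
  \<comment> \<open>The weights make the multiples of 1 cancel. Once \<open>?m + 2 x\<close> is
    split as \<open>(?m - 2 y) + 2 (x + y)\<close>, all terms with \<open>?m\<close> cancel in the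
    norm estimate as well.\<close>
  have "(?n + ?m) *\<^sub>R (2 *\<^sub>R x) = ?n *\<^sub>R (?m *\<^sub>R 1 + 2 *\<^sub>R x) + ?m *\<^sub>R u"
    by (simp add: u_def algebra_simps)
  then have "(?n + ?m) * (2 * ?n) = norm (?n *\<^sub>R (?m *\<^sub>R 1 + 2 *\<^sub>R x) + ?m *\<^sub>R u)"
    by (metis abs_of_nonneg add_nonneg_nonneg norm_ge_zero norm_scaleR abs_numeral)
  also have "\<dots> \<le> ?n * norm (?m *\<^sub>R 1 + 2 *\<^sub>R x) + ?m * norm u"
    by (rule order_trans[OF norm_triangle_ineq]) simp
  also have "?m * norm u \<le> ?m * ?n" using nu by (intro mult_left_mono) auto
  also have "norm (?m *\<^sub>R 1 + 2 *\<^sub>R x) \<le> ?m + 2 * ?r"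
  proof -
    have "?m *\<^sub>R 1 + 2 *\<^sub>R x = (?m *\<^sub>R 1 - 2 *\<^sub>R y) + 2 *\<^sub>R (x + y)" by (simp add: algebra_simps)
    also have "norm \<dots> \<le> norm (?m *\<^sub>R 1 - 2 *\<^sub>R y) + norm (2 *\<^sub>R (x + y))"
      by (rule norm_triangle_ineq)
    finally show ?thesis using cstar_pos_norm_bound[OF y] by simp
  qed
  then have "?n * norm (?m *\<^sub>R 1 + 2 *\<^sub>R x) \<le> ?n * (?m + 2 * ?r)" by (intro mult_left_mono) auto
  finally have "?n * (2 * ?n) \<le> ?n * (2 * ?r)" by (simp add: algebra_simps)
  then show ?thesis using False by (simp add: mult_le_cancel_left)
qed simp

text \<open>\<open>(\<tau> - c* c)\<^sup>n (c* c) = c* (\<tau> - c c*)\<^sup>n c\<close> bounds the increments of \<open>n \<mapsto> norm ((\<tau> - c* c)\<^sup>n)\<close>.\<close>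

lemma norm_shifted_square_swap:
  fixes c :: "'a::unital_cstar_algebra"
  assumes b: "norm (\<tau> *\<^sub>R 1 - c * adj c) \<le> t" and t: "t > 0" "\<bar>\<tau>\<bar> \<le> t"
  shows "norm (\<tau> *\<^sub>R 1 - adj c * c) \<le> t"
proof -
  define g where "g = \<tau> *\<^sub>R 1 - adj c * c"
  define G where "G = \<tau> *\<^sub>R 1 - c * adj c"
  have comm: "g ^ n * adj c = adj c * G ^ n" for n
  proof (induction n)
    case (Suc n)
    have "g * adj c = adj c * G" by (simp add: g_def G_def algebra_simps)
    then show ?case using Suc by (metis mult.assoc power_Suc power_Suc2)
  qed simp
  let ?M = "norm c * norm c"
  have bd: "norm (g ^ n * (adj c * c)) \<le> t ^ n * ?M" for n
  proof -
    have "norm (g ^ n * (adj c * c)) = norm (adj c * G ^ n * c)"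
      using comm by (metis mult.assoc)
    also have "\<dots> \<le> norm (adj c) * norm (G ^ n) * norm c"
      by (intro order_trans[OF norm_mult_ineq] mult_right_mono) (auto intro: norm_mult_ineq)
    also have "\<dots> \<le> norm (adj c) * t ^ n * norm c"
      using norm_power_le[of G n] power_mono[OF b[folded G_def], of n]
      by (intro mult_right_mono mult_left_mono) auto
    finally show ?thesis by (simp add: algebra_simps)
  qed
  have "norm g \<le> t"
  proof (rule norm_le_if_powers_grow_linearly)
    fix n show "norm (g ^ n) \<le> (1 + real n * (?M / t)) * t ^ n"
    proof (induction n)
      case (Suc n)
      have "g ^ Suc n = \<tau> *\<^sub>R g ^ n - g ^ n * (adj c * c)"
        by (subst power_Suc2, subst (2) g_def) (simp add: algebra_simps)
      then have "norm (g ^ Suc n) \<le> \<bar>\<tau>\<bar> * norm (g ^ n) + norm (g ^ n * (adj c * c))"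
        by (metis norm_scaleR norm_triangle_ineq4)
      also have "\<dots> \<le> t * ((1 + real n * (?M / t)) * t ^ n) + t ^ n * ?M"
        using t Suc bd by (intro add_mono mult_mono) auto
      also have "\<dots> = (1 + real (Suc n) * (?M / t)) * t ^ Suc n"
        using t by (simp add: field_simps)
      finally show ?case .
    qed (simp add: norm_one_le)
  qed (use t in \<open>auto simp: g_def adj_diff adj_scaleR adj_mult adj_adj\<close>)
  then show ?thesis by (simp add: g_def)
qed

lemma cstar_pos_adj_mult_add_mult_adj: "cstar_pos (adj c * c + c * adj (c :: 'a::unital_cstar_algebra))"
proof -
  let ?h = "c + adj c" and ?k = "\<i> *\<^sub>C (c - adj c)"
  have "cstar_pos (?h * ?h)" by (rule cstar_pos_square) (simp add: adj_add adj_adj add.commute)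
  moreover have "cstar_pos (?k * ?k)"
    by (rule cstar_pos_square)
      (simp add: adj_scaleC adj_diff adj_adj scaleC_minus_left scaleC_diff_right)
  ultimately have "cstar_pos (?h * ?h + ?k * ?k)" by (rule cstar_pos_add)
  moreover have "?h * ?h + ?k * ?k = 2 *\<^sub>R (adj c * c + c * adj c)"
    by (simp add: scaleC_mult_left scaleC_mult_right scaleC_diff_right scaleC_add_right scaleC_ii_ii algebra_simps scaleR_2)
  ultimately have "cstar_pos (2 *\<^sub>R (adj c * c + c * adj c))" by (simp only:)
  from cstar_pos_scaleR[OF this, of "1/2"] show ?thesis by simp
qed

text \<open>Positivity of \<open>adj c * c\<close> is not yet known. Adding
  \<open>adj c * c + c * adj c\<close> to the hypothesis gives positivity of
  \<open>1 + c * adj c\<close>; exchanging the factors gives that of \<open>1 + adj c * c\<close>.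
  The latter then has norm at most 2, and 3 comes from subtracting 1.\<close>

lemma norm_adj_mult_le_if_one_minus_pos:
  fixes c :: "'a::unital_cstar_algebra"
  assumes "cstar_pos (1 - adj c * c)"
  shows "norm (adj c * c) \<le> 3"
proof -
  have "cstar_pos ((1 - adj c * c) + (adj c * c + c * adj c))"
    using assms cstar_pos_adj_mult_add_mult_adj by (rule cstar_pos_add)
  then have "cstar_pos (1 + c * adj c)" by (simp add: algebra_simps)
  then obtain t where t: "t \<ge> 0" "norm (t *\<^sub>R 1 - (1 + c * adj c)) \<le> t" by (auto simp: cstar_pos_def)
  have "t *\<^sub>R 1 - c * adj c = (t *\<^sub>R 1 - (1 + c * adj c)) + 1" by simp
  then have "norm (t *\<^sub>R 1 - c * adj c) \<le> t + 1"
    using t norm_triangle_ineq[of "t *\<^sub>R 1 - (1 + c * adj c)" 1] norm_one_le[where 'a='a] by simp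
  then have "norm (t *\<^sub>R 1 - adj c * c) \<le> t + 1"
    using t by (intro norm_shifted_square_swap) auto
  then have "cstar_pos (1 + adj c * c)"
    using t by (intro cstar_posI[of _ "t + 1"]) (auto simp: adj_add adj_mult adj_adj algebra_simps)
  then have "norm (1 + adj c * c) \<le> norm ((1 + adj c * c) + (1 - adj c * c))"
    using assms by (rule cstar_pos_norm_mono)
  also have "\<dots> \<le> 2" using norm_one_scaleR_le[of 2, where 'a='a] by (simp add: scaleR_2)
  finally have "norm (1 + adj c * c) \<le> 2" .
  moreover have "adj c * c = (1 + adj c * c) - 1" by simp
  ultimately show ?thesis using norm_triangle_ineq4[of "1 + adj c * c" 1] norm_one_le[where 'a='a]
    by simp
qed

text \<open>If \<open>1 - a* a\<close> had norm greater than \<open>1\<close>, the elements \<open>c = a (1 - a* a)\<^sup>m\<close> would have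
  unbounded norm; but \<open>1 - c* c\<close> is a sum of squares, so \<open>norm (c* c) \<le> 3\<close>.\<close>

lemma cstar_pos_adj_mult_aux:
  fixes a :: "'a::unital_cstar_algebra"
  assumes a: "norm a < 1"
  shows "cstar_pos (adj a * a)"
proof -
  define x where "x = adj a * a"
  have sx: "adj x = x" by (simp add: x_def adj_mult adj_adj)
  have "norm x < 1" using a cstar_identity[of a] by (simp add: x_def abs_square_less_1)
  then obtain H where H: "adj H = H" "H * H = 1 - x" "x * H = H * x"
    using cstar_sqrt[of x x] sx by auto
  define G where "G = 1 - x"
  have GH: "G = H * H" and sG: "adj G = G" and xG: "x * G = G * x"
    by (auto simp: G_def H(2) adj_diff sx algebra_simps)
  have nG: "norm G \<le> 2"
    using norm_triangle_ineq4[of 1 x] \<open>norm x < 1\<close> norm_one_le[where 'a='a] by (simp add: G_def)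
  have xGn: "x * G ^ n = G ^ n * x" for n
    using power_commuting_commutes[OF xG[symmetric]] by simp
  have xHn: "x * H ^ n = H ^ n * x" for n
    using power_commuting_commutes[OF H(3)[symmetric]] by simp
  \<comment> \<open>This is positivity of \<open>1 - G ^ m * x\<close>. Each induction step adds
    \<open>G ^ m * (x * x)\<close>, the square of the self-adjoint \<open>H ^ m * x\<close>.\<close>
  have P: "cstar_pos (1 - G ^ m + G ^ Suc m)" for m
  proof (induction m)
    case 0
    show ?case using cstar_pos_square[OF H(1)] by (simp add: GH)
  next
    case (Suc m)
    have "G ^ m = (H ^ 2) ^ m" by (simp add: GH power2_eq_square)
    also have "\<dots> = H ^ (m + m)" by (simp add: mult_2 flip: power_mult)
    also have "\<dots> = H ^ m * H ^ m" by (rule power_add)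
    finally have "G ^ m = H ^ m * H ^ m" .
    then have "G ^ m * (x * x) = (H ^ m * x) * (H ^ m * x)"
      using xHn[of m] by (metis mult.assoc)
    moreover have "cstar_pos ((H ^ m * x) * (H ^ m * x))"
      by (rule cstar_pos_square) (simp add: adj_mult adj_power H sx xHn)
    ultimately have "cstar_pos (1 - G ^ m + G ^ Suc m + G ^ m * (x * x))"
      using Suc cstar_pos_add by simp
    moreover have "1 - G ^ m + G ^ Suc m + G ^ m * (x * x) = 1 - G ^ Suc m + G ^ Suc (Suc m)"
    proof -
      have "x = 1 - G" by (simp add: G_def)
      have "G ^ m * (x * x) = G ^ m - G ^ m * G - G ^ m * G + G ^ m * G * G"
        unfolding \<open>x = 1 - G\<close> by (simp add: algebra_simps)
      then show ?thesis by (simp add: power_Suc2 mult.assoc del: power_Suc)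
    qed
    ultimately show ?case by (simp only:)
  qed
  have even: "norm (G ^ (2 * m) - G ^ Suc (2 * m)) \<le> 3" for m
  proof -
    define c where "c = a * G ^ m"
    have "adj c * c = G ^ m * x * G ^ m"
      by (simp add: c_def adj_mult adj_power sG x_def mult.assoc)
    also have "\<dots> = G ^ (2 * m) * x" by (simp add: mult.assoc xGn mult_2 power_add)
    also have "\<dots> = G ^ (2 * m) - G ^ Suc (2 * m)"
    proof -
      have "x = 1 - G" by (simp add: G_def)
      show ?thesis unfolding \<open>x = 1 - G\<close> by (simp add: algebra_simps power_Suc2 del: power_Suc)
    qed
    finally have *: "adj c * c = G ^ (2 * m) - G ^ Suc (2 * m)" .
    have "cstar_pos (1 - adj c * c)" using P[of "2 * m"] unfolding * by (simp add: algebra_simps)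
    from norm_adj_mult_le_if_one_minus_pos[OF this] show ?thesis unfolding * .
  qed
  \<comment> \<open>The products \<open>adj c * c\<close> yield only even exponents; an odd one
    costs a further factor \<open>norm G\<close>, which is at most 2.\<close>
  have step: "norm (G ^ n - G ^ Suc n) \<le> 6" for n
  proof (cases "even n")
    case True
    then obtain m where "n = 2 * m" by blast
    then show ?thesis using even[of m] by simp
  next
    case False
    then obtain m where m: "n = Suc (2 * m)" by (auto elim: oddE)
    have "G ^ n - G ^ Suc n = G * (G ^ (2 * m) - G ^ Suc (2 * m))" by (simp add: m algebra_simps)
    also have "norm \<dots> \<le> 2 * 3"
      using nG even[of m] by (intro order_trans[OF norm_mult_ineq] mult_mono) auto
    finally show ?thesis by simp
  qed
  have "norm G \<le> 1"
  proof (rule norm_le_if_powers_grow_linearly)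
    fix n show "norm (G ^ n) \<le> (1 + real n * 6) * 1 ^ n"
    proof (induction n)
      case (Suc n)
      have "norm (G ^ Suc n) \<le> norm (G ^ n) + norm (G ^ n - G ^ Suc n)"
        by (metis norm_triangle_sub norm_minus_commute)
      then show ?case using Suc step[of n] by simp
    qed (simp add: norm_one_le)
  qed (auto simp: sG)
  then show ?thesis using sx unfolding x_def[symmetric] G_def by (intro cstar_posI[of _ 1]) auto
qed

lemma cstar_pos_adj_mult: "cstar_pos (adj a * (a :: 'a::unital_cstar_algebra))"
proof -
  define r where "r = 1 / (norm a + 1)"
  have r: "r > 0" by (simp add: r_def add_nonneg_pos)
  have "norm (r *\<^sub>R a) < 1"
    using norm_ge_zero[of a] by (simp add: r_def divide_less_eq_1 del: norm_ge_zero)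
  from cstar_pos_scaleR[OF cstar_pos_adj_mult_aux[OF this], of "1 / (r * r)"] r show ?thesis
    by (simp add: adj_scaleR)
qed

section \<open>The Hilbert module norm and the entrywise norm\<close>

lemma norm_index_le_module_norm:
  fixes v :: "'a::unital_cstar_algebra vec"
  assumes j: "j < dim_vec v"
  shows "norm (vec_index v j) \<le> module_norm v"
proof -
  let ?f = "\<lambda>i. adj (vec_index v i) * vec_index v i"
  have "norm (?f j) \<le> norm (?f j + sum ?f ({..<dim_vec v} - {j}))"
    by (intro cstar_pos_norm_mono cstar_pos_sum cstar_pos_adj_mult)
  also have "?f j + sum ?f ({..<dim_vec v} - {j}) = sum ?f {..<dim_vec v}"
    using j by (simp add: sum.remove[of _ j])
  finally have "(norm (vec_index v j))\<^sup>2 \<le> norm (sum ?f {..<dim_vec v})"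
    by (simp add: cstar_identity)
  then show ?thesis by (simp add: module_norm_def real_le_rsqrt)
qed

lemma module_norm_le_sum: "module_norm v \<le> (\<Sum>i<dim_vec v. norm (vec_index v i :: 'a::cstar_algebra))"
proof -
  have "norm (\<Sum>i<dim_vec v. adj (vec_index v i) * vec_index v i)
      \<le> (\<Sum>i<dim_vec v. (norm (vec_index v i))\<^sup>2)"
    by (rule order_trans[OF norm_sum]) (simp add: cstar_identity)
  also have "\<dots> \<le> (\<Sum>i<dim_vec v. norm (vec_index v i))\<^sup>2"
  proof -
    have "(\<Sum>i\<in>A. f i ^ 2) \<le> (sum f A)\<^sup>2" if "\<And>i. f i \<ge> (0::real)" "finite A" for f and A :: "nat set"
      using that(2)
    proof (induction A rule: finite_induct)
      case (insert x A)
      have "0 \<le> f x * sum f A" using that(1) by (simp add: sum_nonneg)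
      then show ?case using insert by (simp add: power2_sum)
    qed simp
    then show ?thesis by simp
  qed
  finally show ?thesis unfolding module_norm_def by (intro real_le_lsqrt) (auto simp: sum_nonneg)
qed

text \<open>The bridge from the entrywise estimates used throughout to the C*-norm that
  \<open>point_index\<close> refers to.\<close>

lemma mat_norm_le_sum:
  fixes M :: "'a::unital_cstar_algebra mat"
  shows "mat_norm M \<le> (\<Sum>i<dim_row M. \<Sum>j<dim_col M. norm (M $$ (i, j)))"
  unfolding mat_norm_def
proof (rule cSUP_least)
  show "{v \<in> carrier_vec (dim_col M). module_norm (v :: 'a vec) \<le> 1} \<noteq> {}"
    unfolding ex_in_conv[symmetric]
    by (rule exI[of _ "0\<^sub>v (dim_col M)"]) (simp add: module_norm_def)
next
  fix v :: "'a vec" assume "v \<in> {v \<in> carrier_vec (dim_col M). module_norm v \<le> 1}"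
  then have v: "dim_vec v = dim_col M" "module_norm v \<le> 1" by auto
  have nv: "norm (vec_index v j) \<le> 1" if "j < dim_col M" for j
    using norm_index_le_module_norm[of j v] v that by simp
  have "module_norm (M *\<^sub>v v) \<le> (\<Sum>i<dim_row M. norm (vec_index (M *\<^sub>v v) i))"
    using module_norm_le_sum[of "M *\<^sub>v v"] by simp
  also have "\<dots> \<le> (\<Sum>i<dim_row M. \<Sum>j<dim_col M. norm (M $$ (i, j)))"
  proof (rule sum_mono)
    fix i assume "i \<in> {..<dim_row M}"
    then have "vec_index (M *\<^sub>v v) i = (\<Sum>j<dim_col M. M $$ (i, j) * vec_index v j)"
      using v by (simp add: scalar_prod_def atLeast0LessThan)
    also have "norm \<dots> \<le> (\<Sum>j<dim_col M. norm (M $$ (i, j)) * 1)"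
      using nv by (intro sum_norm_le order_trans[OF norm_mult_ineq] mult_left_mono) auto
    finally show "norm (vec_index (M *\<^sub>v v) i) \<le> (\<Sum>j<dim_col M. norm (M $$ (i, j)))" by simp
  qed
  finally show "module_norm (M *\<^sub>v v) \<le> (\<Sum>i<dim_row M. \<Sum>j<dim_col M. norm (M $$ (i, j)))" .
qed

section \<open>Finitely supported infinite matrices\<close>

text \<open>All the algebras \<open>M\<^sub>n(A)\<close> are corners of one normed algebra. It carries the norm
  \<open>\<Sum>\<^sub>i\<^sub>j norm (x\<^sub>i\<^sub>j)\<close> instead of the C*-norm: on \<open>M\<^sub>n(A)\<close> the two are equivalent,
  but the former is visibly approximable from above by means of the norm of \<open>A\<close>.\<close>

typedef (overloaded) 'a fmat =
  "{f :: nat \<Rightarrow> nat \<Rightarrow> 'a::zero. \<exists>N. \<forall>i j. N \<le> i \<or> N \<le> j \<longrightarrow> f i j = 0}"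
  morphisms ent Fmat
  by (intro exI[of _ "\<lambda>_ _. 0"]) auto

text \<open>Separate bounds for rows and columns, since partial isometries between projections of
  different sizes are rectangular.\<close>

definition supported :: "nat \<Rightarrow> nat \<Rightarrow> 'a::zero fmat \<Rightarrow> bool" where
  "supported m n X \<longleftrightarrow> (\<forall>i j. m \<le> i \<or> n \<le> j \<longrightarrow> ent X i j = 0)"

lemma supported_exists: "\<exists>N. supported N N X"
  using ent[of X] by (simp add: supported_def)

lemma supported_mono: "supported m n X \<Longrightarrow> m \<le> m' \<Longrightarrow> n \<le> n' \<Longrightarrow> supported m' n' X"
  by (auto simp: supported_def)

lemma ent_Fmat: "(\<And>i j. m \<le> i \<or> n \<le> j \<Longrightarrow> f i j = 0) \<Longrightarrow> ent (Fmat f) i j = f i j"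
  by (subst Fmat_inverse) (auto intro!: exI[of _ "max m n"])

lemma fmat_eqI: "(\<And>i j. ent X i j = ent Y i j) \<Longrightarrow> X = Y"
  by (simp add: ent_inject[symmetric] ext)

definition fmat_of :: "nat \<Rightarrow> nat \<Rightarrow> (nat \<Rightarrow> nat \<Rightarrow> 'a::zero) \<Rightarrow> 'a fmat" where
  "fmat_of m n f = Fmat (\<lambda>i j. if i < m \<and> j < n then f i j else 0)"

lemma ent_fmat_of: "ent (fmat_of m n f) i j = (if i < m \<and> j < n then f i j else 0)"
  unfolding fmat_of_def by (rule ent_Fmat[where m = m and n = n]) auto

lemma supported_fmat_of: "supported m n (fmat_of m n f)"
  by (simp add: supported_def ent_fmat_of)

lemma finite_support: "finite {(i, j). ent X i j \<noteq> 0}"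
proof -
  obtain N where "supported N N X" using supported_exists by blast
  then have "{(i, j). ent X i j \<noteq> 0} \<subseteq> {..<N} \<times> {..<N}"
    by (auto simp: supported_def) (meson not_le)+
  then show ?thesis by (rule finite_subset) auto
qed

instantiation fmat :: (cstar_algebra) real_normed_algebra
begin

definition zero_fmat :: "'a fmat" where "0 = Fmat (\<lambda>_ _. 0)"
definition plus_fmat :: "'a fmat \<Rightarrow> 'a fmat \<Rightarrow> 'a fmat" where
  "X + Y = Fmat (\<lambda>i j. ent X i j + ent Y i j)"
definition minus_fmat :: "'a fmat \<Rightarrow> 'a fmat \<Rightarrow> 'a fmat" where
  "X - Y = Fmat (\<lambda>i j. ent X i j - ent Y i j)"
definition uminus_fmat :: "'a fmat \<Rightarrow> 'a fmat" where "- X = Fmat (\<lambda>i j. - ent X i j)"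
definition scaleR_fmat :: "real \<Rightarrow> 'a fmat \<Rightarrow> 'a fmat" where
  "r *\<^sub>R X = Fmat (\<lambda>i j. r *\<^sub>R ent X i j)"
text \<open>Summing over the nonzero entries of a row keeps the sum finite without choosing a bound;
  \<open>ent_mult\<close> replaces this range by any bound on the support.\<close>

definition times_fmat :: "'a fmat \<Rightarrow> 'a fmat \<Rightarrow> 'a fmat" where
  "X * Y = Fmat (\<lambda>i j. \<Sum>k | ent X i k \<noteq> 0. ent X i k * ent Y k j)"
definition norm_fmat :: "'a fmat \<Rightarrow> real" where
  "norm X = (\<Sum>(i, j) | ent X i j \<noteq> 0. norm (ent X i j))"
definition sgn_fmat :: "'a fmat \<Rightarrow> 'a fmat" where "sgn_fmat X = inverse (norm X) *\<^sub>R X"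
definition dist_fmat :: "'a fmat \<Rightarrow> 'a fmat \<Rightarrow> real" where
  "dist_fmat X Y = norm (X - Y)"
definition uniformity_fmat :: "('a fmat \<times> 'a fmat) filter" where
  "uniformity_fmat = (INF e\<in>{0<..}. principal {(X, Y). dist X Y < e})"
definition open_fmat :: "'a fmat set \<Rightarrow> bool" where
  "open_fmat U \<longleftrightarrow> (\<forall>X\<in>U. eventually (\<lambda>(X', Y). X' = X \<longrightarrow> Y \<in> U) uniformity)"

lemma ent_zero: "ent (0 :: 'a fmat) i j = 0"
  unfolding zero_fmat_def by (rule ent_Fmat) auto

lemma ent_add: "ent (X + Y :: 'a fmat) i j = ent X i j + ent Y i j"
proof -
  obtain M N where "supported M M X" "supported N N Y" using supported_exists by metis
  then show ?thesis unfolding plus_fmat_def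
    by (intro ent_Fmat[where m = "max M N" and n = "max M N"]) (auto simp: supported_def)
qed

lemma ent_diff: "ent (X - Y :: 'a fmat) i j = ent X i j - ent Y i j"
proof -
  obtain M N where "supported M M X" "supported N N Y" using supported_exists by metis
  then show ?thesis unfolding minus_fmat_def
    by (intro ent_Fmat[where m = "max M N" and n = "max M N"]) (auto simp: supported_def)
qed

lemma ent_minus: "ent (- X :: 'a fmat) i j = - ent X i j"
proof -
  obtain M where "supported M M X" using supported_exists by metis
  then show ?thesis unfolding uminus_fmat_def
    by (intro ent_Fmat[where m = M and n = M]) (auto simp: supported_def)
qed

lemma ent_scaleR: "ent (r *\<^sub>R X :: 'a fmat) i j = r *\<^sub>R ent X i j"
proof -
  obtain M where "supported M M X" using supported_exists by metis
  then show ?thesis unfolding scaleR_fmat_def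
    by (intro ent_Fmat[where m = M and n = M]) (auto simp: supported_def)
qed

lemma ent_mult:
  assumes X: "supported m n X"
  shows "ent (X * Y :: 'a fmat) i j = (\<Sum>k<n. ent X i k * ent Y k j)"
proof -
  obtain N where Y: "supported N N Y" using supported_exists by metis
  have "ent (X * Y) i j = (\<Sum>k | ent X i k \<noteq> 0. ent X i k * ent Y k j)"
    unfolding times_fmat_def
  proof (rule ent_Fmat[where m = m and n = N])
    fix i j assume "m \<le> i \<or> N \<le> j"
    then have "(\<forall>k. ent X i k = 0) \<or> (\<forall>k. ent Y k j = 0)"
      using X Y by (auto simp: supported_def)
    then show "(\<Sum>k | ent X i k \<noteq> 0. ent X i k * ent Y k j) = 0" by auto
  qed
  also have "\<dots> = (\<Sum>k<n. ent X i k * ent Y k j)"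
    using X by (intro sum.mono_neutral_left) (auto simp: supported_def, meson not_le)
  finally show ?thesis .
qed

lemma norm_fmat_eq:
  assumes X: "supported m n X"
  shows "norm (X :: 'a fmat) = (\<Sum>i<m. \<Sum>j<n. norm (ent X i j))"
proof -
  have "norm X = (\<Sum>(i, j)\<in>{..<m} \<times> {..<n}. norm (ent X i j))"
    unfolding norm_fmat_def
    using X by (intro sum.mono_neutral_left) (auto simp: supported_def, (meson not_le)+)
  then show ?thesis by (simp add: sum.cartesian_product)
qed

instance
proof
  fix X Y Z :: "'a fmat" and r t :: real
  show "X + Y + Z = X + (Y + Z)" "X + Y = Y + X" "0 + X = X" "- X + X = 0" "X - Y = X + - Y"
    by (auto intro!: fmat_eqI simp: ent_add ent_zero ent_minus ent_diff)
  show "r *\<^sub>R (X + Y) = r *\<^sub>R X + r *\<^sub>R Y" "(r + t) *\<^sub>R X = r *\<^sub>R X + t *\<^sub>R X"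
    "r *\<^sub>R t *\<^sub>R X = (r * t) *\<^sub>R X" "1 *\<^sub>R X = X"
    by (auto intro!: fmat_eqI simp: ent_add ent_scaleR algebra_simps)
  obtain L M N where "supported L L X" "supported M M Y" "supported N N Z" using supported_exists by metis
  then obtain K where K: "supported K K X" "supported K K Y" "supported K K Z"
    using that[of "max L (max M N)"] supported_mono by (smt (verit) max.cobounded1 max.cobounded2 le_trans)
  have K': "supported K K (X + Y)" "supported K K (X * Y)" "supported K K (r *\<^sub>R X)"
    using K by (auto simp: supported_def ent_add ent_mult[OF K(1)] ent_scaleR)
  show "X * Y * Z = X * (Y * Z)"
  proof (rule fmat_eqI)
    fix i j
    have "ent (X * Y * Z) i j = (\<Sum>k<K. \<Sum>l<K. ent X i l * (ent Y l k * ent Z k j))"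
      by (simp only: ent_mult[OF K(1)] ent_mult[OF K'(2)] sum_distrib_right mult.assoc)
    also have "\<dots> = (\<Sum>l<K. \<Sum>k<K. ent X i l * (ent Y l k * ent Z k j))" by (rule sum.swap)
    also have "\<dots> = ent (X * (Y * Z)) i j"
      by (simp only: ent_mult[OF K(1)] ent_mult[OF K(2)] sum_distrib_left)
    finally show "ent (X * Y * Z) i j = ent (X * (Y * Z)) i j" .
  qed
  show "(X + Y) * Z = X * Z + Y * Z"
    by (rule fmat_eqI)
      (simp add: ent_mult[OF K(1)] ent_mult[OF K(2)] ent_mult[OF K'(1)] ent_add
        distrib_right sum.distrib)
  show "X * (Y + Z) = X * Y + X * Z"
    by (rule fmat_eqI) (simp add: ent_mult[OF K(1)] ent_add distrib_left sum.distrib)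
  show "r *\<^sub>R X * Y = r *\<^sub>R (X * Y)"
    by (rule fmat_eqI) (simp add: ent_mult[OF K(1)] ent_mult[OF K'(3)] ent_scaleR scaleR_sum_right)
  show "X * r *\<^sub>R Y = r *\<^sub>R (X * Y)"
    by (rule fmat_eqI) (simp add: ent_mult[OF K(1)] ent_scaleR scaleR_sum_right)
  show "norm (X + Y) \<le> norm X + norm Y"
    unfolding norm_fmat_eq[OF K(1)] norm_fmat_eq[OF K(2)] norm_fmat_eq[OF K'(1)]
    by (simp add: ent_add norm_triangle_ineq sum_mono flip: sum.distrib)
  show "norm (r *\<^sub>R X) = \<bar>r\<bar> * norm X"
    unfolding norm_fmat_eq[OF K(1)] norm_fmat_eq[OF K'(3)] by (simp add: ent_scaleR sum_distrib_left)
  show "(norm X = 0) = (X = 0)"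
  proof
    assume "norm X = 0"
    then have "\<forall>i\<in>{..<K}. \<forall>j\<in>{..<K}. ent X i j = 0"
      unfolding norm_fmat_eq[OF K(1)] by (simp add: sum_nonneg_eq_0_iff sum_nonneg)
    then show "X = 0" using K(1) by (intro fmat_eqI) (simp add: supported_def ent_zero, meson lessThan_iff not_le)
  qed (simp add: norm_fmat_def ent_zero)
  show "norm (X * Y) \<le> norm X * norm Y"
  proof -
    have "norm (X * Y) \<le> (\<Sum>i<K. \<Sum>j<K. \<Sum>k<K. norm (ent X i k) * norm (ent Y k j))"
      unfolding norm_fmat_eq[OF K'(2)] ent_mult[OF K(1)]
      by (intro sum_mono sum_norm_le norm_mult_ineq)
    also have "\<dots> = (\<Sum>i<K. \<Sum>k<K. norm (ent X i k) * (\<Sum>j<K. norm (ent Y k j)))"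
      by (subst sum.swap[of _ "{..<K}" "{..<K}"]) (simp add: sum_distrib_left)
    also have "\<dots> \<le> (\<Sum>i<K. \<Sum>k<K. norm (ent X i k) * norm Y)"
      unfolding norm_fmat_eq[OF K(2)]
      by (intro sum_mono mult_left_mono member_le_sum) (auto intro: sum_nonneg)
    also have "\<dots> = norm X * norm Y" unfolding norm_fmat_eq[OF K(1)] by (simp add: sum_distrib_right)
    finally show ?thesis .
  qed
qed (rule sgn_fmat_def dist_fmat_def uniformity_fmat_def open_fmat_def)+

end

section \<open>Involution and completeness of corners\<close>

lemma ent_sum: "ent (sum F A) i j = (\<Sum>a\<in>A. ent (F a :: 'a::cstar_algebra fmat) i j)"
  by (induction A rule: infinite_finite_induct) (auto simp: ent_zero ent_add)

lemma norm_ent_le: "norm (ent X i j) \<le> norm (X :: 'a::cstar_algebra fmat)"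
proof (cases "ent X i j = 0")
  case False
  then have "(\<lambda>(i, j). norm (ent X i j)) (i, j) \<le> (\<Sum>(i, j) | ent X i j \<noteq> 0. norm (ent X i j))"
    by (intro member_le_sum) (auto simp: finite_support)
  then show ?thesis by (simp add: norm_fmat_def)
qed simp

definition star :: "'a::cstar_algebra fmat \<Rightarrow> 'a fmat" where
  "star X = Fmat (\<lambda>i j. adj (ent X j i))"

lemma ent_star: "ent (star X) i j = adj (ent X j i)"
proof -
  obtain M where "supported M M X" using supported_exists by metis
  then show ?thesis unfolding star_def
    by (intro ent_Fmat[where m = M and n = M]) (auto simp: supported_def)
qed

lemma supported_zero: "supported m n (0 :: 'a::cstar_algebra fmat)"
  by (simp add: supported_def ent_zero)

lemma supported_add: "supported m n X \<Longrightarrow> supported m n Y \<Longrightarrow> supported m n (X + Y :: 'a::cstar_algebra fmat)"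
  by (simp add: supported_def ent_add)

lemma supported_diff: "supported m n X \<Longrightarrow> supported m n Y \<Longrightarrow> supported m n (X - Y :: 'a::cstar_algebra fmat)"
  by (simp add: supported_def ent_diff)

lemma supported_scaleR: "supported m n X \<Longrightarrow> supported m n (r *\<^sub>R X :: 'a::cstar_algebra fmat)"
  by (simp add: supported_def ent_scaleR)

lemma supported_mult:
  assumes "supported l m X" "supported m' n Y" shows "supported l n (X * Y :: 'a::cstar_algebra fmat)"
  using assms(1,2) unfolding supported_def ent_mult[OF assms(1)] by auto

lemma supported_star: "supported m n X \<Longrightarrow> supported n m (star X)"
  by (simp add: supported_def ent_star)

lemmas supported_intros = supported_zero supported_add supported_diff supported_scaleR supported_mult supported_star

lemma star_add: "star (X + Y) = star X + star Y"
  by (rule fmat_eqI) (simp add: ent_star ent_add adj_add)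

lemma star_diff: "star (X - Y) = star X - star Y"
  by (rule fmat_eqI) (simp add: ent_star ent_diff adj_diff)

lemma star_scaleR: "star (r *\<^sub>R X) = r *\<^sub>R star X"
  by (rule fmat_eqI) (simp add: ent_star ent_scaleR adj_scaleR)

lemma star_star [simp]: "star (star X) = X"
  by (rule fmat_eqI) (simp add: ent_star adj_adj)

lemma star_zero [simp]: "star 0 = 0"
  by (rule fmat_eqI) (simp add: ent_star ent_zero)

lemma star_mult: "star (X * Y) = star Y * star X"
proof -
  obtain L M where "supported L L X" "supported M M Y" using supported_exists by metis
  then obtain K where K: "supported K K X" "supported K K Y"
    using supported_mono by (metis max.cobounded1 max.cobounded2)
  show ?thesis
    by (rule fmat_eqI)
      (simp add: ent_star ent_mult[OF K(1)] ent_mult[OF supported_star[OF K(2)]] adj_sum adj_mult)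
qed

lemmas star_simps = star_add star_diff star_scaleR star_mult

lemma norm_star [simp]: "norm (star X) = norm X"
proof -
  obtain M where M: "supported M M X" using supported_exists by metis
  show ?thesis unfolding norm_fmat_eq[OF M] norm_fmat_eq[OF supported_star[OF M]]
    by (subst sum.swap) (simp add: ent_star)
qed

lemma bounded_linear_star: "bounded_linear star"
  by (rule bounded_linear_intro[where K = 1]) (auto simp: star_simps)

lemmas tendsto_star = bounded_linear.tendsto[OF bounded_linear_star]

lemma continuous_on_star: "continuous_on S star"
  by (rule bounded_linear.continuous_on[OF bounded_linear_star continuous_on_id])

lemma fmat_tendsto_iff:
  fixes X :: "nat \<Rightarrow> 'a::cstar_algebra fmat"
  assumes X: "\<And>k. supported m n (X k)" and Y: "supported m n Y"
    and lim: "\<And>i j. i < m \<Longrightarrow> j < n \<Longrightarrow> (\<lambda>k. ent (X k) i j) \<longlonglongrightarrow> ent Y i j"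
  shows "X \<longlonglongrightarrow> Y"
proof (rule LIM_zero_iff[THEN iffD1], rule tendsto_norm_zero_cancel)
  have "norm (X k - Y) = (\<Sum>i<m. \<Sum>j<n. norm (ent (X k) i j - ent Y i j))" for k
    by (simp add: norm_fmat_eq[OF supported_diff[OF X Y]] ent_diff)
  moreover have "(\<lambda>k. \<Sum>i<m. \<Sum>j<n. norm (ent (X k) i j - ent Y i j)) \<longlonglongrightarrow> (\<Sum>i<m. \<Sum>j<n. 0)"
    using lim by (intro tendsto_sum tendsto_norm_zero) (auto simp: LIM_zero_iff)
  ultimately show "(\<lambda>k. norm (X k - Y)) \<longlonglongrightarrow> 0" by simp
qed

text \<open>The algebra of all finitely supported matrices is in general not complete, so limits and
  fixed points are always taken inside a corner of fixed size.\<close>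

lemma complete_supported: "complete {X :: 'a::cstar_algebra fmat. supported m n X}"
proof (rule completeI)
  fix X :: "nat \<Rightarrow> 'a fmat" assume X: "\<forall>k. X k \<in> {X. supported m n X}" and C: "Cauchy X"
  have "Cauchy (\<lambda>k. ent (X k) i j)" for i j
  proof (rule CauchyI)
    fix e :: real assume "0 < e"
    then obtain M where M: "\<forall>k\<ge>M. \<forall>l\<ge>M. norm (X k - X l) < e" using C CauchyD by blast
    then show "\<exists>M. \<forall>k\<ge>M. \<forall>l\<ge>M. norm (ent (X k) i j - ent (X l) i j) < e"
      by (metis ent_diff norm_ent_le le_less_trans)
  qed
  then have lim: "(\<lambda>k. ent (X k) i j) \<longlonglongrightarrow> lim (\<lambda>k. ent (X k) i j)" for i j
    by (simp add: Cauchy_convergent_iff convergent_LIMSEQ_iff)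
  define Y where "Y = fmat_of m n (\<lambda>i j. lim (\<lambda>k. ent (X k) i j))"
  have "supported m n Y" by (simp add: Y_def supported_fmat_of)
  moreover have "X \<longlonglongrightarrow> Y"
    using X lim by (intro fmat_tendsto_iff[of m n]) (auto simp: Y_def supported_fmat_of ent_fmat_of)
  ultimately show "\<exists>l\<in>{X. supported m n X}. X \<longlonglongrightarrow> l" by blast
qed

section \<open>Matrix units and block shifts\<close>

definition unit_fmat :: "nat \<Rightarrow> nat \<Rightarrow> 'a::zero \<Rightarrow> 'a fmat" where
  "unit_fmat i j a = fmat_of (Suc i) (Suc j) (\<lambda>i' j'. if i' = i \<and> j' = j then a else 0)"

lemma ent_unit: "ent (unit_fmat i j a) i' j' = (if i' = i \<and> j' = j then a else 0)"
  by (simp add: unit_fmat_def ent_fmat_of)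

lemma supported_unit: "i < m \<Longrightarrow> j < n \<Longrightarrow> supported m n (unit_fmat i j a)"
  by (auto simp: supported_def ent_unit)

lemma star_unit: "star (unit_fmat i j a) = unit_fmat j i (adj a)"
  by (rule fmat_eqI) (simp add: ent_star ent_unit)

lemma unit_mult: "unit_fmat i j a * unit_fmat k l b = (if j = k then unit_fmat i l (a * b) else 0)"
proof (rule fmat_eqI)
  fix i' j'
  have "ent (unit_fmat i j a * unit_fmat k l b) i' j'
      = (\<Sum>k'<Suc j. (if i' = i \<and> k' = j then a else 0) * (if k' = k \<and> j' = l then b else 0))"
    by (subst ent_mult[OF supported_unit[of i "Suc i" j "Suc j"]]) (auto simp: ent_unit)
  also have "\<dots> = ent (if j = k then unit_fmat i l (a * b) else 0) i' j'"
    by (auto simp: ent_unit ent_zero if_distrib[of "\<lambda>x. x * _"] sum.delta cong: if_cong)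
  finally show "ent (unit_fmat i j a * unit_fmat k l b) i' j'
    = ent (if j = k then unit_fmat i l (a * b) else 0) i' j'" .
qed

lemma unit_add: "unit_fmat i j (a + b) = unit_fmat i j a + unit_fmat i j (b :: 'a::cstar_algebra)"
  by (rule fmat_eqI) (simp add: ent_unit ent_add)

lemma unit_zero: "unit_fmat i j 0 = (0 :: 'a::cstar_algebra fmat)"
  by (rule fmat_eqI) (simp add: ent_unit ent_zero)

lemma fmat_eq_sum_unit:
  assumes "supported m n X"
  shows "X = (\<Sum>i<m. \<Sum>j<n. unit_fmat i j (ent X i j :: 'a::cstar_algebra))"
proof (rule fmat_eqI)
  fix i' j'
  have "(\<Sum>j<n. if i' = i \<and> j' = j then ent X i j else 0) = (if i' = i \<and> j' < n then ent X i j' else 0)" for i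
    by (cases "i' = i") (auto simp: sum.delta')
  then have "ent (\<Sum>i<m. \<Sum>j<n. unit_fmat i j (ent X i j)) i' j'
      = (\<Sum>i<m. if i' = i \<and> j' < n then ent X i j' else 0)"
    by (simp add: ent_sum ent_unit)
  also have "\<dots> = (if i' < m \<and> j' < n then ent X i' j' else 0)"
    by (cases "j' < n") (auto simp: sum.delta')
  finally show "ent X i' j' = ent (\<Sum>i<m. \<Sum>j<n. unit_fmat i j (ent X i j)) i' j'"
    using assms by (auto simp: supported_def)
qed

text \<open>If \<open>X\<close> lives in the upper left corner of size \<open>n\<close>, then
  \<open>X + shift n n Y\<close> is the diagonal sum. Different offsets \<open>a\<close> and
  \<open>b\<close> serve the partial isometries between two such sums.\<close>

definition shift :: "nat \<Rightarrow> nat \<Rightarrow> 'a::zero fmat \<Rightarrow> 'a fmat" where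
  "shift a b X = Fmat (\<lambda>i j. if a \<le> i \<and> b \<le> j then ent X (i - a) (j - b) else 0)"

lemma ent_shift: "ent (shift a b X) i j = (if a \<le> i \<and> b \<le> j then ent X (i - a) (j - b) else 0)"
proof -
  obtain M where "supported M M X" using supported_exists by metis
  then show ?thesis unfolding shift_def
    by (intro ent_Fmat[where m = "a + M" and n = "b + M"]) (auto simp: supported_def)
qed

lemma supported_shift: "supported m n X \<Longrightarrow> supported (a + m) (b + n) (shift a b X)"
  by (auto simp: supported_def ent_shift)

lemma shift_add: "shift a b (X + Y) = shift a b X + shift a b (Y :: 'a::cstar_algebra fmat)"
  by (rule fmat_eqI) (simp add: ent_shift ent_add)

lemma shift_diff: "shift a b (X - Y) = shift a b X - shift a b (Y :: 'a::cstar_algebra fmat)"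
  by (rule fmat_eqI) (simp add: ent_shift ent_diff)

lemma shift_zero: "shift a b 0 = (0 :: 'a::cstar_algebra fmat)"
  by (rule fmat_eqI) (simp add: ent_shift ent_zero)

lemma shift_shift: "shift a b (shift c d X) = shift (a + c) (b + d) X"
  by (rule fmat_eqI) (auto simp: ent_shift add.commute)

lemma star_shift: "star (shift a b X) = shift b a (star X)"
  by (rule fmat_eqI) (auto simp: ent_shift ent_star)

lemma shift_unit: "shift a b (unit_fmat i j x) = unit_fmat (a + i) (b + j) x"
  by (rule fmat_eqI) (auto simp: ent_shift ent_unit)

lemma shift_mult: "shift a b X * shift b c Y = shift a c (X * Y :: 'a::cstar_algebra fmat)"
proof (rule fmat_eqI)
  fix i j
  obtain M where M: "supported M M X" using supported_exists by metis
  have "ent (shift a b X * shift b c Y) i j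
      = (\<Sum>k<b + M. ent (shift a b X) i k * ent (shift b c Y) k j)"
    by (rule ent_mult[OF supported_shift[OF M]])
  also have "\<dots> = (\<Sum>k\<in>{b..<b + M}. ent (shift a b X) i k * ent (shift b c Y) k j)"
    by (rule sum.mono_neutral_right) (auto simp: ent_shift)
  also have "\<dots> = (\<Sum>k<M. ent (shift a b X) i (b + k) * ent (shift b c Y) (b + k) j)"
    by (rule sum.reindex_bij_witness[of _ "\<lambda>k. b + k" "\<lambda>k. k - b"]) auto
  also have "\<dots> = ent (shift a c (X * Y)) i j"
    by (cases "a \<le> i"; cases "c \<le> j") (simp_all add: ent_shift ent_mult[OF M])
  finally show "ent (shift a b X * shift b c Y) i j = ent (shift a c (X * Y)) i j" .
qed

lemma mult_shift_zero:
  assumes "supported m n X" "n \<le> c" shows "X * shift c d Y = (0 :: 'a::cstar_algebra fmat)"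
  using assms(2) by (intro fmat_eqI) (simp add: ent_mult[OF assms(1)] ent_shift ent_zero)

lemma shift_mult_zero:
  assumes "supported m n X" "m \<le> d" shows "shift c d Y * X = (0 :: 'a::cstar_algebra fmat)"
proof -
  have "star (shift c d Y * X) = 0"
    by (simp add: star_mult star_shift mult_shift_zero[OF supported_star[OF assms(1)] assms(2)])
  then show ?thesis using star_star star_zero by metis
qed

lemma norm_shift [simp]: "norm (shift a b X) = norm (X :: 'a::cstar_algebra fmat)"
proof -
  have "(\<Sum>(i, j) | ent X i j \<noteq> 0. norm (ent X i j))
      = (\<Sum>(i, j) | ent (shift a b X) i j \<noteq> 0. norm (ent (shift a b X) i j))"
    by (rule sum.reindex_bij_witness[of _ "\<lambda>(i, j). (i - a, j - b)" "\<lambda>(i, j). (a + i, b + j)"])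
      (auto simp: ent_shift split: if_splits)
  then show ?thesis by (simp add: norm_fmat_def)
qed

section \<open>Passing between matrices and the common algebra\<close>

definition emb :: "'a::zero mat \<Rightarrow> 'a fmat" where
  "emb M = fmat_of (dim_row M) (dim_col M) (\<lambda>i j. M $$ (i, j))"

definition corner :: "nat \<Rightarrow> nat \<Rightarrow> 'a::zero fmat \<Rightarrow> 'a mat" where
  "corner m n X = mat m n (\<lambda>(i, j). ent X i j)"

lemma ent_emb: "ent (emb M) i j = (if i < dim_row M \<and> j < dim_col M then M $$ (i, j) else 0)"
  by (simp add: emb_def ent_fmat_of)

lemma dim_corner [simp]: "dim_row (corner m n X) = m" "dim_col (corner m n X) = n"
  by (auto simp: corner_def)

lemma corner_carrier [simp]: "corner m n X \<in> carrier_mat m n"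
  by (simp add: corner_def)

lemma supported_emb: "supported (dim_row M) (dim_col M) (emb M)"
  by (auto simp: supported_def ent_emb)

lemma emb_corner: "supported m n X \<Longrightarrow> emb (corner m n X) = X"
  by (rule fmat_eqI) (auto simp: ent_emb corner_def supported_def)

text \<open>\<open>emb\<close> forgets the size and so identifies a matrix with its diagonal sums
  with zero matrices; equal dimensions undo this.\<close>

lemma emb_inject:
  assumes "emb M = emb N" "dim_row M = dim_row N" "dim_col M = dim_col N" shows "M = N"
proof (rule eq_matI)
  fix i j assume "i < dim_row N" "j < dim_col N"
  then show "M $$ (i, j) = N $$ (i, j)"
    using arg_cong[OF assms(1), of "\<lambda>X. ent X i j"] assms(2,3) by (simp add: ent_emb)
qed (use assms in auto)

lemma emb_mult: "dim_col M = dim_row N \<Longrightarrow> emb (M * N) = emb M * emb (N :: 'a::cstar_algebra mat)"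
  by (rule fmat_eqI)
    (auto simp: ent_mult[OF supported_emb] ent_emb scalar_prod_def atLeast0LessThan)

lemma emb_mat_adj: "emb (mat_adj M) = star (emb M)"
  by (rule fmat_eqI) (auto simp: ent_star ent_emb mat_adj_def)

lemma dim_mat_adj [simp]: "dim_row (mat_adj M) = dim_col M" "dim_col (mat_adj M) = dim_row M"
  by (auto simp: mat_adj_def)

section \<open>Murray--von Neumann equivalence of finitely supported projections\<close>

definition fproj :: "'a::cstar_algebra fmat \<Rightarrow> bool" where
  "fproj p \<longleftrightarrow> p * p = p \<and> star p = p"

definition fequiv :: "'a::cstar_algebra fmat \<Rightarrow> 'a fmat \<Rightarrow> bool" where
  "fequiv p q \<longleftrightarrow> (\<exists>v. star v * v = p \<and> v * star v = q)"

lemma fproj_mult_left: "fproj p \<Longrightarrow> p * (p * x) = p * x"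
  by (metis fproj_def mult.assoc)

lemma mat_projections_iff: "p \<in> mat_projections n \<longleftrightarrow> p \<in> carrier_mat n n \<and> fproj (emb p)"
proof (cases "p \<in> carrier_mat n n")
  case True
  then have d: "dim_row p = n" "dim_col p = n" by auto
  then have "p * p = p \<longleftrightarrow> emb p * emb p = emb p"
    by (metis emb_mult emb_inject index_mult_mat(2,3))
  moreover have "mat_adj p = p \<longleftrightarrow> star (emb p) = emb p"
    using d by (metis emb_mat_adj emb_inject dim_mat_adj)
  ultimately show ?thesis using True by (simp add: mat_projections_def fproj_def)
qed (simp add: mat_projections_def)

lemma projections_iff:
  "p \<in> projections \<longleftrightarrow> dim_row p = dim_col p \<and> 1 \<le> dim_row p \<and> fproj (emb p)"
  by (auto simp: projections_def mat_projections_iff)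

lemma fequiv_refl: "fproj p \<Longrightarrow> fequiv p p"
  by (auto simp: fequiv_def fproj_def intro: exI[of _ p])

lemma fequiv_sym: "fequiv p q \<Longrightarrow> fequiv q p"
  unfolding fequiv_def by (metis star_star)

text \<open>That \<open>v\<close> equals \<open>q * v * p\<close> would follow from the C*-identity,
  which the entrywise norm need not satisfy. The compression has the same initial and final
  projections, and its outer factors also bound its support.\<close>

lemma fequiv_partial_isometry:
  assumes p: "fproj p" and q: "fproj q" and v: "star v * v = p" "v * star v = q"
  defines "w \<equiv> q * v * p"
  shows "star w * w = p" "w * star w = q" "w = q * w" "w = w * p"
proof -
  have pp: "p * p = p" "star p = p" and qq: "q * q = q" "star q = q"
    using p q by (auto simp: fproj_def)
  have "star w * w = p * (star v * (q * q) * v) * p"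
    by (simp add: w_def star_mult pp(2) qq(2) mult.assoc)
  also have "\<dots> = p * ((star v * v) * (star v * v)) * p"
    unfolding qq(1) unfolding v(2)[symmetric] by (simp only: mult.assoc)
  finally show "star w * w = p" by (simp add: v pp)
  have "w * star w = q * (v * (p * p) * star v) * q"
    by (simp add: w_def star_mult pp(2) qq(2) mult.assoc)
  also have "\<dots> = q * ((v * star v) * (v * star v)) * q"
    unfolding pp(1) unfolding v(1)[symmetric] by (simp only: mult.assoc)
  finally show "w * star w = q" by (simp add: v qq)
  show "w = q * w" "w = w * p" by (simp_all add: w_def pp mult.assoc fproj_mult_left[OF q])
qed

lemma fequiv_trans:
  assumes p: "fproj p" and q: "fproj q" and r: "fproj r" and "fequiv p q" "fequiv q r"
  shows "fequiv p r"
proof -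
  obtain v where "star v * v = p" "v * star v = q" using assms by (auto simp: fequiv_def)
  from fequiv_partial_isometry[OF p q this] obtain v where
    v: "star v * v = p" "v * star v = q" "v = q * v" by blast
  obtain u where "star u * u = q" "u * star u = r" using assms by (auto simp: fequiv_def)
  from fequiv_partial_isometry[OF q r this] obtain u where
    u: "star u * u = q" "u * star u = r" "u = u * q" by blast
  have "star (u * v) * (u * v) = star v * (star u * u * v)" by (simp add: star_mult mult.assoc)
  also have "\<dots> = p" using u v by simp
  finally have 1: "star (u * v) * (u * v) = p" .
  have "(u * v) * star (u * v) = u * (v * star v) * star u" by (simp add: star_mult mult.assoc)
  also have "\<dots> = r" unfolding v(2) using u by metis
  finally show ?thesis using 1 by (auto simp: fequiv_def)
qed

lemma mvn_equiv_iff: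
  "(p, q) \<in> mvn_equiv \<longleftrightarrow> p \<in> projections \<and> q \<in> projections \<and> fequiv (emb p) (emb q)"
proof (cases "p \<in> projections \<and> q \<in> projections")
  case True
  then have fp: "fproj (emb p)" and fq: "fproj (emb q)"
    and d: "dim_col p = dim_row p" "dim_col q = dim_row q" by (auto simp: projections_iff)
  show ?thesis
  proof
    assume "(p, q) \<in> mvn_equiv"
    then obtain v where v: "v \<in> carrier_mat (dim_row q) (dim_row p)"
        "mat_adj v * v = p" "v * mat_adj v = q"
      by (auto simp: mvn_equiv_def)
    have "star (emb v) * emb v = emb p" "emb v * star (emb v) = emb q"
      using v d emb_mult[of "mat_adj v" v] emb_mult[of v "mat_adj v"] by (auto simp: emb_mat_adj)
    then show "p \<in> projections \<and> q \<in> projections \<and> fequiv (emb p) (emb q)"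
      using True by (auto simp: fequiv_def)
  next
    assume "p \<in> projections \<and> q \<in> projections \<and> fequiv (emb p) (emb q)"
    then obtain v where "star v * v = emb p" "v * star v = emb q" by (auto simp: fequiv_def)
    from fequiv_partial_isometry[OF fp fq this] obtain w where
      w: "star w * w = emb p" "w * star w = emb q" "w = emb q * w" "w = w * emb p" by blast
    obtain K where "supported K K w" using supported_exists by blast
    then have "supported (dim_row q) (dim_row p) (emb q * w * emb p)"
      using d by (metis supported_mult supported_emb)
    then have ww: "supported (dim_row q) (dim_row p) w" using w by metis
    define V where "V = corner (dim_row q) (dim_row p) w"
    have V: "emb V = w" "V \<in> carrier_mat (dim_row q) (dim_row p)"
      using emb_corner[OF ww] by (auto simp: V_def)
    then have dV: "dim_row V = dim_row q" "dim_col V = dim_row p" by auto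
    have "mat_adj V * V = p" "V * mat_adj V = q"
      using d dV w V(1) by (auto intro!: emb_inject simp: emb_mult emb_mat_adj)
    then show "(p, q) \<in> mvn_equiv" using True V by (auto simp: mvn_equiv_def)
  qed
qed (auto simp: mvn_equiv_def)

lemma equiv_mvn_equiv: "equiv projections mvn_equiv"
proof (rule equivI)
  show "mvn_equiv \<subseteq> projections \<times> projections" by (auto simp: mvn_equiv_def)
  show "refl_on projections mvn_equiv"
    by (auto simp: refl_on_def mvn_equiv_iff projections_iff fequiv_refl)
  show "sym mvn_equiv" by (auto simp: sym_def mvn_equiv_iff intro: fequiv_sym)
  show "trans mvn_equiv"
    unfolding trans_def mvn_equiv_iff by (meson fequiv_trans projections_iff)
qed

lemma mvn_class_eq_iff:
  "p \<in> projections \<Longrightarrow> q \<in> projections \<Longrightarrow> mvn_class p = mvn_class q \<longleftrightarrow> fequiv (emb p) (emb q)"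
  unfolding mvn_class_def using eq_equiv_class_iff[OF equiv_mvn_equiv] mvn_equiv_iff by blast

section \<open>Diagonal sums\<close>

lemma emb_diag_sum:
  "emb (diag_sum p q) = emb p + shift (dim_row p) (dim_col p) (emb (q :: 'a::cstar_algebra mat))"
  by (rule fmat_eqI) (auto simp: diag_sum_def ent_emb ent_add ent_shift)

lemma dim_diag_sum [simp]:
  "dim_row (diag_sum p q) = dim_row p + dim_row q" "dim_col (diag_sum p q) = dim_col p + dim_col q"
  by (auto simp: diag_sum_def)

lemma fproj_block:
  assumes "supported n n p" "fproj p" "fproj q" shows "fproj (p + shift n n q)"
  using assms by (simp add: fproj_def star_add star_shift shift_mult algebra_simps
      mult_shift_zero shift_mult_zero)

lemma diag_sum_projections:
  "p \<in> projections \<Longrightarrow> q \<in> projections \<Longrightarrow> diag_sum p q \<in> projections"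
  unfolding projections_iff emb_diag_sum using supported_emb[of p] by (auto simp: fproj_block)

lemma fequiv_block:
  assumes p: "fproj p" "supported n n p" and p': "fproj p'" "supported n' n' p'"
    and "fequiv p p'" "fequiv q q'"
  shows "fequiv (p + shift n n q) (p' + shift n' n' q')"
proof -
  obtain v where "star v * v = p" "v * star v = p'" using assms by (auto simp: fequiv_def)
  from fequiv_partial_isometry[OF p(1) p'(1) this] obtain v where
    v: "star v * v = p" "v * star v = p'" "v = p' * v" "v = v * p" by blast
  obtain K where "supported K K v" using supported_exists by blast
  then have "supported n' n (p' * v * p)" using p p' by (metis supported_mult)
  then have wv: "supported n' n v" using v by metis
  obtain w where w: "star w * w = q" "w * star w = q'" using assms by (auto simp: fequiv_def)
  let ?V = "v + shift n' n w"
  have "star ?V * ?V = p + shift n n q" "?V * star ?V = p' + shift n' n' q'"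
    using wv supported_star[OF wv] v w
    by (simp_all add: star_add star_shift algebra_simps shift_mult mult_shift_zero shift_mult_zero)
  then show ?thesis by (auto simp: fequiv_def)
qed

lemma mvn_add_class:
  assumes p: "p \<in> projections" and q: "q \<in> projections"
  shows "mvn_add (mvn_class p) (mvn_class q) = mvn_class (diag_sum p q)"
proof -
  have "mvn_class (diag_sum p' q') = mvn_class (diag_sum p q)"
    if "p' \<in> mvn_class p" "q' \<in> mvn_class q" for p' q'
  proof -
    from that have P: "p' \<in> projections" "q' \<in> projections"
        and E: "fequiv (emb p) (emb p')" "fequiv (emb q) (emb q')"
      by (auto simp: mvn_class_def mvn_equiv_iff)
    have d: "dim_col p = dim_row p" "dim_col p' = dim_row p'"
      using p P by (auto simp: projections_iff)
    have "fequiv (emb (diag_sum p q)) (emb (diag_sum p' q'))"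
      unfolding emb_diag_sum d using p q P E supported_emb[of p] supported_emb[of p']
      by (intro fequiv_block) (auto simp: projections_iff)
    then show ?thesis
      using mvn_class_eq_iff diag_sum_projections p q P by blast
  qed
  moreover have "p \<in> mvn_class p" "q \<in> mvn_class q"
    using p q by (auto simp: mvn_class_def mvn_equiv_iff projections_iff fequiv_refl)
  ultimately show ?thesis unfolding mvn_add_def by blast
qed

text \<open>With \<open>y = (a* a)\<^sup>1\<^sup>/\<^sup>2 = p - g\<close> and \<open>z = p + g z\<close> the inverse of \<open>y\<close> in the corner of \<open>p\<close>,
  the polar part \<open>a z\<close> of \<open>a\<close> is the required partial isometry.\<close>

lemma fequiv_approx:
  fixes p q a :: "'a::cstar_algebra fmat"
  assumes p: "fproj p" and q: "fproj q" and a: "q * a = a" "a * p = a"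
    and na: "norm (star a * a - p) < 1" "norm (a * star a - q) < 1"
  shows "fequiv p q"
proof -
  have pp: "p * p = p" "star p = p" and qq: "q * q = q" "star q = q"
    using p q by (auto simp: fproj_def)
  have a': "star a * q = star a" "p * star a = star a"
    using a pp qq by (metis star_mult)+
  define e where "e = p - star a * a"
  have e: "norm e < 1" "star e = e" "p * e = e"
    using na(1) a' by (auto simp: e_def norm_minus_commute star_simps pp algebra_simps simp flip: mult.assoc)
  obtain K1 K2 where "supported K1 K1 p" "supported K2 K2 a" using supported_exists by metis
  then obtain K where K: "supported K K p" "supported K K a"
    using supported_mono by (metis max.cobounded1 max.cobounded2)
  then have Ke: "supported K K e"
    using supported_diff[OF K(1) supported_mult[OF supported_star[OF K(2)] K(2)]] by (simp add: e_def)
  have cl: "closed {g :: 'a fmat. star g = g \<and> p * g = g}"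
    by (intro closed_Collect_conj closed_Collect_eq continuous_intros continuous_on_star)
  \<comment> \<open>In the corner of \<open>p\<close> the unit is \<open>p\<close>. The conditions
    \<open>star g = g\<close> and \<open>p * g = g\<close> together also give
    \<open>g * p = g\<close>, so \<open>g\<close> lies in that corner.\<close>
  have "\<exists>g\<in>{g. supported K K g} \<inter> {g. star g = g \<and> p * g = g}. norm g < 1 \<and> g = (1/2) *\<^sub>R (e + g * g)"
  proof (rule contraction_fixed_point_sqrt)
    fix g assume "g \<in> {g. supported K K g} \<inter> {g. star g = g \<and> p * g = g}"
    then show "(1/2) *\<^sub>R (e + g * g) \<in> {g. supported K K g} \<inter> {g. star g = g \<and> p * g = g}"
      using e Ke supported_mult[of K K g K K g]
      by (auto intro!: supported_add supported_scaleR simp: star_simps algebra_simps simp flip: mult.assoc)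
  qed (use e cl in \<open>auto simp: complete_supported complete_Int_closed supported_intros\<close>)
  then obtain g where g: "supported K K g" "star g = g" "p * g = g" "norm g < 1"
    "g = (1/2) *\<^sub>R (e + g * g)" by blast
  note g5 = g(5) and g = g(1-4)
  have gp: "g * p = g" using g(2,3) pp by (metis star_mult)
  have "2 *\<^sub>R g = e + g * g" by (subst (1) g5) simp
  then have yy: "(p - g) * (p - g) = star a * a"
    by (simp add: algebra_simps g gp pp e_def scaleR_2)
  have cl2: "closed {z :: 'a fmat. star z = z \<and> z * g = g * z \<and> p * z = z}"
    by (intro closed_Collect_conj closed_Collect_eq continuous_intros continuous_on_star)
  have "\<exists>z\<in>{z. supported K K z} \<inter> {z. star z = z \<and> z * g = g * z \<and> p * z = z}. z = p + g * z"
  proof (rule contraction_fixed_point_mult)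
    show "{z. supported K K z} \<inter> {z. star z = z \<and> z * g = g * z \<and> p * z = z} \<noteq> {}"
      using supported_zero[where 'a='a, of K K] by force
    fix z assume z: "z \<in> {z. supported K K z} \<inter> {z. star z = z \<and> z * g = g * z \<and> p * z = z}"
    have "(g * z) * g = g * (g * z)" using z by (simp add: mult.assoc)
    moreover have "p * (g * z) = g * z" using g by (simp flip: mult.assoc)
    ultimately show "p + g * z \<in> {z. supported K K z} \<inter> {z. star z = z \<and> z * g = g * z \<and> p * z = z}"
      using z K g gp pp supported_mult[of K K g K K z]
      by (auto intro!: supported_add simp: star_simps distrib_left distrib_right)
  qed (use g cl2 in \<open>auto simp: complete_supported complete_Int_closed\<close>)
  then obtain z where z: "star z = z" "z * g = g * z" "p * z = z" and z_eq: "z = p + g * z" by blast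
  have gz: "g * z = z - p" by (subst (2) z_eq) simp
  have zp: "z * p = z" using z pp by (metis star_mult)
  define y where "y = p - g"
  have yz: "y * z = p" "z * y = p"
    using z zp gz by (simp_all add: y_def left_diff_distrib right_diff_distrib)
  have yy: "y * y = star a * a" using yy by (simp add: y_def)
  have py: "p * y = y" "y * p = y" by (simp_all add: y_def algebra_simps g gp pp)
  define w where "w = a * z"
  have sw: "star w = z * star a" by (simp add: w_def star_mult z)
  have "star w * w = z * (y * y) * z" unfolding sw unfolding w_def yy by (simp add: mult.assoc)
  also have "\<dots> = (z * y) * (y * z)" by (simp add: mult.assoc)
  finally have 1: "star w * w = p" by (simp add: yz pp)
  have "w * star w * a = a * (z * (z * (star a * a)))" unfolding sw unfolding w_def by (simp add: mult.assoc)
  also have "z * (z * (star a * a)) = z * ((z * y) * y)" unfolding yy[symmetric] by (simp add: mult.assoc)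
  finally have wwa: "w * star w * a = a" by (simp add: yz py a)
  \<comment> \<open>Instead of a second polar decomposition: \<open>u\<close> annihilates
    \<open>a * star a\<close>, so \<open>u = u * (q - a * star a)\<close>, and the second factor has
    norm below 1, which forces \<open>u = 0\<close>.\<close>
  define u where "u = q - w * star w"
  have u1: "u * (a * star a) = 0"
    by (simp add: u_def left_diff_distrib a wwa flip: mult.assoc)
  have "w * star w * q = w * star w" unfolding sw by (simp add: mult.assoc a')
  then have u2: "u * q = u" by (simp add: u_def left_diff_distrib qq)
  have "u = u * (q - a * star a)" by (simp add: right_diff_distrib u1 u2)
  then have "norm u \<le> norm u * norm (q - a * star a)" by (metis norm_mult_ineq)
  moreover have "norm (q - a * star a) < 1" using na(2) by (simp add: norm_minus_commute)
  ultimately have "norm u = 0"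
    by (smt (verit) mult_less_cancel_left2 norm_ge_zero mult_le_cancel_left1)
  then have "w * star w = q" by (simp add: u_def)
  with 1 show ?thesis by (auto simp: fequiv_def)
qed

section \<open>Computable functions on encoded data\<close>

inductive_cases evaluates_PZeroE: "evaluates PZero x y"
inductive_cases evaluates_PSuccE: "evaluates PSucc x y"
inductive_cases evaluates_PFstE: "evaluates PFst x y"
inductive_cases evaluates_PSndE: "evaluates PSnd x y"
inductive_cases evaluates_PPairE: "evaluates (PPair f g) x y"
inductive_cases evaluates_PCompE: "evaluates (PComp f g) x y"
inductive_cases evaluates_PRecE: "evaluates (PRec f g) x y"
inductive_cases evaluates_PMuE: "evaluates (PMu f) x y"

lemma evaluates_deterministic: "evaluates c x y \<Longrightarrow> evaluates c x z \<Longrightarrow> z = y"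
proof (induction arbitrary: z rule: evaluates.induct)
  case (rec_0 f a y g)
  from rec_0.prems show ?case
    by (rule evaluates_PRecE) (use rec_0.IH in auto)
next
  case (rec_Suc f g a n y z')
  from rec_Suc.prems show ?case
    by (rule evaluates_PRecE) (use rec_Suc.IH in auto)
next
  case (mu f x n)
  from mu.prems show ?case
  proof (rule evaluates_PMuE)
    assume z: "evaluates f (prod_encode (x, z)) 0"
      "\<And>m. m < z \<Longrightarrow> \<exists>y. evaluates f (prod_encode (x, m)) (Suc y)"
    have "\<not> n < z"
    proof
      assume "n < z"
      then obtain y where "evaluates f (prod_encode (x, n)) (Suc y)" using z(2) by blast
      then show False using mu.IH(1) by blast
    qed
    moreover have "\<not> z < n"
    proof
      assume "z < n"
      then show False using mu.IH(2) z(1) by blast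
    qed
    ultimately show ?thesis by linarith
  qed
next
  case (pair f x a g b)
  from pair.prems show ?case
    by (rule evaluates_PPairE) (use pair.IH in blast)
next
  case (comp g x y f z')
  from comp.prems show ?case
    by (rule evaluates_PCompE) (use comp.IH in blast)
qed (auto elim: evaluates_PZeroE evaluates_PSuccE evaluates_PFstE evaluates_PSndE)

fun const_prog :: "nat \<Rightarrow> prog" where
  "const_prog 0 = PZero"
| "const_prog (Suc n) = PComp PSucc (const_prog n)"

lemma evaluates_const_prog: "evaluates (const_prog n) x n"
  by (induction n) (auto intro: evaluates.intros)

lemma evaluates_id: "evaluates (PPair PFst PSnd) x x"
  by (metis evaluates.pair evaluates.first evaluates.second prod_decode_inverse surj_pair)

lemma computable_const: "computable (\<lambda>_. n)"
  unfolding computable_def using evaluates_const_prog by blast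

lemma computable_id: "computable (\<lambda>x. x)"
  unfolding computable_def using evaluates_id by blast

lemma computable_Suc: "computable Suc"
  unfolding computable_def using evaluates.succ by blast

lemma computable_fst: "computable (\<lambda>x. fst (prod_decode x))"
  unfolding computable_def by (metis evaluates.first prod_decode_inverse prod.collapse)

lemma computable_snd: "computable (\<lambda>x. snd (prod_decode x))"
  unfolding computable_def by (metis evaluates.second prod_decode_inverse prod.collapse)

lemma computable_comp: "computable f \<Longrightarrow> computable g \<Longrightarrow> computable (\<lambda>x. f (g x))"
  unfolding computable_def by (metis evaluates.comp)

lemma computable_pair: "computable f \<Longrightarrow> computable g \<Longrightarrow> computable (\<lambda>x. prod_encode (f x, g x))"
  unfolding computable_def by (metis evaluates.pair)

lemma computable_rec:
  assumes "computable f" "computable g"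
  shows "computable (\<lambda>x. rec_nat (f (fst (prod_decode x)))
    (\<lambda>n r. g (prod_encode (fst (prod_decode x), prod_encode (n, r)))) (snd (prod_decode x)))"
proof -
  from assms obtain c d where cd: "\<And>x. evaluates c x (f x)" "\<And>x. evaluates d x (g x)"
    by (auto simp: computable_def)
  have "evaluates (PRec c d) (prod_encode (a, n))
      (rec_nat (f a) (\<lambda>n r. g (prod_encode (a, prod_encode (n, r)))) n)" for a n
    by (induction n) (auto intro: evaluates.intros cd)
  then show ?thesis unfolding computable_def by (metis prod.collapse prod_decode_inverse)
qed

lemma ce_set_exists:
  assumes "computable f"
  shows "ce_set {x. \<exists>n. f (prod_encode (x, n)) = 0}"
proof -
  from assms obtain c where c: "\<And>x. evaluates c x (f x)" by (auto simp: computable_def)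
  have "(\<exists>n. f (prod_encode (x, n)) = 0) \<longleftrightarrow> (\<exists>y. evaluates (PMu c) x y)" for x
  proof
    assume ex: "\<exists>n. f (prod_encode (x, n)) = 0"
    define n where "n = (LEAST n. f (prod_encode (x, n)) = 0)"
    have "f (prod_encode (x, n)) = 0" unfolding n_def using ex by (rule LeastI_ex)
    moreover have "\<exists>y. evaluates c (prod_encode (x, m)) (Suc y)" if "m < n" for m
      using not_less_Least[of m "\<lambda>n. f (prod_encode (x, n)) = 0"] that c[of "prod_encode (x, m)"]
      by (metis n_def not0_implies_Suc)
    ultimately have "evaluates (PMu c) x n" using c by (metis evaluates.mu)
    then show "\<exists>y. evaluates (PMu c) x y" by blast
  next
    assume "\<exists>y. evaluates (PMu c) x y"
    then obtain n where "evaluates c (prod_encode (x, n)) 0" by (auto elim: evaluates_PMuE)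
    then have "f (prod_encode (x, n)) = 0" using c evaluates_deterministic by blast
    then show "\<exists>n. f (prod_encode (x, n)) = 0" by blast
  qed
  then show ?thesis unfolding ce_set_def by auto
qed

section \<open>Encodable types and computable maps between them\<close>

text \<open>A bijection rather than an injection: every number is then a code, so a map between
  encodable types is a total function of codes, and every number can later serve as a
  letter.\<close>

class encodable =
  fixes enc :: "'a \<Rightarrow> nat"
  assumes bij_enc: "bij enc"

definition dec :: "nat \<Rightarrow> 'a::encodable" where "dec = inv_into UNIV enc"

lemma dec_enc [simp]: "dec (enc x) = x"
  unfolding dec_def by (rule inv_f_f) (rule bij_is_inj[OF bij_enc])

lemma enc_dec [simp]: "enc (dec n) = n"
  unfolding dec_def by (rule surj_f_inv_f) (rule bij_is_surj[OF bij_enc])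

lemma enc_inject [simp]: "enc x = enc y \<longleftrightarrow> x = y"
  by (metis dec_enc)

instantiation nat :: encodable
begin
definition enc_nat :: "nat \<Rightarrow> nat" where "enc_nat n = n"
instance by standard (simp add: enc_nat_def[abs_def] bij_def inj_def)
end

instantiation prod :: (encodable, encodable) encodable
begin
definition enc_prod :: "'a \<times> 'b \<Rightarrow> nat" where "enc_prod p = prod_encode (enc (fst p), enc (snd p))"
instance
proof
  show "bij (enc :: 'a \<times> 'b \<Rightarrow> nat)"
    by (rule bij_betw_byWitness[where f' = "\<lambda>n. map_prod dec dec (prod_decode n)"])
      (auto simp: enc_prod_def)
qed
end

instantiation list :: (encodable) encodable
begin
definition enc_list :: "'a list \<Rightarrow> nat" where "enc_list xs = list_encode (map enc xs)"
instance
proof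
  have "map dec (map enc xs) = xs" for xs :: "'a list" by (induction xs) auto
  moreover have "map enc (map dec ns :: 'a list) = ns" for ns by (induction ns) auto
  ultimately show "bij (enc :: 'a list \<Rightarrow> nat)"
    by (intro bij_betw_byWitness[where f' = "\<lambda>n. map dec (list_decode n)"])
      (auto simp: enc_list_def simp del: map_map)
qed
end

lemma enc_Cons: "enc (x # xs) = Suc (prod_encode (enc x, enc xs))"
  by (simp add: enc_list_def)

lemma enc_Nil: "enc [] = 0"
  by (simp add: enc_list_def)

lemma dec_nat [simp]: "dec n = (n :: nat)"
  using dec_enc[of n] by (simp add: enc_nat_def)

lemma dec_prod: "dec n = (dec (fst (prod_decode n)), dec (snd (prod_decode n)))"
  by (subst enc_inject[symmetric], subst enc_dec) (simp add: enc_prod_def)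

text \<open>The rules in \<open>cmp_intros\<close> are used backwards along the shape of a term.
  Under a binder the surrounding variables are passed as the first component of a pair, the bound
  ones behind it.\<close>

definition cmp :: "('a::encodable \<Rightarrow> 'b::encodable) \<Rightarrow> bool" where
  "cmp f \<longleftrightarrow> computable (\<lambda>n. enc (f (dec n)))"

definition dcd :: "('a::encodable \<Rightarrow> bool) \<Rightarrow> bool" where
  "dcd P \<longleftrightarrow> cmp (\<lambda>x. if P x then 1 else 0 :: nat)"

named_theorems cmp_intros

lemma cmp_id [cmp_intros]: "cmp (\<lambda>x. x)"
  by (simp add: cmp_def computable_id)

lemma cmp_const [cmp_intros]: "cmp (\<lambda>_. c)"
  by (simp add: cmp_def computable_const)

lemma cmp_nat_iff: "cmp f \<longleftrightarrow> computable (f :: nat \<Rightarrow> nat)"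
  by (simp add: cmp_def enc_nat_def)

lemma cmp_comp: assumes "cmp f" "cmp g" shows "cmp (\<lambda>x. f (g x))"
  using computable_comp[OF assms[unfolded cmp_def]] by (simp add: cmp_def)

lemma cmp_Pair [cmp_intros]: "cmp f \<Longrightarrow> cmp g \<Longrightarrow> cmp (\<lambda>x. (f x, g x))"
  unfolding cmp_def enc_prod_def using computable_pair by auto

lemma cmp_fst [cmp_intros]: assumes "cmp f" shows "cmp (\<lambda>x. fst (f x))"
  using computable_comp[OF computable_fst assms[unfolded cmp_def]] by (simp add: cmp_def enc_prod_def)

lemma cmp_snd [cmp_intros]: assumes "cmp f" shows "cmp (\<lambda>x. snd (f x))"
  using computable_comp[OF computable_snd assms[unfolded cmp_def]] by (simp add: cmp_def enc_prod_def)

lemma cmp_comp2: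
  assumes "cmp (\<lambda>p. f (fst p) (snd p))" "cmp g" "cmp h" shows "cmp (\<lambda>x. f (g x) (h x))"
  using cmp_comp[OF assms(1) cmp_Pair[OF assms(2,3)]] by simp

lemma cmp_comp3:
  assumes "cmp (\<lambda>p. f (fst p) (fst (snd p)) (snd (snd p)))" "cmp g" "cmp h" "cmp k"
  shows "cmp (\<lambda>x. f (g x) (h x) (k x))"
  using cmp_comp[OF assms(1) cmp_Pair[OF assms(2) cmp_Pair[OF assms(3,4)]]] by simp

lemma cmp_comp4:
  assumes "cmp (\<lambda>p. f (fst p) (fst (snd p)) (fst (snd (snd p))) (snd (snd (snd p))))"
    "cmp g" "cmp h" "cmp k" "cmp l"
  shows "cmp (\<lambda>x. f (g x) (h x) (k x) (l x))"
  using cmp_comp[OF assms(1) cmp_Pair[OF assms(2) cmp_Pair[OF assms(3) cmp_Pair[OF assms(4,5)]]]]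
  by simp

lemma cmp_case_prod [cmp_intros]:
  assumes "cmp g" "cmp (\<lambda>p. h (fst p) (fst (snd p)) (snd (snd p)))"
  shows "cmp (\<lambda>x. case_prod (h x) (g x))"
  using cmp_comp[OF assms(2) cmp_Pair[OF cmp_id assms(1)]] by (simp add: case_prod_beta)

lemma cmp_enc [cmp_intros]: "cmp f \<Longrightarrow> cmp (\<lambda>x. enc (f x))"
  by (simp add: cmp_def enc_nat_def)

lemma cmp_dec [cmp_intros]: "cmp f \<Longrightarrow> cmp (\<lambda>x. dec (f x))"
  by (simp add: cmp_def enc_nat_def)

lemma cmp_prod_decode [cmp_intros]: "cmp f \<Longrightarrow> cmp (\<lambda>x. prod_decode (f x))"
  by (simp add: cmp_def enc_nat_def enc_prod_def)

lemma cmp_prod_encode [cmp_intros]: "cmp f \<Longrightarrow> cmp (\<lambda>x. prod_encode (f x))"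
  by (simp add: cmp_def enc_nat_def enc_prod_def)

lemma cmp_list_encode [cmp_intros]: "cmp f \<Longrightarrow> cmp (\<lambda>x. list_encode (f x))"
  by (simp add: cmp_def enc_list_def enc_nat_def[abs_def])

lemma cmp_Suc [cmp_intros]: assumes "cmp f" shows "cmp (\<lambda>x. Suc (f x))"
  using computable_comp[OF computable_Suc assms[unfolded cmp_def]] by (simp add: cmp_def enc_nat_def)

lemma cmp_Cons [cmp_intros]: assumes "cmp f" "cmp g" shows "cmp (\<lambda>x. f x # g x)"
  using computable_comp[OF computable_Suc computable_pair[OF assms[unfolded cmp_def]]]
  by (simp add: cmp_def enc_Cons)

lemma cmp_rec_nat [cmp_intros]:
  assumes N: "cmp N" and A: "cmp A" and B: "cmp (\<lambda>p. B (fst p) (fst (snd p)) (snd (snd p)))"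
  shows "cmp (\<lambda>x. rec_nat (A x) (B x) (N x))"
proof -
  let ?f = "\<lambda>n. enc (A (dec n))"
  let ?g = "\<lambda>n. enc ((\<lambda>p. B (fst p) (fst (snd p)) (snd (snd p))) (dec n))"
  have "computable (\<lambda>x. rec_nat (?f (fst (prod_decode (prod_encode (x, N (dec x))))))
    (\<lambda>n r. ?g (prod_encode (fst (prod_decode (prod_encode (x, N (dec x)))), prod_encode (n, r))))
    (snd (prod_decode (prod_encode (x, N (dec x))))))"
    using computable_comp[OF computable_rec[OF A[unfolded cmp_def] B[unfolded cmp_def]]
        computable_pair[OF computable_id N[unfolded cmp_def enc_nat_def]]] by simp
  moreover have "rec_nat (?f x) (\<lambda>n r. ?g (prod_encode (x, prod_encode (n, r)))) k
      = enc (rec_nat (A (dec x)) (B (dec x)) k)" for x k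
    by (induction k) (simp_all add: dec_prod)
  ultimately show ?thesis by (simp add: cmp_def)
qed

lemma cmp_add [cmp_intros]: assumes "cmp f" "cmp g" shows "cmp (\<lambda>x. f x + g x :: nat)"
proof -
  have "rec_nat m (\<lambda>_ r. Suc r) n = m + n" for m n by (induction n) auto
  moreover have "cmp (\<lambda>p. rec_nat (fst p) (\<lambda>_ r. Suc r) (snd p))" by (intro cmp_intros)
  ultimately show ?thesis by (intro cmp_comp2[OF _ assms]) simp
qed

lemma cmp_mult [cmp_intros]: assumes "cmp f" "cmp g" shows "cmp (\<lambda>x. f x * g x :: nat)"
proof -
  have "rec_nat 0 (\<lambda>_ r. r + m) n = m * n" for m n :: nat by (induction n) auto
  moreover have "cmp (\<lambda>p. rec_nat 0 (\<lambda>_ r. r + fst p) (snd p) :: nat)" by (intro cmp_intros)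
  ultimately show ?thesis by (intro cmp_comp2[OF _ assms]) simp
qed

lemma cmp_power [cmp_intros]: assumes "cmp f" "cmp g" shows "cmp (\<lambda>x. f x ^ g x :: nat)"
proof -
  have "rec_nat 1 (\<lambda>_ r. r * m) n = m ^ n" for m n :: nat by (induction n) auto
  moreover have "cmp (\<lambda>p. rec_nat 1 (\<lambda>_ r. r * fst p) (snd p) :: nat)" by (intro cmp_intros)
  ultimately show ?thesis by (intro cmp_comp2[OF _ assms]) simp
qed

lemma cmp_diff [cmp_intros]: assumes "cmp f" "cmp g" shows "cmp (\<lambda>x. f x - g x :: nat)"
proof -
  have p: "rec_nat 0 (\<lambda>k _. k) n = n - 1" for n by (induction n) auto
  have "cmp (\<lambda>n. rec_nat 0 (\<lambda>k _. k) n)" by (intro cmp_intros)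
  then have p1: "cmp (\<lambda>n::nat. n - 1 :: nat)" unfolding p .
  have "rec_nat m (\<lambda>_ r. r - 1) n = m - n" for m n :: nat by (induction n) auto
  moreover have "cmp (\<lambda>p. rec_nat (fst p) (\<lambda>_ r. r - 1) (snd p) :: nat)"
    by (intro cmp_intros cmp_comp[OF p1])
  ultimately show ?thesis by (intro cmp_comp2[OF _ assms]) simp
qed

lemma cmp_if [cmp_intros]:
  assumes "dcd P" "cmp f" "cmp g" shows "cmp (\<lambda>x. if P x then f x else g x)"
proof -
  \<comment> \<open>A conditional is a recursion of length at most one that starts from the else
    branch.\<close>
  have "rec_nat a (\<lambda>_ _. b) (if c then 1 else 0) = (if c then b else a)" for a b :: 'b and c by simp
  moreover have "cmp (\<lambda>p. rec_nat (snd (snd p)) (\<lambda>_ _. fst (snd p)) (fst p :: nat) :: 'b)"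
    by (intro cmp_intros)
  from cmp_comp3[of "\<lambda>n a b. rec_nat b (\<lambda>_ _. a) n", OF this assms(1)[unfolded dcd_def] assms(2,3)]
  have "cmp (\<lambda>x. rec_nat (g x) (\<lambda>_ _. f x) (if P x then 1 else 0))" .
  ultimately show ?thesis by simp
qed

lemma dcd_comp: "dcd P \<Longrightarrow> cmp f \<Longrightarrow> dcd (\<lambda>x. P (f x))"
  unfolding dcd_def by (rule cmp_comp)

lemma dcd_eq_zero: assumes "cmp f" shows "dcd (\<lambda>x. f x = (0::nat))"
proof -
  have "(if f x = 0 then 1 else 0) = 1 - f x" for x by simp
  moreover have "cmp (\<lambda>x. 1 - f x)" by (intro cmp_intros assms)
  ultimately show ?thesis by (simp add: dcd_def)
qed

lemma dcd_not [cmp_intros]: assumes "dcd P" shows "dcd (\<lambda>x. \<not> P x)"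
proof -
  have "((if P x then 1 else 0) = (0::nat)) = (\<not> P x)" for x by simp
  then show ?thesis using dcd_eq_zero[OF assms[unfolded dcd_def]] by simp
qed

lemma dcd_conj [cmp_intros]: assumes "dcd P" "dcd Q" shows "dcd (\<lambda>x. P x \<and> Q x)"
proof -
  have "cmp (\<lambda>x. if P x then (if Q x then 1 else 0) else 0 :: nat)"
    by (intro cmp_intros assms)
  moreover have "(if P x then (if Q x then 1 else 0) else 0) = (if P x \<and> Q x then 1 else 0 :: nat)" for x
    by simp
  ultimately show ?thesis by (simp add: dcd_def)
qed

lemma dcd_disj [cmp_intros]: assumes "dcd P" "dcd Q" shows "dcd (\<lambda>x. P x \<or> Q x)"
proof -
  have "dcd (\<lambda>x. \<not> (\<not> P x \<and> \<not> Q x))" by (intro cmp_intros assms)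
  then show ?thesis by simp
qed

lemma dcd_less [cmp_intros]: assumes "cmp f" "cmp g" shows "dcd (\<lambda>x. f x < (g x :: nat))"
proof -
  have "dcd (\<lambda>x. \<not> g x - f x = 0)" by (intro cmp_intros dcd_eq_zero assms)
  moreover have "(\<not> g x - f x = 0) = (f x < g x)" for x by auto
  ultimately show ?thesis by simp
qed

lemma dcd_eq [cmp_intros]: assumes "cmp f" "cmp g" shows "dcd (\<lambda>x. f x = g x)"
proof -
  have "dcd (\<lambda>x. \<not> enc (f x) < enc (g x) \<and> \<not> enc (g x) < enc (f x))"
    by (intro cmp_intros assms)
  moreover have "(\<not> enc (f x) < enc (g x) \<and> \<not> enc (g x) < enc (f x)) = (f x = g x)" for x
    by (metis enc_inject linorder_neqE_nat less_irrefl)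
  ultimately show ?thesis by simp
qed

lemma dcd_all_less [cmp_intros]:
  fixes N :: "'a::encodable \<Rightarrow> nat"
  assumes N: "cmp N" and P: "dcd (\<lambda>p. P (fst p) (snd p))"
  shows "dcd (\<lambda>x. \<forall>i<N x. P x i)"
proof -
  have "rec_nat 1 (\<lambda>i r. if P x i then r else 0) n = (if \<forall>i<n. P x i then 1 else 0 :: nat)" for x n
    by (induction n) (auto simp: less_Suc_eq)
  moreover have "cmp (\<lambda>x. rec_nat 1 (\<lambda>i r. if P x i then r else 0 :: nat) (N x))"
    by (intro cmp_intros N dcd_comp[OF P, of "\<lambda>p. (fst p, fst (snd p))", simplified])
  ultimately show ?thesis by (simp add: dcd_def)
qed

lemma cmp_div2 [cmp_intros]: assumes "cmp f" shows "cmp (\<lambda>x. f x div 2 :: nat)"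
proof -
  let ?r = "\<lambda>n. rec_nat (0, 0) (\<lambda>_ r. if snd r = (0::nat) then (fst r, 1) else (Suc (fst r), 0)) n :: nat \<times> nat"
  have "?r n = (n div 2, n mod 2)" for n
  proof (induction n)
    case (Suc n)
    then show ?case by (cases "even n") (auto simp: even_iff_mod_2_eq_zero odd_iff_mod_2_eq_one, presburger+)
  qed simp
  moreover have "cmp (\<lambda>n. fst (?r n))" by (intro cmp_intros)
  ultimately have "cmp (\<lambda>n. n div 2 :: nat)" by simp
  then show ?thesis using assms by (rule cmp_comp)
qed

lemma dcd_even [cmp_intros]: assumes "cmp f" shows "dcd (\<lambda>x. even (f x :: nat))"
proof -
  have "dcd (\<lambda>x. f x = 2 * (f x div 2))" by (intro cmp_intros assms)
  moreover have "(n = 2 * (n div 2)) = even n" for n :: nat by presburger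
  ultimately show ?thesis by simp
qed

text \<open>Lists are consumed by iteration on codes: each round removes the head, the code 0 of the
  empty list is left alone, and the code of a list bounds its length, so that many rounds
  suffice.\<close>

lemma cmp_foldl [cmp_intros]:
  fixes L :: "'a::encodable \<Rightarrow> 'b::encodable list"
  assumes L: "cmp L" and A: "cmp A" and B: "cmp (\<lambda>p. B (fst p) (fst (snd p)) (snd (snd p)))"
  shows "cmp (\<lambda>x. foldl (B x) (A x) (L x))"
proof -
  define step where "step x r = (if fst r = 0 then r
    else (snd (prod_decode (fst r - 1)), B x (snd r) (dec (fst (prod_decode (fst r - 1))))))" for x r
  let ?it = "\<lambda>x n ys a. rec_nat (enc ys, a) (\<lambda>_. step x) n"
  have comm: "rec_nat (step x r) (\<lambda>_. step x) n = step x (rec_nat r (\<lambda>_. step x) n)" for x r n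
    by (induction n) auto
  have it: "?it x n ys a = (0, foldl (B x) a ys)" if "length ys \<le> n" for x n ys a
    using that
  proof (induction n arbitrary: ys a)
    case 0
    then show ?case by (simp add: enc_Nil)
  next
    case (Suc n)
    show ?case
    proof (cases ys)
      case Nil
      then show ?thesis using Suc.IH[of "[]" a] by (simp add: step_def)
    next
      case (Cons y zs)
      have "step x (enc ys, a) = (enc zs, B x a y)" by (simp add: step_def Cons enc_Cons)
      then have "?it x (Suc n) ys a = ?it x n zs (B x a y)" using comm[of x "(enc ys, a)" n] by simp
      then show ?thesis using Suc.IH[of zs "B x a y"] Suc.prems Cons by simp
    qed
  qed
  have len: "length ys \<le> enc ys" for ys :: "'b list"
  proof (induction ys)
    case (Cons y ys)
    have "enc ys \<le> prod_encode (enc y, enc ys)" by (rule le_prod_encode_2)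
    then show ?case using Cons by (simp add: enc_Cons)
  qed (simp add: enc_Nil)
  have "cmp (\<lambda>x. snd (rec_nat (enc (L x), A x) (\<lambda>_. step x) (enc (L x))))"
    unfolding step_def
    by (intro cmp_intros L A cmp_comp3[of B, OF B])
  then show ?thesis using it[OF len] by simp
qed

lemma cmp_rev [cmp_intros]: assumes "cmp f" shows "cmp (\<lambda>x. rev (f x))"
proof -
  have "foldl (\<lambda>r y. y # r) zs xs = rev xs @ zs" for xs zs :: "'b list"
    by (induction xs arbitrary: zs) auto
  moreover have "cmp (\<lambda>x. foldl (\<lambda>r y. y # r) [] (f x))" by (intro cmp_intros assms)
  ultimately show ?thesis by simp
qed

lemma cmp_foldr [cmp_intros]:
  assumes L: "cmp L" and A: "cmp A" and B: "cmp (\<lambda>p. B (fst p) (fst (snd p)) (snd (snd p)))"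
  shows "cmp (\<lambda>x. foldr (B x) (L x) (A x))"
  unfolding foldr_conv_foldl
  by (intro cmp_intros L A cmp_comp3[of B, OF B])

lemma cmp_append [cmp_intros]: assumes "cmp f" "cmp g" shows "cmp (\<lambda>x. f x @ g x)"
proof -
  have "cmp (\<lambda>x. foldr (\<lambda>y r. y # r) (f x) (g x))" by (intro cmp_intros assms)
  moreover have "foldr (\<lambda>y r. y # r) xs ys = xs @ ys" for xs ys :: "'b list" by (induction xs) auto
  ultimately show ?thesis by simp
qed

lemma cmp_map [cmp_intros]:
  assumes L: "cmp L" and F: "cmp (\<lambda>p. F (fst p) (snd p))" shows "cmp (\<lambda>x. map (F x) (L x))"
proof -
  have "cmp (\<lambda>x. foldr (\<lambda>y r. F x y # r) (L x) [])" by (intro cmp_intros L cmp_comp2[of F, OF F])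
  moreover have "foldr (\<lambda>y r. F x y # r) ys [] = map (F x) ys" for x ys by (induction ys) auto
  ultimately show ?thesis by simp
qed

lemma cmp_concat [cmp_intros]: assumes "cmp L" shows "cmp (\<lambda>x. concat (L x))"
  unfolding concat_conv_foldr by (intro cmp_intros assms)

lemma cmp_filter [cmp_intros]:
  assumes L: "cmp L" and P: "dcd (\<lambda>p. P (fst p) (snd p))" shows "cmp (\<lambda>x. filter (P x) (L x))"
proof -
  have P': "dcd (\<lambda>p. P (fst p) (fst (snd p)))"
    using dcd_comp[OF P, of "\<lambda>p. (fst p, fst (snd p))"] by (simp add: cmp_intros)
  have "cmp (\<lambda>x. foldr (\<lambda>y r. if P x y then y # r else r) (L x) [])" by (intro cmp_intros L P')
  moreover have "foldr (\<lambda>y r. if P x y then y # r else r) ys [] = filter (P x) ys" for x ys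
    by (induction ys) auto
  ultimately show ?thesis by simp
qed

lemma cmp_length [cmp_intros]: assumes "cmp f" shows "cmp (\<lambda>x. length (f x))"
proof -
  have "cmp (\<lambda>x. foldr (\<lambda>_ r. Suc r) (f x) 0)" by (intro cmp_intros assms)
  moreover have "foldr (\<lambda>_ r. Suc r) ys 0 = length ys" for ys :: "'b list" by (induction ys) auto
  ultimately show ?thesis by simp
qed

lemma cmp_funpow:
  fixes F :: "'b::encodable \<Rightarrow> 'b"
  assumes N: "cmp N" and A: "cmp A" and F: "cmp F" shows "cmp (\<lambda>x. (F ^^ N x) (A x))"
proof -
  have "cmp (\<lambda>x. rec_nat (A x) (\<lambda>_ r. F r) (N x))" by (intro cmp_intros N A cmp_comp[OF F])
  moreover have "rec_nat a (\<lambda>_ r. F r) n = (F ^^ n) a" for a n by (induction n) auto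
  ultimately show ?thesis by simp
qed

text \<open>The s-m-n theorem, with \<open>x\<close> built in as a constant program. It is used
  because \<open>computably_supported\<close> asks for an index computed from the word, not merely
  for approximations computed from it.\<close>

lemma smn:
  assumes F: "cmp (\<lambda>p. F (fst p) (snd p) :: nat)"
  obtains E :: "'a::encodable \<Rightarrow> nat" where "cmp E"
    "\<And>x. \<exists>c. E x = prog_code c \<and> (\<forall>k::nat. evaluates c k (F x k))"
proof -
  from F obtain c0 where c0: "\<And>n. evaluates c0 n (enc ((\<lambda>p. F (fst p) (snd p)) (dec n)))"
    by (auto simp: cmp_def computable_def)
  define P where "P x = PComp c0 (PPair (const_prog (enc x)) (PPair PFst PSnd))" for x :: 'a
  have ev: "evaluates (P x) k (F x k)" for x k
  proof -
    have "evaluates (PPair (const_prog (enc x)) (PPair PFst PSnd)) k (prod_encode (enc x, k))"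
      by (intro evaluates.pair evaluates_const_prog evaluates_id)
    moreover have "evaluates c0 (prod_encode (enc x, k)) (F x k)"
      using c0[of "prod_encode (enc x, k)"] by (simp add: dec_prod enc_nat_def)
    ultimately show ?thesis unfolding P_def by (rule evaluates.comp)
  qed
  have cc: "prog_code (const_prog n) = rec_nat 0 (\<lambda>_ r. 5 + 4 * prod_encode (1, r)) n" for n
    by (induction n) auto
  have "cmp (\<lambda>x. prog_code (P x))"
    unfolding P_def prog_code.simps cc by (intro cmp_intros)
  then show ?thesis using ev by (intro that[of "\<lambda>x. prog_code (P x)"]) auto
qed

section \<open>Codes of dyadic rational points\<close>

text \<open>The code \<open>(i, j, a, b, l, ls)\<close> stands for the monomial \<open>\<i>\<^sup>a / 2\<^sup>b\<close> times the word \<open>l # ls\<close>, put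
  in entry \<open>(i, j)\<close>. Sums of such monomials are dense and closed under all operations needed here,
  and multiplying them requires no arithmetic of rational numbers.\<close>

type_synonym dterm = "nat \<times> nat \<times> nat \<times> nat \<times> nat \<times> nat list"

definition lit :: "(nat \<Rightarrow> 'a::cstar_algebra) \<Rightarrow> nat \<Rightarrow> 'a" where
  "lit s l = literal_of cstar_ops s l"

text \<open>In the coding of sums \<open>Inl i\<close> is \<open>2 * i\<close> and
  \<open>Inr i\<close> is its successor, so taking adjoints toggles parity.\<close>

definition flip_lit :: "nat \<Rightarrow> nat" where
  "flip_lit l = (if even l then Suc l else l - 1)"

definition wordval :: "(nat \<Rightarrow> 'a::cstar_algebra) \<Rightarrow> nat \<Rightarrow> nat list \<Rightarrow> 'a" where
  "wordval s l ls = foldl (\<lambda>x j. x * lit s j) (lit s l) ls"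

text \<open>Words are nonempty, so the reversed word is accumulated as its head and its
  tail.\<close>

definition word_adj :: "nat \<Rightarrow> nat list \<Rightarrow> nat \<times> nat list" where
  "word_adj l ls = foldl (\<lambda>r x. (flip_lit x, fst r # snd r)) (flip_lit l, []) ls"

lemma lit_flip: "lit s (flip_lit l) = adj (lit s l)"
  by (auto simp: lit_def flip_lit_def literal_of_def sum_decode_def cstar_ops_def adj_adj elim!: oddE)

lemma wordval_append: "wordval s l (ls @ l' # ls') = wordval s l ls * wordval s l' ls'"
proof (induction ls' rule: rev_induct)
  case (snoc x xs)
  then show ?case by (simp add: wordval_def mult.assoc flip: append_assoc append_Cons)
qed (simp add: wordval_def)

lemma wordval_adj: "wordval s (fst (word_adj l ls)) (snd (word_adj l ls)) = adj (wordval s l ls)"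
proof (induction ls rule: rev_induct)
  case (snoc x xs)
  have "wordval s (flip_lit x) (fst r # snd r) = adj (lit s x) * wordval s (fst r) (snd r)" for r
    using wordval_append[of s "flip_lit x" "[]" "fst r" "snd r"] by (simp add: wordval_def lit_flip)
  then show ?case using snoc by (simp add: word_adj_def wordval_def adj_mult)
qed (simp add: word_adj_def wordval_def lit_flip)

definition coef :: "nat \<Rightarrow> nat \<Rightarrow> complex" where
  "coef a b = \<i> ^ a / 2 ^ b"

fun tval :: "(nat \<Rightarrow> 'a::cstar_algebra) \<Rightarrow> dterm \<Rightarrow> 'a fmat" where
  "tval s (i, j, a, b, l, ls) = unit_fmat i j (coef a b *\<^sub>C wordval s l ls)"

definition dval :: "(nat \<Rightarrow> 'a::cstar_algebra) \<Rightarrow> dterm list \<Rightarrow> 'a fmat" where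
  "dval s T = sum_list (map (tval s) T)"

text \<open>The factor is \<open>\<i> ^ c / 2 ^ e\<close>. With \<open>c = 2\<close> and
  \<open>e = 0\<close> it is negation, so signs have no coding of their own.\<close>

definition dscale :: "nat \<Rightarrow> nat \<Rightarrow> dterm list \<Rightarrow> dterm list" where
  "dscale c e T = map (\<lambda>(i, j, a, b, l, ls). (i, j, a + c, b + e, l, ls)) T"

fun tmul :: "dterm \<Rightarrow> dterm \<Rightarrow> dterm list" where
  "tmul (i, j, a, b, l, ls) (i', j', a', b', l', ls') =
    (if j = i' then [(i, j', a + a', b + b', l, ls @ l' # ls')] else [])"

definition dmul :: "dterm list \<Rightarrow> dterm list \<Rightarrow> dterm list" where
  "dmul T U = concat (map (\<lambda>t. concat (map (\<lambda>u. tmul t u) U)) T)"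

text \<open>The conjugate of \<i> is its cube, hence \<open>3 * a\<close>.\<close>

definition dadj :: "dterm list \<Rightarrow> dterm list" where
  "dadj T = map (\<lambda>(i, j, a, b, l, ls). (j, i, 3 * a, b, word_adj l ls)) T"

definition dshift :: "nat \<Rightarrow> dterm list \<Rightarrow> dterm list" where
  "dshift n T = map (\<lambda>(i, j, r). (n + i, n + j, r)) T"

text \<open>Lets an arbitrary list of terms be read as a matrix of size \<open>n\<close>; the size
  is thereby enforced instead of being checked.\<close>

definition clip :: "nat \<Rightarrow> dterm list \<Rightarrow> dterm list" where
  "clip n T = filter (\<lambda>t. fst t < n \<and> fst (snd t) < n) T"

definition below :: "nat \<Rightarrow> dterm list \<Rightarrow> bool" where
  "below n T \<longleftrightarrow> (\<forall>t\<in>set T. fst t < n \<and> fst (snd t) < n)"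

lemma coef_mult: "coef a b * coef a' b' = coef (a + a') (b + b')"
  by (simp add: coef_def power_add)

lemma cnj_coef: "cnj (coef a b) = coef (3 * a) b"
proof -
  have "cnj \<i> = \<i> ^ 3" by (simp add: power3_eq_cube)
  then show ?thesis by (simp add: coef_def power_mult)
qed

lemma dval_Nil [simp]: "dval s [] = 0"
  by (simp add: dval_def)

lemma dval_Cons: "dval s (t # T) = tval s t + dval s T"
  by (simp add: dval_def)

lemma dval_append [simp]: "dval s (T @ U) = dval s T + dval s U"
  by (simp add: dval_def)

lemma scaleC_mult_mult: "(c *\<^sub>C x) * (d *\<^sub>C y) = (c * d) *\<^sub>C (x * (y :: 'a::cstar_algebra))"
  by (simp add: scaleC_mult_left scaleC_mult_right scaleC_scaleC mult.commute)

lemma scaleC_of_real_mult: "(complex_of_real r * c) *\<^sub>C x = r *\<^sub>R (c *\<^sub>C (x :: 'a::cstar_algebra))"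
  by (simp add: scaleC_of_real flip: scaleC_scaleC)

lemma unit_scaleR: "unit_fmat i j (r *\<^sub>R x) = r *\<^sub>R unit_fmat i j (x :: 'a::cstar_algebra)"
  by (rule fmat_eqI) (simp add: ent_unit ent_scaleR)

lemma dval_dscale_half [simp]: "dval s (dscale 0 e T) = (1 / 2 ^ e) *\<^sub>R dval s T"
proof -
  have c: "coef a (b + e) = complex_of_real (1 / 2 ^ e) * coef a b" for a b
    by (simp add: coef_def power_add)
  show ?thesis unfolding dscale_def
    by (induction T) (auto simp: dval_Cons c scaleC_of_real_mult unit_scaleR scaleR_add_right
        simp del: of_real_divide)
qed

lemma dval_dscale_neg [simp]: "dval s (dscale 2 0 T) = - dval s T"
proof -
  have "coef (Suc (Suc a)) b = - coef a b" for a b by (simp add: coef_def)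
  then have c: "unit_fmat i j (coef (Suc (Suc a)) b *\<^sub>C x) = - unit_fmat i j (coef a b *\<^sub>C x)"
    for i j a b and x :: 'a
    by (intro fmat_eqI) (simp add: ent_unit ent_minus scaleC_minus_left)
  show ?thesis unfolding dscale_def by (induction T) (auto simp: dval_Cons c)
qed

lemma dval_tmul: "dval s (tmul t u) = tval s t * tval s u"
  by (cases t; cases u)
    (auto simp: dval_Cons unit_mult scaleC_mult_mult coef_mult wordval_append)

lemma dval_dmul [simp]: "dval s (dmul T U) = dval s T * dval s U"
proof -
  have "dval s (concat (map (tmul t) U)) = tval s t * dval s U" for t
    by (induction U) (auto simp: dval_Cons dval_tmul distrib_left)
  then show ?thesis
    unfolding dmul_def by (induction T) (auto simp: dval_Cons distrib_right)
qed

lemma dval_dadj [simp]: "dval s (dadj T) = star (dval s T)"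
proof -
  have "tval s ((\<lambda>(i, j, a, b, l, ls). (j, i, 3 * a, b, word_adj l ls)) t) = star (tval s t)" for t
    by (cases t; cases "word_adj (fst (snd (snd (snd (snd t))))) (snd (snd (snd (snd (snd t)))))")
      (auto simp: star_unit adj_scaleC cnj_coef simp flip: wordval_adj)
  then show ?thesis unfolding dadj_def by (induction T) (auto simp: dval_Cons star_add)
qed

lemma dval_dshift [simp]: "dval s (dshift n T) = shift n n (dval s T)"
  unfolding dshift_def by (induction T) (auto simp: dval_Cons shift_zero shift_add shift_unit)

lemma supported_dval: "below n T \<Longrightarrow> supported n n (dval s T)"
proof (induction T)
  case (Cons t T)
  then show ?case by (cases t) (auto simp: below_def dval_Cons intro!: supported_add supported_unit)
qed (simp add: supported_zero)

lemma below_clip: "below n (clip n T)"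
  by (auto simp: below_def clip_def)

lemma clip_below: "below n T \<Longrightarrow> clip n T = T"
  by (auto simp: below_def clip_def filter_id_conv)

lemma below_Nil [simp]: "below n []"
  by (simp add: below_def)

lemma below_append [simp]: "below n (T @ U) \<longleftrightarrow> below n T \<and> below n U"
  by (auto simp: below_def)

lemma below_mono: "below m T \<Longrightarrow> m \<le> n \<Longrightarrow> below n T"
  by (force simp: below_def)

lemma below_dscale [simp]: "below n T \<Longrightarrow> below n (dscale c e T)"
  by (force simp: below_def dscale_def)

lemma below_dadj [simp]: "below n T \<Longrightarrow> below n (dadj T)"
  by (force simp: below_def dadj_def)

lemma below_dmul [simp]: "below n T \<Longrightarrow> below n U \<Longrightarrow> below n (dmul T U)"
proof -
  assume "below n T" "below n U"
  moreover have "fst v = fst t \<and> fst (snd v) = fst (snd u)" if "v \<in> set (tmul t u)" for t u v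
    using that by (cases t; cases u) (auto split: if_splits)
  ultimately show ?thesis unfolding below_def dmul_def by fastforce
qed

lemma below_dshift: "below n T \<Longrightarrow> below (m + n) (dshift m T)"
  by (force simp: below_def dshift_def)

subsection \<open>Translation into codes of rational points\<close>

definition neg_code :: "nat \<Rightarrow> nat" where
  "neg_code m = (if m = 1 then 2 else if m = 2 then 1 else 0)"

text \<open>The integers \<open>0, - 1, 1\<close> have the codes \<open>0, 1, 2\<close>, and \<open>2\<^sup>b\<close> has the code \<open>2 * 2\<^sup>b\<close>.\<close>

definition coef_code :: "nat \<Rightarrow> nat \<Rightarrow> nat" where
  "coef_code a b = (case rec_nat (2, 0) (\<lambda>_ r. (neg_code (snd r), fst r)) a of (m, n) \<Rightarrow>
     prod_encode (prod_encode (m, 2 * 2 ^ b), prod_encode (n, 2 * 2 ^ b)))"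

lemma int_decode_even: "int_decode (2 * n) = int n"
  by (simp add: int_decode_def sum_decode_def)

lemma int_decode_1: "int_decode (Suc 0) = - 1"
  by (simp add: int_decode_def sum_decode_def)

lemma gauss_rat_coef_code: "gauss_rat (coef_code a b) = coef a b"
proof -
  define R where "R a = rec_nat (2 :: nat, 0 :: nat) (\<lambda>_ r. (neg_code (snd r), fst r)) a" for a
  have neg: "int_decode (neg_code m) = - int_decode m" if "m \<in> {0, 1, 2}" for m
    using that int_decode_even[of 0] int_decode_even[of 1] by (auto simp: neg_code_def int_decode_1)
  \<comment> \<open>Multiplication by \<i> turns (m, n) into (- n, m), and both codes stay among 0,
    1, 2, where \<open>neg_code\<close> is correct.\<close>
  have inv: "fst (R a) \<in> {0, 1, 2} \<and> snd (R a) \<in> {0, 1, 2} \<and>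
      Complex (of_int (int_decode (fst (R a)))) (of_int (int_decode (snd (R a)))) = \<i> ^ a" for a
  proof (induction a)
    case 0
    show ?case using int_decode_even[of 0] int_decode_even[of 1] by (simp add: R_def complex_eq_iff)
  next
    case (Suc a)
    have R: "R (Suc a) = (neg_code (snd (R a)), fst (R a))" by (simp add: R_def)
    have "\<i> ^ Suc a = \<i> * Complex (of_int (int_decode (fst (R a)))) (of_int (int_decode (snd (R a))))"
      using Suc by simp
    then show ?case using Suc neg[of "snd (R a)"] unfolding R
      by (auto simp: complex_eq_iff neg_code_def)
  qed
  have rat: "real_of_rat (nat_to_rat_surj (prod_encode (m, 2 * 2 ^ b))) = of_int (int_decode m) / 2 ^ b" for m
    using int_decode_even[of "2 ^ b"] by (simp add: nat_to_rat_surj_def of_rat_rat)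
  have "coef_code a b = prod_encode (prod_encode (fst (R a), 2 * 2 ^ b), prod_encode (snd (R a), 2 * 2 ^ b))"
    by (simp add: coef_code_def R_def case_prod_beta)
  then have "gauss_rat (coef_code a b)
      = Complex (of_int (int_decode (fst (R a))) / 2 ^ b) (of_int (int_decode (snd (R a))) / 2 ^ b)"
    by (simp add: gauss_rat_def rat)
  also have "\<dots> = Complex (of_int (int_decode (fst (R a)))) (of_int (int_decode (snd (R a)))) / 2 ^ b"
  proof -
    have "Complex x y / 2 ^ b = Complex (x / 2 ^ b) (y / 2 ^ b)" for x y
    proof -
      have "(2 :: complex) ^ b = complex_of_real (2 ^ b)" by simp
      then show ?thesis by (simp add: complex_eq_iff del: of_real_power of_real_numeral)
    qed
    then show ?thesis by simp
  qed
  finally show ?thesis using inv[of a] by (simp add: coef_def)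
qed

definition entry_code :: "nat \<Rightarrow> nat \<Rightarrow> dterm list \<Rightarrow> nat" where
  "entry_code i j T = list_encode (map
     (\<lambda>(i, j, a, b, l, ls). prod_encode (coef_code a b, prod_encode (l, list_encode ls)))
     (filter (\<lambda>t. fst t = i \<and> fst (snd t) = j) T))"

lemma rational_point_entry_code:
  "rational_point cstar_ops s (entry_code i j T) = ent (dval s T) i j"
proof (induction T)
  case Nil
  show ?case by (simp add: entry_code_def rational_point_def cstar_ops_def ent_zero)
next
  case (Cons t T)
  obtain i' j' a b l ls where t: "t = (i', j', a, b, l, ls)" by (cases t)
  have "term_of cstar_ops s (prod_encode (coef_code a b, prod_encode (l, list_encode ls)))
      = coef a b *\<^sub>C wordval s l ls"
    by (simp add: term_of_def gauss_rat_coef_code wordval_def lit_def[abs_def])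
      (simp add: cstar_ops_def)
  then show ?case using Cons
    by (auto simp: t entry_code_def rational_point_def dval_Cons ent_add ent_unit)
      (auto simp: cstar_ops_def)
qed

text \<open>An adjoint literal that is to occupy entry \<open>(i, j)\<close> is the adjoint of a
  special point in entry \<open>(j, i)\<close>.\<close>

definition mat_lit :: "nat \<Rightarrow> nat \<Rightarrow> nat \<Rightarrow> nat \<Rightarrow> nat" where
  "mat_lit n i j l = (if even l then 2 * (l div 2 * (n * n) + i * n + j)
     else Suc (2 * (l div 2 * (n * n) + j * n + i)))"

text \<open>The first literal sits in entry \<open>(i, j)\<close> and all others in
  \<open>(j, j)\<close>, so the product stays in entry \<open>(i, j)\<close>.\<close>

fun mat_term :: "nat \<Rightarrow> dterm \<Rightarrow> nat" where
  "mat_term n (i, j, a, b, l, ls) = prod_encode (coef_code a b,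
     prod_encode (mat_lit n i j l, list_encode (map (mat_lit n j j) ls)))"

definition mat_code :: "nat \<Rightarrow> dterm list \<Rightarrow> nat" where
  "mat_code n T = list_encode (map (mat_term n) T)"

lemma emb_mat_special:
  assumes "i < n" "j < n"
  shows "emb (mat_special n s (k * (n * n) + i * n + j)) = unit_fmat i j (s k)"
proof -
  have "k * (n * n) + i * n + j = (k * n + i) * n + j" by (simp add: algebra_simps)
  then have m: "(k * (n * n) + i * n + j) mod n = j" "(k * (n * n) + i * n + j) div n = k * n + i"
    using assms by auto
  moreover have "(k * n + i) mod n = i" "(k * n + i) div n = k" using assms by auto
  moreover have "(k * (n * n) + i * n + j) div (n * n) = k"
    using m(2) \<open>(k * n + i) div n = k\<close> by (simp add: div_mult2_eq)
  ultimately show ?thesis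
    by (intro fmat_eqI) (use assms in \<open>auto simp: mat_special_def ent_emb ent_unit\<close>)
qed

lemma literal_of_mat_lit:
  assumes "i < n" "j < n"
  shows "emb (literal_of (mat_ops n) (mat_special n s) (mat_lit n i j l)) = unit_fmat i j (lit s l)"
    "literal_of (mat_ops n) (mat_special n s) (mat_lit n i j l) \<in> carrier_mat n n"
  using assms
  by (auto simp: literal_of_def mat_lit_def sum_decode_def lit_def cstar_ops_def mat_ops_def
      emb_mat_special emb_mat_adj star_unit) (auto simp: mat_special_def)

lemma emb_map_scaleC: "emb M = unit_fmat i j a \<Longrightarrow> emb (map_mat (scaleC c) M) = unit_fmat i j (c *\<^sub>C a)"
proof (rule fmat_eqI)
  fix i' j' assume M: "emb M = unit_fmat i j a"
  have z: "c *\<^sub>C (0 :: 'a) = 0" using scaleC_add_right[of c "0::'a" 0] by simp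
  have "ent (emb (map_mat (scaleC c) M)) i' j' = c *\<^sub>C ent (emb M) i' j'"
    by (auto simp: ent_emb z)
  then show "ent (emb (map_mat (scaleC c) M)) i' j' = ent (unit_fmat i j (c *\<^sub>C a)) i' j'"
    by (simp add: M ent_unit z)
qed

lemma term_of_mat_term:
  assumes t: "fst t < n" "fst (snd t) < n"
  shows "emb (term_of (mat_ops n) (mat_special n s) (mat_term n t)) = tval s t"
    "term_of (mat_ops n) (mat_special n s) (mat_term n t) \<in> carrier_mat n n"
proof -
  obtain i j a b l ls where t': "t = (i, j, a, b, l, ls)" by (cases t)
  have ij: "i < n" "j < n" using t by (auto simp: t')
  define W where "W = foldl (\<lambda>x k. x * literal_of (mat_ops n) (mat_special n s) k)
    (literal_of (mat_ops n) (mat_special n s) (mat_lit n i j l)) (map (mat_lit n j j) ls)"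
  have W: "emb W = unit_fmat i j (wordval s l ls) \<and> W \<in> carrier_mat n n"
    unfolding W_def
  proof (induction ls rule: rev_induct)
    case Nil
    show ?case using literal_of_mat_lit[OF ij, of s l] by (simp add: wordval_def)
  next
    case (snoc x xs)
    then show ?case using literal_of_mat_lit[OF ij(2) ij(2), of s x]
      by (auto simp: wordval_def emb_mult unit_mult)
  qed
  have "term_of (mat_ops n) (mat_special n s) (mat_term n t) = map_mat (scaleC (coef a b)) W"
    by (simp add: t' term_of_def gauss_rat_coef_code W_def) (simp add: mat_ops_def)
  then show "emb (term_of (mat_ops n) (mat_special n s) (mat_term n t)) = tval s t"
    "term_of (mat_ops n) (mat_special n s) (mat_term n t) \<in> carrier_mat n n"
    using W by (auto simp: t' emb_map_scaleC)
qed

lemma emb_add: "dim_row M = dim_row N \<Longrightarrow> dim_col M = dim_col N \<Longrightarrow> emb (M + N) = emb M + emb (N :: 'a::cstar_algebra mat)"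
  by (rule fmat_eqI) (auto simp: ent_emb ent_add)

lemma rational_point_mat_code:
  assumes "below n T"
  shows "emb (rational_point (mat_ops n) (mat_special n s) (mat_code n T)) = dval s T \<and>
    rational_point (mat_ops n) (mat_special n s) (mat_code n T) \<in> carrier_mat n n"
  using assms
proof (induction T)
  case Nil
  have "emb (0\<^sub>m n n :: 'a mat) = 0" by (rule fmat_eqI) (simp add: ent_emb ent_zero)
  then show ?case by (simp add: mat_code_def rational_point_def mat_ops_def)
next
  case (Cons t T)
  define M where "M = term_of (mat_ops n) (mat_special n s) (mat_term n t)"
  define N where "N = rational_point (mat_ops n) (mat_special n s) (mat_code n T)"
  have M: "emb M = tval s t" "M \<in> carrier_mat n n"
    using Cons.prems term_of_mat_term[of t n s] by (auto simp: M_def below_def)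
  have N: "emb N = dval s T" "N \<in> carrier_mat n n"
    using Cons by (auto simp: N_def below_def)
  have "rational_point (mat_ops n) (mat_special n s) (mat_code n (t # T)) = M + N"
    unfolding M_def N_def by (simp add: rational_point_def mat_code_def) (simp add: mat_ops_def)
  then show ?case using M N by (auto simp: dval_Cons emb_add)
qed

lemma mat_norm_diff_le:
  fixes p :: "'a::unital_cstar_algebra mat"
  assumes p: "p \<in> carrier_mat n n" and T: "below n T"
  shows "op_norm (mat_ops n) (op_add (mat_ops n) p (op_scale (mat_ops n) (- 1)
      (rational_point (mat_ops n) (mat_special n s) (mat_code n T)))) \<le> norm (emb p - dval s T)"
proof -
  define R where "R = rational_point (mat_ops n) (mat_special n s) (mat_code n T)"
  have R: "emb R = dval s T" "R \<in> carrier_mat n n" using rational_point_mat_code[OF T] by (auto simp: R_def)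
  have d: "dim_row p = n" "dim_col p = n" "dim_row R = n" "dim_col R = n" using p R by auto
  let ?D = "p + map_mat (scaleC (- 1)) R"
  have e: "emb ?D = emb p - dval s T"
    unfolding R(1)[symmetric]
    using scaleC_of_real[of "-1"] by (intro fmat_eqI) (auto simp: ent_emb ent_diff d)
  have "mat_norm ?D \<le> (\<Sum>i<n. \<Sum>j<n. norm (?D $$ (i, j)))"
    using mat_norm_le_sum[of ?D] d by simp
  also have "\<dots> = norm (emb ?D)"
    using supported_emb[of ?D] d by (simp add: norm_fmat_eq[of n n] ent_emb)
  finally show ?thesis unfolding e R_def[symmetric] by (simp add: mat_ops_def)
qed

subsection \<open>Computability of the operations\<close>

lemma cmp_flip_lit [cmp_intros]: "cmp f \<Longrightarrow> cmp (\<lambda>x. flip_lit (f x))"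
  unfolding flip_lit_def by (intro cmp_intros)

lemma cmp_word_adj [cmp_intros]: "cmp f \<Longrightarrow> cmp g \<Longrightarrow> cmp (\<lambda>x. word_adj (f x) (g x))"
  by (rule cmp_comp2[of word_adj]) (unfold word_adj_def, intro cmp_intros)

lemma cmp_dscale [cmp_intros]: "cmp f \<Longrightarrow> cmp g \<Longrightarrow> cmp h \<Longrightarrow> cmp (\<lambda>x. dscale (f x) (g x) (h x))"
  by (rule cmp_comp3[of dscale]) (unfold dscale_def, intro cmp_intros)

lemma tmul_eq: "tmul t u = (case t of (i, j, a, b, l, ls) \<Rightarrow> case u of (i', j', a', b', l', ls') \<Rightarrow>
    if j = i' then [(i, j', a + a', b + b', l, ls @ l' # ls')] else [])"
  by (cases t; cases u) simp

lemma cmp_tmul [cmp_intros]: "cmp f \<Longrightarrow> cmp g \<Longrightarrow> cmp (\<lambda>x. tmul (f x) (g x))"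
  by (rule cmp_comp2[of tmul]) (unfold tmul_eq, intro cmp_intros)

lemma cmp_dmul [cmp_intros]: "cmp f \<Longrightarrow> cmp g \<Longrightarrow> cmp (\<lambda>x. dmul (f x) (g x))"
  by (rule cmp_comp2[of dmul]) (unfold dmul_def, intro cmp_intros)

lemma cmp_dadj [cmp_intros]: "cmp f \<Longrightarrow> cmp (\<lambda>x. dadj (f x))"
  by (rule cmp_comp[of dadj]) (unfold dadj_def, intro cmp_intros)

lemma cmp_dshift [cmp_intros]: "cmp f \<Longrightarrow> cmp g \<Longrightarrow> cmp (\<lambda>x. dshift (f x) (g x))"
  by (rule cmp_comp2[of dshift]) (unfold dshift_def, intro cmp_intros)

lemma cmp_clip [cmp_intros]: "cmp f \<Longrightarrow> cmp g \<Longrightarrow> cmp (\<lambda>x. clip (f x) (g x))"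
  by (rule cmp_comp2[of clip]) (unfold clip_def, intro cmp_intros)

lemma cmp_coef_code [cmp_intros]: "cmp f \<Longrightarrow> cmp g \<Longrightarrow> cmp (\<lambda>x. coef_code (f x) (g x))"
  by (rule cmp_comp2[of coef_code]) (unfold coef_code_def neg_code_def, intro cmp_intros)

lemma cmp_entry_code [cmp_intros]:
  "cmp f \<Longrightarrow> cmp g \<Longrightarrow> cmp h \<Longrightarrow> cmp (\<lambda>x. entry_code (f x) (g x) (h x))"
  by (rule cmp_comp3[of entry_code]) (unfold entry_code_def, intro cmp_intros)

lemma cmp_mat_lit [cmp_intros]:
  "cmp f \<Longrightarrow> cmp g \<Longrightarrow> cmp h \<Longrightarrow> cmp k \<Longrightarrow> cmp (\<lambda>x. mat_lit (f x) (g x) (h x) (k x))"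
  by (rule cmp_comp4[of mat_lit]) (unfold mat_lit_def, intro cmp_intros)

lemma mat_term_eq: "mat_term n t = (case t of (i, j, a, b, l, ls) \<Rightarrow> prod_encode (coef_code a b,
     prod_encode (mat_lit n i j l, list_encode (map (\<lambda>k. mat_lit n j j k) ls))))"
  by (cases t) simp

lemma cmp_mat_code [cmp_intros]: "cmp f \<Longrightarrow> cmp g \<Longrightarrow> cmp (\<lambda>x. mat_code (f x) (g x))"
  by (rule cmp_comp2[of mat_code]) (unfold mat_code_def mat_term_eq, intro cmp_intros)

section \<open>Density of the dyadic rational points\<close>

lemma bounded_linear_scaleC: "bounded_linear (scaleC c :: 'a::cstar_algebra \<Rightarrow> 'a)"
proof (rule bounded_linear_intro[where K = "cmod c"])
  fix r and x :: 'a
  have "c *\<^sub>C complex_of_real r *\<^sub>C x = complex_of_real r *\<^sub>C c *\<^sub>C x"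
    by (simp add: scaleC_scaleC mult.commute)
  then show "c *\<^sub>C r *\<^sub>R x = r *\<^sub>R c *\<^sub>C x" by (simp add: scaleC_of_real)
qed (auto simp: scaleC_add_right norm_scaleC mult.commute)

lemma scaleC_Re_Im: "c *\<^sub>C x = Re c *\<^sub>R x + Im c *\<^sub>R (\<i> *\<^sub>C (x :: 'a::cstar_algebra))"
proof -
  have "c *\<^sub>C x = (complex_of_real (Re c) + complex_of_real (Im c) * \<i>) *\<^sub>C x"
    using complex_eq[of c] by (simp add: mult.commute)
  then show ?thesis by (simp add: scaleC_add_left scaleC_of_real scaleC_of_real_mult)
qed

definition aval :: "(nat \<Rightarrow> 'a::cstar_algebra) \<Rightarrow> (nat \<times> nat \<times> nat \<times> nat list) list \<Rightarrow> 'a" where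
  "aval s U = sum_list (map (\<lambda>(a, b, l, ls). coef a b *\<^sub>C wordval s l ls) U)"

lemma dval_unit_aval: "dval s (map (\<lambda>u. (i, j, u)) U) = unit_fmat i j (aval s U)"
  by (induction U) (auto simp: dval_Cons aval_def unit_zero unit_add)

lemma closure_of_additive_closed:
  fixes D :: "'b::real_normed_vector set"
  assumes D: "\<And>x y. x \<in> D \<Longrightarrow> y \<in> D \<Longrightarrow> x + y \<in> D" and x: "x \<in> closure D" and y: "y \<in> closure D"
  shows "x + y \<in> closure D"
proof -
  obtain f where f: "\<forall>n. f n \<in> D" "f \<longlonglongrightarrow> x" using x closure_sequential by metis
  obtain g where g: "\<forall>n. g n \<in> D" "g \<longlonglongrightarrow> y" using y closure_sequential by metis
  have "(\<lambda>n. f n + g n) \<longlonglongrightarrow> x + y" using f g by (intro tendsto_add) auto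
  then show ?thesis using f g D unfolding closure_sequential
    by (intro exI[of _ "\<lambda>n. f n + g n"]) auto
qed

lemma closure_of_linear_image:
  assumes D: "\<And>x. x \<in> D \<Longrightarrow> F x \<in> closure D" and F: "bounded_linear F" and x: "x \<in> closure D"
  shows "F x \<in> closure D"
proof -
  obtain f where f: "\<forall>n. f n \<in> D" "f \<longlonglongrightarrow> x" using x closure_sequential by metis
  have "(\<lambda>n. F (f n)) \<longlonglongrightarrow> F x" using f bounded_linear.tendsto[OF F] by blast
  then have "F x \<in> closure (closure D)" using f D unfolding closure_sequential[of _ "closure D"]
    by (intro exI[of _ "\<lambda>n. F (f n)"]) auto
  then show ?thesis by simp
qed

text \<open>Truncated binary expansions of \<open>r\<close> are dyadic, and a dyadic multiple is a
  repeated sum, negated if necessary and then halved.\<close>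

lemma closure_dyadic_scaleR:
  fixes D :: "'b::real_normed_vector set"
  assumes zero: "0 \<in> D" and add: "\<And>x y. x \<in> D \<Longrightarrow> y \<in> D \<Longrightarrow> x + y \<in> D"
    and neg: "\<And>x. x \<in> D \<Longrightarrow> - x \<in> D" and half: "\<And>x n. x \<in> D \<Longrightarrow> (1 / 2 ^ n) *\<^sub>R x \<in> D"
    and x: "x \<in> closure D"
  shows "r *\<^sub>R x \<in> closure D"
proof (rule closure_of_linear_image[OF _ bounded_linear_scaleR_right x])
  fix x assume x: "x \<in> D"
  have nat: "real n *\<^sub>R y \<in> D" if "y \<in> D" for n y
    using that by (induction n) (auto simp: zero add algebra_simps)
  have int: "of_int k *\<^sub>R y \<in> D" if "y \<in> D" for k y
  proof (cases "k \<ge> 0")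
    case True
    then show ?thesis using nat[OF that, of "nat k"] by simp
  next
    case False
    then show ?thesis using neg[OF nat[OF that, of "nat (- k)"]] by simp
  qed
  let ?c = "\<lambda>n. of_int \<lfloor>r * 2 ^ n\<rfloor> / 2 ^ n :: real"
  have "?c \<longlonglongrightarrow> r"
  proof (rule tendsto_sandwich)
    show "\<forall>\<^sub>F n in sequentially. r - 1 / 2 ^ n \<le> ?c n"
    proof (intro always_eventually allI)
      fix n
      have "r * 2 ^ n - 1 \<le> of_int \<lfloor>r * 2 ^ n\<rfloor>" by linarith
      then have "(r * 2 ^ n - 1) / 2 ^ n \<le> ?c n" by (intro divide_right_mono) auto
      then show "r - 1 / 2 ^ n \<le> ?c n" by (simp add: diff_divide_distrib)
    qed
    show "\<forall>\<^sub>F n in sequentially. ?c n \<le> r" by (simp add: divide_le_eq)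
    show "(\<lambda>n. r - 1 / 2 ^ n) \<longlonglongrightarrow> r" by real_asymp
  qed auto
  then have "(\<lambda>n. ?c n *\<^sub>R x) \<longlonglongrightarrow> r *\<^sub>R x" by (intro tendsto_scaleR tendsto_const)
  moreover have "?c n *\<^sub>R x \<in> D" for n
    using half[OF int[OF x], of n "\<lfloor>r * 2 ^ n\<rfloor>"] by simp
  ultimately show "r *\<^sub>R x \<in> closure D" unfolding closure_sequential
    by (intro exI[of _ "\<lambda>n. ?c n *\<^sub>R x"]) auto
qed

text \<open>Dyadic sums are closed under every operation except scaling by arbitrary complex
  numbers, which is recovered in the closure from real and imaginary parts.\<close>

lemma generated_subset_closure_aval: "generated_star_subalgebra s \<subseteq> closure (range (aval s))"
proof -
  let ?D = "range (aval s)"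
  have add: "x + y \<in> ?D" if "x \<in> ?D" "y \<in> ?D" for x y
  proof -
    from that obtain U V where "x = aval s U" "y = aval s V" by blast
    then have "x + y = aval s (U @ V)" by (simp add: aval_def)
    then show ?thesis by blast
  qed
  have zero: "0 \<in> ?D" using rangeI[of "aval s" "[]"] by (simp add: aval_def)
  \<comment> \<open>A linear map preserves the dyadic sums once it sends single monomials into
    them.\<close>
  have map: "(\<And>u. F (aval s [u]) \<in> ?D) \<Longrightarrow> x \<in> ?D \<Longrightarrow> F x \<in> ?D"
    if F: "linear F" for F and x :: 'a
  proof -
    assume F1: "\<And>u. F (aval s [u]) \<in> ?D" and "x \<in> ?D"
    then obtain U where "x = aval s U" by blast
    moreover have "F (aval s U) \<in> ?D"
    proof (induction U)
      case Nil
      then show ?case using zero linear_0[OF F] by (simp add: aval_def)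
    next
      case (Cons u U)
      have "aval s (u # U) = aval s [u] + aval s U" by (simp add: aval_def)
      then show ?case using Cons F1 add by (simp add: linear_add[OF F])
    qed
    ultimately show "F x \<in> ?D" by simp
  qed
  have single: "coef a b *\<^sub>C wordval s l ls \<in> ?D" for a b l ls
    using rangeI[of "aval s" "[(a, b, l, ls)]"] by (simp add: aval_def)
  have half: "(1 / 2 ^ n) *\<^sub>R x \<in> ?D" if "x \<in> ?D" for x n
  proof (rule map[OF _ _ that])
    show "linear ((*\<^sub>R) (1 / 2 ^ n) :: 'a \<Rightarrow> 'a)" by (simp add: bounded_linear.linear bounded_linear_scaleR_right)
    fix u :: "nat \<times> nat \<times> nat \<times> nat list"
    obtain a b l ls where u: "u = (a, b, l, ls)" by (cases u)
    have "complex_of_real (1 / 2 ^ n) * coef a b = coef a (b + n)" by (simp add: coef_def power_add)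
    then have "(1 / 2 ^ n) *\<^sub>R aval s [u] = coef a (b + n) *\<^sub>C wordval s l ls"
      by (simp add: u aval_def del: of_real_divide flip: scaleC_of_real_mult)
    then show "(1 / 2 ^ n) *\<^sub>R aval s [u] \<in> ?D" using single by simp
  qed
  have ii: "\<i> *\<^sub>C x \<in> ?D" if "x \<in> ?D" for x
  proof (rule map[OF _ _ that])
    show "linear (scaleC \<i> :: 'a \<Rightarrow> 'a)" by (simp add: bounded_linear.linear bounded_linear_scaleC)
    fix u :: "nat \<times> nat \<times> nat \<times> nat list"
    obtain a b l ls where u: "u = (a, b, l, ls)" by (cases u)
    have "\<i> *\<^sub>C aval s [u] = coef (Suc a) b *\<^sub>C wordval s l ls"
      by (simp add: u aval_def scaleC_scaleC coef_def)
    then show "\<i> *\<^sub>C aval s [u] \<in> ?D" using single by simp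
  qed
  have neg: "- x \<in> ?D" if "x \<in> ?D" for x
    using ii[OF ii[OF that]] by (simp add: scaleC_ii_ii)
  have adj: "adj x \<in> ?D" if "x \<in> ?D" for x
  proof (rule map[OF _ _ that])
    show "linear (adj :: 'a \<Rightarrow> 'a)" by (simp add: bounded_linear.linear bounded_linear_adj)
    fix u :: "nat \<times> nat \<times> nat \<times> nat list"
    obtain a b l ls where u: "u = (a, b, l, ls)" by (cases u)
    have "adj (aval s [u]) = coef (3 * a) b *\<^sub>C wordval s (fst (word_adj l ls)) (snd (word_adj l ls))"
      by (simp add: u aval_def adj_scaleC cnj_coef wordval_adj)
    then show "adj (aval s [u]) \<in> ?D" using single by simp
  qed
  have mult: "x * y \<in> ?D" if "x \<in> ?D" "y \<in> ?D" for x y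
  proof (rule map[OF _ _ that(1)])
    show "linear (\<lambda>x. x * y)" by (simp add: bounded_linear.linear bounded_linear_mult_left)
    fix u :: "nat \<times> nat \<times> nat \<times> nat list"
    show "aval s [u] * y \<in> ?D"
    proof (rule map[OF _ _ that(2)])
      show "linear ((*) (aval s [u]))" by (simp add: bounded_linear.linear bounded_linear_mult_right)
      fix v :: "nat \<times> nat \<times> nat \<times> nat list"
      obtain a b l ls where u: "u = (a, b, l, ls)" by (cases u)
      obtain a' b' l' ls' where v: "v = (a', b', l', ls')" by (cases v)
      have "aval s [u] * aval s [v] = coef (a + a') (b + b') *\<^sub>C wordval s l (ls @ l' # ls')"
        by (simp add: u v aval_def scaleC_mult_mult coef_mult wordval_append)
      then show "aval s [u] * aval s [v] \<in> ?D" using single by simp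
    qed
  qed
  note cadd = closure_of_additive_closed[of ?D, OF add]
  note cscale = closure_dyadic_scaleR[of ?D, OF zero add neg half]
  have cii: "\<i> *\<^sub>C x \<in> closure ?D" if "x \<in> closure ?D" for x
    by (rule closure_of_linear_image[OF _ bounded_linear_scaleC that]) (use ii closure_subset in blast)
  show ?thesis
  proof
    fix x assume "x \<in> generated_star_subalgebra s"
    then show "x \<in> closure ?D"
    proof induction
      case gen_zero
      then show ?case using zero closure_subset by blast
    next
      case (gen_special i)
      have "s i = coef 0 0 *\<^sub>C wordval s (2 * i) []"
        using scaleC_of_real[of 1 "s i"]
        by (simp add: coef_def wordval_def lit_def literal_of_def sum_decode_def)
      then show ?case using single[of 0 0 "2 * i" "[]"] closure_subset by fastforce
    next
      case (gen_add x y)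
      then show ?case using cadd by blast
    next
      case (gen_scaleC x c)
      then show ?case unfolding scaleC_Re_Im[of c] by (intro cadd cscale cii)
    next
      case (gen_mult x y)
      obtain f where f: "\<forall>n. f n \<in> ?D" "f \<longlonglongrightarrow> x" using gen_mult closure_sequential by metis
      obtain g where g: "\<forall>n. g n \<in> ?D" "g \<longlonglongrightarrow> y" using gen_mult closure_sequential by metis
      have "(\<lambda>n. f n * g n) \<longlonglongrightarrow> x * y" using f g by (intro tendsto_mult) auto
      moreover have "\<forall>n. f n * g n \<in> ?D" using f g mult by blast
      ultimately show ?case unfolding closure_sequential by (intro exI[of _ "\<lambda>n. f n * g n"] conjI)
    next
      case (gen_adj x)
      show ?case
        by (rule closure_of_linear_image[OF _ bounded_linear_adj gen_adj.IH])
          (use adj closure_subset in blast)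
    qed
  qed
qed

lemma dval_dense:
  fixes s :: "nat \<Rightarrow> 'a::cstar_algebra"
  assumes pres: "cstar_presentation s" and X: "supported n n X"
  obtains T where "\<And>k. below n (T k)" "(\<lambda>k. dval s (T k)) \<longlonglongrightarrow> X"
proof -
  let ?D = "dval s ` {T. below n T}"
  have add: "x + y \<in> ?D" if "x \<in> ?D" "y \<in> ?D" for x y
  proof -
    from that obtain U V where "x = dval s U" "below n U" "y = dval s V" "below n V" by blast
    then have "x + y = dval s (U @ V)" "below n (U @ V)" by auto
    then show ?thesis by blast
  qed
  have zero: "0 \<in> ?D" using imageI[of "[]" "{T. below n T}" "dval s"] by simp
  have zero': "0 \<in> closure ?D" by (rule subsetD[OF closure_subset zero])
  have sum: "(\<Sum>i\<in>A. F i) \<in> closure ?D" if "\<And>i. i \<in> A \<Longrightarrow> F i \<in> closure ?D" for A :: "nat set" and F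
    using that
  proof (induction A rule: infinite_finite_induct)
    case (insert x A)
    have "F x \<in> closure ?D" "sum F A \<in> closure ?D" using insert.prems insert.IH by blast+
    then have "F x + sum F A \<in> closure ?D" by (intro closure_of_additive_closed[of ?D] add)
    then show ?case by (subst sum.insert[OF insert.hyps])
  qed (use zero' in simp_all)
  have unit: "unit_fmat i j x \<in> closure ?D" if "i < n" "j < n" for i j x
  proof -
    have "x \<in> closure (range (aval s))"
      using pres closure_mono[OF generated_subset_closure_aval[of s]]
      by (auto simp: cstar_presentation_def)
    then obtain f where f: "\<forall>k. f k \<in> range (aval s)" "f \<longlonglongrightarrow> x" using closure_sequential by metis
    have "unit_fmat i j (f k) \<in> ?D" for k
    proof -
      obtain U where "f k = aval s U" using f by blast
      then have "unit_fmat i j (f k) = dval s (map (\<lambda>u. (i, j, u)) U)" by (simp add: dval_unit_aval)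
      moreover have "below n (map (\<lambda>u. (i, j, u)) U)" using that by (auto simp: below_def)
      ultimately show ?thesis by blast
    qed
    moreover have "(\<lambda>k. unit_fmat i j (f k)) \<longlonglongrightarrow> unit_fmat i j x"
      using f(2) that by (intro fmat_tendsto_iff[of n n]) (auto simp: supported_unit ent_unit)
    ultimately show ?thesis unfolding closure_sequential by (intro exI[of _ "\<lambda>k. unit_fmat i j (f k)"]) auto
  qed
  have "X \<in> closure ?D"
    by (subst fmat_eq_sum_unit[OF X]) (intro sum unit, auto)
  then obtain g where g: "\<forall>k. g k \<in> ?D" "g \<longlonglongrightarrow> X" using closure_sequential by metis
  then have "\<forall>k. \<exists>T. below n T \<and> g k = dval s T" by blast
  then obtain T where T: "\<And>k. below n (T k)" "\<And>k. g k = dval s (T k)" by metis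
  then have "g = (\<lambda>k. dval s (T k))" by auto
  then show ?thesis using that T g by metis
qed

section \<open>From approximate to exact projections\<close>

text \<open>McWeeny purification: the polynomial fixes 0 and 1 and has derivative zero at both, so
  the defect is squared up to a factor. It is written without coefficients so that
  \<open>drefine\<close> can mirror it by concatenation and negation.\<close>

definition refine_proj :: "'b::real_normed_algebra \<Rightarrow> 'b" where
  "refine_proj h = h * h + h * h + h * h - h * h * h - h * h * h"

lemma refine_proj_diff: "refine_proj h - h = (h * h - h) - 2 *\<^sub>R (h * (h * h - h))"
  by (simp add: refine_proj_def algebra_simps scaleR_2)

lemma refine_proj_defect:
  defines "d \<equiv> \<lambda>h. h * h - h"
  shows "d (refine_proj h) = 4 *\<^sub>R (d h * (d h * d h)) - 3 *\<^sub>R (d h * d h)"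
proof -
  have 4: "4 *\<^sub>R x = x + x + x + x" and 3: "3 *\<^sub>R x = x + x + x" for x :: 'a
    using scaleR_add_left[of 2 2 x] scaleR_add_left[of 2 1 x] by (simp_all add: scaleR_2)
  show ?thesis unfolding 4 3 d_def refine_proj_def by (simp add: algebra_simps)
qed

text \<open>A step moves \<open>h\<close> by at most its defect times \<open>1 + 2 * norm h\<close>.
  The factor 16 keeps the total movement \<open>8 * R * \<delta>\<close> at most 1/2, so the
  iterates have norm at most \<open>R + 1/2\<close> and the steps are dominated by a geometric
  series.\<close>

lemma refine_proj_limit:
  fixes h :: "'a::cstar_algebra fmat"
  assumes h: "star h = h" "supported n n h" and R: "1 \<le> R" "norm h \<le> R"
    and \<delta>: "norm (h * h - h) \<le> \<delta>" "16 * R * \<delta> \<le> 1"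
  obtains P where "fproj P" "supported n n P" "\<And>k. norm (P - (refine_proj ^^ k) h) \<le> 8 * R * \<delta> / 2 ^ k"
proof -
  let ?h = "\<lambda>k. (refine_proj ^^ k) h"
  let ?d = "\<lambda>k. ?h k * ?h k - ?h k"
  have \<delta>0: "\<delta> \<ge> 0" using \<delta>(1) norm_ge_zero order_trans by blast
  have "16 * 1 * \<delta> \<le> 16 * R * \<delta>" using R \<delta>0 by (intro mult_right_mono) auto
  then have \<delta>16: "\<delta> \<le> 1 / 16" using \<delta>(2) by linarith
  have sh: "star (?h k) = ?h k \<and> supported n n (?h k)" for k
    by (induction k)
      (auto simp: h refine_proj_def star_simps mult.assoc intro!: supported_add supported_diff
        intro: supported_mult)
  have d: "norm (?d k) \<le> \<delta> / 2 ^ k" for k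
  proof (induction k)
    case (Suc k)
    let ?n = "norm (?d k)"
    have "\<delta> / 2 ^ k \<le> \<delta>" using divide_left_mono[of 1 "2 ^ k" \<delta>] \<delta>0 by simp
    then have n16: "?n \<le> 1 / 16" using Suc \<delta>16 by linarith
    have "norm (?d (Suc k)) \<le> 4 * norm (?d k * (?d k * ?d k)) + 3 * norm (?d k * ?d k)"
      using norm_triangle_ineq4[of "4 *\<^sub>R (?d k * (?d k * ?d k))" "3 *\<^sub>R (?d k * ?d k)"]
        refine_proj_defect[of "?h k"] by simp
    also have "\<dots> \<le> 4 * (?n * (?n * ?n)) + 3 * (?n * ?n)"
      by (intro add_mono mult_left_mono order_trans[OF norm_mult_ineq] norm_mult_ineq) auto
    also have "\<dots> = (4 * (?n * ?n) + 3 * ?n) * ?n" by (simp add: algebra_simps)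
    also have "\<dots> \<le> (4 * (1/16 * (1/16)) + 3 * (1/16)) * ?n"
      using n16 by (intro mult_right_mono add_mono mult_left_mono mult_mono) auto
    \<comment> \<open>The decay is quadratic; halving already gives the claimed rate.\<close>
    also have "\<dots> \<le> 1 / 2 * ?n" by (intro mult_right_mono) auto
    also have "\<dots> \<le> \<delta> / 2 ^ Suc k" using Suc by simp
    finally show ?case .
  qed (use \<delta> in auto)
  have step: "norm (?h (Suc k) - ?h k) \<le> 4 * R * \<delta> / 2 ^ k" if "norm (?h k) \<le> R + 1/2" for k
  proof -
    have "?h (Suc k) - ?h k = ?d k - 2 *\<^sub>R (?h k * ?d k)"
      using refine_proj_diff[of "?h k"] by (simp only: funpow.simps o_apply)
    then have "norm (?h (Suc k) - ?h k) \<le> norm (?d k) + 2 * norm (?h k * ?d k)"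
      using norm_triangle_ineq4[of "?d k" "2 *\<^sub>R (?h k * ?d k)"] by (simp only: norm_scaleR abs_numeral)
    also have "\<dots> \<le> norm (?d k) + 2 * ((R + 1/2) * norm (?d k))"
      using that by (intro add_left_mono mult_left_mono order_trans[OF norm_mult_ineq] mult_right_mono) auto
    also have "\<dots> = (2 * R + 2) * norm (?d k)" by (simp add: algebra_simps)
    also have "\<dots> \<le> (4 * R) * (\<delta> / 2 ^ k)" using R d[of k] by (intro mult_mono) auto
    finally show ?thesis by simp
  qed
  \<comment> \<open>Movement and norm are bounded in one induction, because \<open>step\<close>
    presupposes the norm bound. The telescoping form of the geometric sum is what the induction
    preserves.\<close>
  have dist: "norm (?h (k + m) - ?h k) \<le> 8 * R * \<delta> * (1 / 2 ^ k - 1 / 2 ^ (k + m)) \<and> norm (?h (k + m)) \<le> R + 1/2"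
    if hk: "norm (?h k) \<le> R + 8 * R * \<delta> * (1 - 1 / 2 ^ k)" for k m
  proof -
    have RR: "8 * R * \<delta> \<ge> 0" using R \<delta>0 by simp
    show ?thesis
    proof (induction m)
      case 0
      have "8 * R * \<delta> * (1 - 1 / 2 ^ k) \<le> 8 * R * \<delta> * 1" using RR by (intro mult_left_mono) auto
      then show ?case using hk \<delta>(2) by simp
    next
      case (Suc m)
      have eq: "4 * R * \<delta> / 2 ^ (k + m) = 8 * R * \<delta> * (1 / 2 ^ (k + m) - 1 / 2 ^ (k + Suc m))"
        by (simp add: field_simps)
      have "norm (?h (k + Suc m) - ?h k) \<le> norm (?h (k + Suc m) - ?h (k + m)) + norm (?h (k + m) - ?h k)"
        using norm_triangle_ineq[of "?h (k + Suc m) - ?h (k + m)" "?h (k + m) - ?h k"] by simp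
      also have "\<dots> \<le> 8 * R * \<delta> * (1 / 2 ^ k - 1 / 2 ^ (k + Suc m))"
        using Suc step[of "k + m"] unfolding eq by (simp add: right_diff_distrib)
      finally have 1: "norm (?h (k + Suc m) - ?h k) \<le> 8 * R * \<delta> * (1 / 2 ^ k - 1 / 2 ^ (k + Suc m))" .
      have "norm (?h (k + Suc m)) \<le> norm (?h (k + Suc m) - ?h k) + norm (?h k)"
        using norm_triangle_ineq[of "?h (k + Suc m) - ?h k" "?h k"] by simp
      also have "\<dots> \<le> R + 8 * R * \<delta> * (1 - 1 / 2 ^ (k + Suc m))"
        using 1 hk by (simp add: right_diff_distrib)
      also have "8 * R * \<delta> * (1 - 1 / 2 ^ (k + Suc m)) \<le> 8 * R * \<delta> * 1"
        using RR by (intro mult_left_mono) auto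
      finally show ?case using 1 \<delta>(2) by simp
    qed
  qed
  have h0: "norm (?h k) \<le> R + 8 * R * \<delta> * (1 - 1 / 2 ^ k)" for k
    using dist[of 0 k] R norm_triangle_ineq[of "?h k - h" h] by simp
  have RR: "8 * R * \<delta> \<ge> 0" using R \<delta>0 by simp
  have diff: "norm (?h m - ?h k) \<le> 8 * R * \<delta> / 2 ^ k" if "k \<le> m" for k m
  proof -
    have "norm (?h m - ?h k) \<le> 8 * R * \<delta> * (1 / 2 ^ k - 1 / 2 ^ m)"
      using dist[OF h0, of k "m - k"] that by simp
    also have "\<dots> \<le> 8 * R * \<delta> * (1 / 2 ^ k)" using RR by (intro mult_left_mono) auto
    finally show ?thesis by simp
  qed
  have "Cauchy ?h"
  proof (rule metric_CauchyI)
    fix e :: real assume "0 < e"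
    moreover have "(\<lambda>k. 8 * R * \<delta> / 2 ^ k) \<longlonglongrightarrow> 0" by real_asymp
    ultimately have "eventually (\<lambda>k. 8 * R * \<delta> / 2 ^ k < e) sequentially"
      by (rule order_tendstoD(2)[rotated])
    then obtain M where M: "\<And>k. k \<ge> M \<Longrightarrow> 8 * R * \<delta> / 2 ^ k < e"
      by (auto simp: eventually_sequentially)
    have "dist (?h k) (?h l) < e" if "M \<le> k" "k \<le> l" for k l
      using diff[OF that(2)] M[OF that(1)] by (simp add: dist_norm norm_minus_commute)
    then show "\<exists>M. \<forall>m\<ge>M. \<forall>n\<ge>M. dist (?h m) (?h n) < e" by (metis dist_commute nle_le)
  qed
  then obtain P where P: "supported n n P" "?h \<longlonglongrightarrow> P"
    using complete_supported[of n n, where 'a='a] sh completeE[of "{X. supported n n X}" ?h] by blast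
  have "(\<lambda>k. star (?h k)) \<longlonglongrightarrow> star P" by (rule tendsto_star[OF P(2)])
  then have "star P = P" using sh P(2) LIMSEQ_unique by auto
  moreover have "P * P = P"
  proof -
    have "?d \<longlonglongrightarrow> P * P - P" by (intro tendsto_intros P(2))
    moreover have "?d \<longlonglongrightarrow> 0"
    proof (rule tendsto_norm_zero_cancel)
      have "(\<lambda>k. \<delta> / 2 ^ k) \<longlonglongrightarrow> 0" by real_asymp
      then show "(\<lambda>k. norm (?d k)) \<longlonglongrightarrow> 0"
        by (rule tendsto_sandwich[rotated 3, where f = "\<lambda>_. 0"]) (use d in auto)
    qed
    ultimately have "P * P - P = 0" by (rule LIMSEQ_unique)
    then show ?thesis by simp
  qed
  moreover have "norm (P - ?h k) \<le> 8 * R * \<delta> / 2 ^ k" for k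
  proof (rule LIMSEQ_le_const2)
    show "(\<lambda>m. norm (?h m - ?h k)) \<longlonglongrightarrow> norm (P - ?h k)" by (intro tendsto_intros P(2))
    show "\<exists>N. \<forall>m\<ge>N. norm (?h m - ?h k) \<le> 8 * R * \<delta> / 2 ^ k" using diff by blast
  qed
  ultimately show ?thesis using that P by (simp add: fproj_def)
qed

text \<open>The equivalence comes from \<open>q * p\<close>. Projections may have large entrywise
  norm, and compressing \<open>p - q\<close> by one of them costs at most
  \<open>(norm p + 1)\<^sup>2\<close>, as \<open>norm p + 1\<close> bounds the norms of
  both.\<close>

lemma fequiv_close:
  fixes p q :: "'a::cstar_algebra fmat"
  assumes p: "fproj p" and q: "fproj q" and c: "norm (p - q) * (norm p + 1)\<^sup>2 < 1"
  shows "fequiv p q"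
proof -
  have pp: "p * p = p" "star p = p" and qq: "q * q = q" "star q = q"
    using p q by (auto simp: fproj_def)
  have "1 \<le> (norm p + 1)\<^sup>2" using norm_ge_zero[of p] by (simp add: power2_eq_square algebra_simps)
  then have "norm (p - q) * 1 \<le> norm (p - q) * (norm p + 1)\<^sup>2" by (intro mult_left_mono) auto
  then have n1: "norm (p - q) < 1" using c by linarith
  then have nq: "norm q \<le> norm p + 1"
    using norm_triangle_ineq4[of p "p - q"] by simp
  have sandwich: "norm (r * x * r) \<le> norm x * (norm p + 1)\<^sup>2" if "norm r \<le> norm p + 1" for r x :: "'a fmat"
  proof -
    have "norm (r * x * r) \<le> norm r * norm x * norm r"
      by (intro order_trans[OF norm_mult_ineq] mult_right_mono norm_mult_ineq) auto
    also have "\<dots> \<le> (norm p + 1) * norm x * (norm p + 1)"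
      using that by (intro mult_mono) auto
    finally show ?thesis by (simp add: power2_eq_square algebra_simps)
  qed
  show ?thesis
  proof (rule fequiv_approx[OF p q, of "q * p"])
    have "star (q * p) * (q * p) - p = p * (q - p) * p"
      by (simp add: star_mult pp qq algebra_simps fproj_mult_left[OF q])
    then show "norm (star (q * p) * (q * p) - p) < 1"
      using sandwich[of p "q - p"] c by (simp add: norm_minus_commute)
    have "(q * p) * star (q * p) - q = q * (p - q) * q"
      by (simp add: star_mult pp qq algebra_simps fproj_mult_left[OF p])
    then show "norm ((q * p) * star (q * p) - q) < 1"
      using sandwich[OF nq, of "p - q"] c by simp
  qed (simp_all add: pp qq mult.assoc fproj_mult_left[OF q])
qed

lemma norm_mult5_le:
  fixes a b c d e :: "'b::real_normed_algebra"
  assumes "norm a \<le> A" "norm b \<le> B" "norm c \<le> C" "norm d \<le> D" "norm e \<le> E"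
  shows "norm (a * b * c * d * e) \<le> A * B * C * D * E"
proof -
  have m: "norm (x * y) \<le> X * Y" if "norm x \<le> X" "norm y \<le> Y" for x y :: 'b and X Y
    using that by (meson mult_mono norm_ge_zero norm_mult_ineq order_trans)
  show ?thesis by (intro m assms)
qed

text \<open>Three factors are exchanged one at a time at a cost of 4 + 2 + 1 times
  \<open>\<delta> * b ^ 4\<close>, since \<open>p\<close> and \<open>q\<close> have norm at most
  \<open>2 * b\<close>; the subtracted \<open>p\<close> accounts for the eighth. \<open>T\<close>
  and \<open>T'\<close> are separate so that either of them can be the adjoint of the other, as the
  two conditions of a certificate demand.\<close>

lemma compression_perturb:
  fixes p q X Y T T' :: "'b::real_normed_algebra"
  assumes n: "norm X \<le> b" "norm Y \<le> b" "norm T \<le> b" "norm T' \<le> b"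
    and \<delta>: "norm (p - X) \<le> \<delta>" "norm (q - Y) \<le> \<delta>" "\<delta> \<le> 1" "1 \<le> b" "8 * \<delta> * b ^ 4 \<le> 1 / 4"
    and small: "norm (X * T' * Y * T * X - X) < 1 / 4"
  shows "norm (p * T' * q * T * p - p) < 1"
proof -
  have np: "norm p \<le> 2 * b" using norm_triangle_ineq[of "p - X" X] n \<delta> by simp
  have nq: "norm q \<le> 2 * b" using norm_triangle_ineq[of "q - Y" Y] n \<delta> by simp
  have \<delta>0: "0 \<le> \<delta>" using \<delta>(1) norm_ge_zero order_trans by blast
  let ?a = "(p - X) * T' * q * T * p" and ?b = "X * T' * (q - Y) * T * p" and ?c = "X * T' * Y * T * (p - X)"
  have eq: "p * T' * q * T * p - p = ((?a + ?b) + (?c + (X * T' * Y * T * X - X))) - (p - X)"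
    by (simp add: algebra_simps)
  have "norm ?a \<le> \<delta> * b * (2 * b) * b * (2 * b)" by (intro norm_mult5_le n \<delta> np nq)
  moreover have "norm ?b \<le> b * b * \<delta> * b * (2 * b)" by (intro norm_mult5_le n \<delta> np nq)
  moreover have "norm ?c \<le> b * b * b * b * \<delta>" by (intro norm_mult5_le n \<delta> np nq)
  moreover have "\<delta> * 1 \<le> \<delta> * b ^ 4" using \<delta>0 \<delta> by (intro mult_left_mono one_le_power) auto
  moreover have "\<delta> * b * (2 * b) * b * (2 * b) = 4 * (\<delta> * b ^ 4)" "b * b * \<delta> * b * (2 * b) = 2 * (\<delta> * b ^ 4)"
    "b * b * b * b * \<delta> = \<delta> * b ^ 4"
    by (simp_all add: power4_eq_xxxx algebra_simps)
  moreover have "8 * (\<delta> * b ^ 4) \<le> 1 / 4" using \<delta> by (simp add: algebra_simps)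
  moreover have "norm (p * T' * q * T * p - p) \<le> ((norm ?a + norm ?b) + (norm ?c + norm (X * T' * Y * T * X - X))) + norm (p - X)"
    unfolding eq
    by (intro order_trans[OF norm_triangle_ineq4] add_right_mono order_trans[OF norm_triangle_ineq] add_mono norm_triangle_ineq)
  ultimately show ?thesis using small \<delta>(1) by linarith
qed

section \<open>The presentation of the Murray--von Neumann semigroup\<close>

text \<open>For a nonnegative rational with code \<open>c\<close>, being less than \<open>1 / 2\<^sup>e\<close>: the parity of the code
  of an integer determines its sign, and halving gives its absolute value.\<close>

definition rat_small :: "nat \<Rightarrow> nat \<Rightarrow> bool" where
  "rat_small e c \<longleftrightarrow> Suc (snd (prod_decode c)) div 2 = 0 \<or>
     Suc (fst (prod_decode c)) div 2 * 2 ^ e < Suc (snd (prod_decode c)) div 2"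

lemma abs_int_decode: "\<bar>int_decode a\<bar> = int (Suc a div 2)"
  by (auto simp: int_decode_def sum_decode_def elim!: oddE)

lemma rat_small_iff:
  assumes "real_of_rat (nat_to_rat_surj c) \<ge> 0"
  shows "rat_small e c \<longleftrightarrow> real_of_rat (nat_to_rat_surj c) < 1 / 2 ^ e"
proof -
  obtain a b where c: "prod_decode c = (a, b)" by (cases "prod_decode c")
  have ab: "\<bar>of_int (int_decode a) :: real\<bar> = real (Suc a div 2)"
      "\<bar>of_int (int_decode b) :: real\<bar> = real (Suc b div 2)"
    using abs_int_decode[of a] abs_int_decode[of b] by (simp_all del: of_int_abs flip: of_int_abs)
  show ?thesis
  proof (cases "int_decode b = 0")
    case True
    then have "Suc b div 2 = 0" using abs_int_decode[of b] by simp
    \<comment> \<open>A code with denominator 0 denotes the rational 0, which the first disjunct of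
      \<open>rat_small\<close> accounts for.\<close>
    moreover have "real_of_rat (nat_to_rat_surj c) = 0"
      by (simp add: nat_to_rat_surj_def c True rat_number_collapse)
    ultimately show ?thesis by (simp add: rat_small_def c)
  next
    case False
    then have b0: "Suc b div 2 \<noteq> 0" using abs_int_decode[of b] by (metis abs_eq_0 of_nat_0)
    have "real_of_rat (nat_to_rat_surj c) = of_int (int_decode a) / of_int (int_decode b)"
      by (simp add: nat_to_rat_surj_def c of_rat_rat False)
    then have "real_of_rat (nat_to_rat_surj c) = \<bar>of_int (int_decode a) / of_int (int_decode b)\<bar>"
      using assms by (metis abs_of_nonneg)
    also have "\<dots> = real (Suc a div 2) / real (Suc b div 2)" by (simp only: abs_divide ab)
    finally have r: "real_of_rat (nat_to_rat_surj c) = real (Suc a div 2) / real (Suc b div 2)" .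
    have "Suc a div 2 * 2 ^ e < Suc b div 2 \<longleftrightarrow> real (Suc a div 2 * 2 ^ e) < real (Suc b div 2)"
      by (simp only: of_nat_less_iff)
    also have "\<dots> \<longleftrightarrow> real (Suc a div 2) / real (Suc b div 2) < 1 / 2 ^ e"
      using b0 by (simp add: field_simps del: of_nat_div)
    finally show ?thesis using b0 by (simp add: rat_small_def c r)
  qed
qed

section \<open>Derived operations on codes, and sizes of words\<close>

definition compression_defect :: "dterm list \<Rightarrow> dterm list \<Rightarrow> dterm list \<Rightarrow> dterm list \<Rightarrow> dterm list" where
  "compression_defect X V Y T = dmul (dmul (dmul (dmul X V) Y) T) X @ dscale 2 0 X"

lemma dval_compression_defect:
  "dval s (compression_defect X V Y T)
    = dval s X * dval s V * dval s Y * dval s T * dval s X - dval s X"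
  by (simp add: compression_defect_def)

lemma cmp_compression_defect [cmp_intros]:
  "cmp f \<Longrightarrow> cmp g \<Longrightarrow> cmp h \<Longrightarrow> cmp k \<Longrightarrow> cmp (\<lambda>x. compression_defect (f x) (g x) (h x) (k x))"
  by (rule cmp_comp4[of compression_defect]) (unfold compression_defect_def, intro cmp_intros)

text \<open>Makes self-adjointness hold by construction, as no certificate could establish an exact
  equality.\<close>

definition dsym :: "dterm list \<Rightarrow> dterm list" where
  "dsym T = dscale 0 1 (T @ dadj T)"

lemma dval_dsym: "dval s (dsym T) = (1/2) *\<^sub>R (dval s T + star (dval s T))"
  by (simp add: dsym_def)

lemma cmp_dsym [cmp_intros]: "cmp f \<Longrightarrow> cmp (\<lambda>x. dsym (f x))"
  unfolding dsym_def by (intro cmp_intros)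

definition drefine :: "dterm list \<Rightarrow> dterm list" where
  "drefine T = dmul T T @ dmul T T @ dmul T T @ dscale 2 0 (dmul (dmul T T) T @ dmul (dmul T T) T)"

lemma dval_drefine: "dval s (drefine T) = refine_proj (dval s T)"
  by (simp add: drefine_def refine_proj_def)

lemma dval_drefine_funpow: "dval s ((drefine ^^ k) T) = (refine_proj ^^ k) (dval s T)"
  by (induction k) (auto simp: dval_drefine)

lemma below_drefine_funpow: "below n T \<Longrightarrow> below n ((drefine ^^ k) T)"
  by (induction k) (auto simp: drefine_def)

lemma cmp_drefine: "cmp drefine"
  unfolding drefine_def[abs_def] by (intro cmp_intros)

text \<open>The data \<open>(n', T, B, K)\<close> encoded by a letter are the size minus one, a matrix, the exponent of a
  bound for its norm, and the stage at which the upper approximations of norms certify it.\<close>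

type_synonym letter_data = "nat \<times> dterm list \<times> nat \<times> nat"

definition letter_size :: "nat \<Rightarrow> nat" where
  "letter_size i = Suc (fst (dec i :: letter_data))"

definition word_size :: "nat list \<Rightarrow> nat" where
  "word_size w = foldr (\<lambda>i m. letter_size i + m) w 0"

lemma word_size_simps [simp]:
  "word_size [] = 0" "word_size (i # w) = letter_size i + word_size w"
  by (auto simp: word_size_def)

lemma word_size_append: "word_size (w @ w') = word_size w + word_size w'"
  by (induction w) auto

lemma cmp_letter_size [cmp_intros]: "cmp f \<Longrightarrow> cmp (\<lambda>x. letter_size (f x))"
  unfolding letter_size_def by (intro cmp_intros)

lemma cmp_word_size [cmp_intros]: "cmp f \<Longrightarrow> cmp (\<lambda>x. word_size (f x))"
  unfolding word_size_def by (intro cmp_intros)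

lemma ce_set_enc_exists:
  assumes "dcd (\<lambda>p. P (fst p) (snd p))"
  shows "ce_set {enc x | x. \<exists>y. P x y}"
proof -
  define F where "F p = (if P (fst p) (snd p) then 0 else 1 :: nat)" for p
  have "cmp F" unfolding F_def by (intro cmp_intros assms)
  then have "ce_set {x. \<exists>n. enc (F (dec (prod_encode (x, n)))) = 0}"
    unfolding cmp_def by (rule ce_set_exists)
  also have "{x. \<exists>n. enc (F (dec (prod_encode (x, n)))) = 0} = {enc x | x. \<exists>y. P x y}"
    by (auto simp: F_def dec_prod enc_nat_def split: if_splits) (metis dec_enc enc_dec)+
  finally show ?thesis .
qed

section \<open>Certifying small norms\<close>

locale ce_presented =
  fixes s :: "nat \<Rightarrow> 'a::unital_cstar_algebra" and f :: "nat \<Rightarrow> nat"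
  assumes pres: "cstar_presentation s"
    and computable_f: "computable f"
    and norm_approx: "\<And>q. decseq (\<lambda>k. real_of_rat (nat_to_rat_surj (f (prod_encode (q, k))))) \<and>
      (\<lambda>k. real_of_rat (nat_to_rat_surj (f (prod_encode (q, k))))) \<longlonglongrightarrow> norm (rational_point cstar_ops s q)"
begin

text \<open>The additional \<open>2 * n\<close> binary digits absorb the sum over all entries,
  because \<open>n * n\<close> is at most \<open>2 ^ (2 * n)\<close>. Fixing the stage
  \<open>K\<close> makes the test decidable.\<close>

definition small :: "nat \<Rightarrow> nat \<Rightarrow> nat \<Rightarrow> dterm list \<Rightarrow> bool" where
  "small M n K T \<longleftrightarrow>
    (\<forall>i<n. \<forall>j<n. rat_small (M + 2 * n) (f (prod_encode (entry_code i j T, K))))"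

abbreviation upper :: "nat \<Rightarrow> nat \<Rightarrow> real" where
  "upper q k \<equiv> real_of_rat (nat_to_rat_surj (f (prod_encode (q, k))))"

lemma upper_ge: "norm (rational_point cstar_ops s q) \<le> upper q k"
  using norm_approx[of q] decseq_ge by blast

lemma rat_small_upper: "rat_small e (f (prod_encode (q, k))) \<longleftrightarrow> upper q k < 1 / 2 ^ e"
  using upper_ge[of q k] norm_ge_zero order_trans by (intro rat_small_iff) blast

lemma small_imp_norm_less:
  assumes T: "below n T" and S: "small M n K T" shows "norm (dval s T) < 1 / 2 ^ M"
proof (cases "n = 0")
  case True
  then have "dval s T = 0"
    using supported_dval[OF T, of s] by (intro fmat_eqI) (simp add: supported_def ent_zero)
  then show ?thesis by simp
next
  case False
  have e: "norm (ent (dval s T) i j) < 1 / 2 ^ (M + 2 * n)" if "i < n" "j < n" for i j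
    using S that upper_ge[of "entry_code i j T" K]
    unfolding small_def rat_small_upper rational_point_entry_code by (meson le_less_trans)
  have "norm (dval s T) = (\<Sum>i<n. \<Sum>j<n. norm (ent (dval s T) i j))"
    by (rule norm_fmat_eq[OF supported_dval[OF T]])
  also have "\<dots> < (\<Sum>i<n. \<Sum>j<n. 1 / 2 ^ (M + 2 * n))"
    using False e by (intro sum_strict_mono) auto
  also have "\<dots> = (real n * real n / (2 ^ n * 2 ^ n)) / 2 ^ M"
  proof -
    have *: "(2::real) ^ (M + 2 * n) = 2 ^ M * (2 ^ n * 2 ^ n)" by (simp only: power_add mult_2)
    show ?thesis unfolding * by (simp add: mult.commute)
  qed
  also have "\<dots> \<le> 1 / 2 ^ M"
  proof (rule divide_right_mono)
    have "real n \<le> 2 ^ n" by (metis less_exp less_imp_le of_nat_le_iff of_nat_numeral of_nat_power)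
    then have "real n * real n \<le> 2 ^ n * 2 ^ n" by (intro mult_mono) auto
    then show "real n * real n / (2 ^ n * 2 ^ n) \<le> 1" by (simp add: divide_le_eq_1)
  qed simp
  finally show ?thesis .
qed

text \<open>Compared with \<open>small_imp_norm_less\<close> a factor \<open>2 ^ (2 * n)\<close> is
  lost. This is harmless because certificates are sought along sequences that tend to 0.\<close>

lemma eventually_small:
  assumes "norm (dval s T) < 1 / 2 ^ (M + 2 * n)"
  shows "\<forall>\<^sub>F K in sequentially. small M n K T"
proof -
  have "\<forall>\<^sub>F K in sequentially. rat_small (M + 2 * n) (f (prod_encode (entry_code i j T, K)))" for i j
    unfolding rat_small_upper
  proof (rule order_tendstoD(2)[OF conjunct2[OF norm_approx]])
    show "norm (rational_point cstar_ops s (entry_code i j T)) < 1 / 2 ^ (M + 2 * n)"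
      unfolding rational_point_entry_code using assms norm_ent_le le_less_trans by blast
  qed
  then have "\<forall>\<^sub>F K in sequentially. \<forall>i\<in>{..<n}. \<forall>j\<in>{..<n}.
      rat_small (M + 2 * n) (f (prod_encode (entry_code i j T, K)))"
    by (intro eventually_ball_finite ballI) auto
  then show ?thesis unfolding small_def by (rule eventually_mono) auto
qed

lemma dcd_small [cmp_intros]:
  assumes "cmp M" "cmp n" "cmp K" "cmp T" shows "dcd (\<lambda>x. small (M x) (n x) (K x) (T x))"
proof -
  have "dcd (\<lambda>p. small (fst p) (fst (snd p)) (fst (snd (snd p))) (snd (snd (snd p))))"
    unfolding small_def rat_small_def
    by (intro cmp_intros cmp_comp[OF cmp_nat_iff[THEN iffD2, OF computable_f]])
  from dcd_comp[OF this cmp_Pair[OF assms(1) cmp_Pair[OF assms(2) cmp_Pair[OF assms(3,4)]]]]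
  show ?thesis by simp
qed

section \<open>Letters and words as projections\<close>

text \<open>These tests give the hypotheses of \<open>refine_proj_limit\<close> for
  \<open>R = 2 ^ B\<close> and \<open>\<delta> = 1 / 2 ^ (B + 5)\<close>:
  \<open>16 * R * \<delta>\<close> is 1/2, and \<open>8 * R * \<delta>\<close> is 1/4, so
  \<open>k\<close> refinements leave an error of at most \<open>1 / 2 ^ k\<close>.\<close>

definition data_ok :: "letter_data \<Rightarrow> bool" where
  "data_ok d \<longleftrightarrow> (case d of (n', T, B, K) \<Rightarrow>
     small 0 (Suc n') K (dscale 0 B (dsym (clip (Suc n') T))) \<and>
     small (B + 5) (Suc n') K (dmul (dsym (clip (Suc n') T)) (dsym (clip (Suc n') T)) @
       dscale 2 0 (dsym (clip (Suc n') T))))"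

text \<open>Every number must denote a projection, so a letter that fails the test gets the empty
  code: the zero projection, of the size that the letter asks for.\<close>

definition letter_code :: "nat \<Rightarrow> dterm list" where
  "letter_code i = (if data_ok (dec i) then
     (case (dec i :: letter_data) of (n', T, B, K) \<Rightarrow> dsym (clip (Suc n') T)) else [])"

text \<open>The errors of \<open>length w\<close> letters add up. Refining each letter
  \<open>length w\<close> more times than \<open>k\<close> compensates, because
  \<open>length w < 2 ^ length w\<close>.\<close>

definition word_code :: "nat list \<Rightarrow> nat \<Rightarrow> dterm list" where
  "word_code w k = foldr (\<lambda>i T. (drefine ^^ (k + length w)) (letter_code i) @ dshift (letter_size i) T) w []"

lemma dcd_data_ok [cmp_intros]: assumes "cmp g" shows "dcd (\<lambda>x. data_ok (g x))"
proof -
  have "data_ok d \<longleftrightarrow> small 0 (Suc (fst d)) (snd (snd (snd d))) (dscale 0 (fst (snd (snd d))) (dsym (clip (Suc (fst d)) (fst (snd d))))) \<and>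
     small (fst (snd (snd d)) + 5) (Suc (fst d)) (snd (snd (snd d)))
       (dmul (dsym (clip (Suc (fst d)) (fst (snd d)))) (dsym (clip (Suc (fst d)) (fst (snd d)))) @
       dscale 2 0 (dsym (clip (Suc (fst d)) (fst (snd d)))))" for d
    by (simp add: data_ok_def case_prod_beta)
  then show ?thesis by (simp only:) (intro cmp_intros assms)
qed

lemma cmp_letter_code [cmp_intros]: "cmp g \<Longrightarrow> cmp (\<lambda>x. letter_code (g x))"
  by (rule cmp_comp[of letter_code]) (unfold letter_code_def, intro cmp_intros)

lemma cmp_word_code [cmp_intros]: "cmp g \<Longrightarrow> cmp h \<Longrightarrow> cmp (\<lambda>x. word_code (g x) (h x))"
  by (rule cmp_comp2[of word_code])
    (unfold word_code_def, intro cmp_intros cmp_funpow cmp_drefine)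

lemma letter_code_bounds:
  obtains B where "below (letter_size i) (letter_code i)"
    "star (dval s (letter_code i)) = dval s (letter_code i)"
    "norm (dval s (letter_code i)) \<le> 2 ^ B"
    "norm (dval s (letter_code i) * dval s (letter_code i) - dval s (letter_code i)) \<le> 1 / 2 ^ (B + 5)"
proof (cases "data_ok (dec i)")
  case False
  then show ?thesis using that[of 0] by (simp add: letter_code_def)
next
  case True
  obtain n' T B K where d: "(dec i :: letter_data) = (n', T, B, K)" by (cases "dec i :: letter_data")
  define h where "h = dsym (clip (Suc n') T)"
  have l: "letter_code i = h" "letter_size i = Suc n'" using True by (simp_all add: letter_code_def letter_size_def d h_def)
  have b: "below (Suc n') h" by (simp add: h_def dsym_def below_clip)
  from True have sm: "small 0 (Suc n') K (dscale 0 B h)" "small (B + 5) (Suc n') K (dmul h h @ dscale 2 0 h)"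
    by (simp_all add: data_ok_def d h_def)
  have n: "norm (dval s (dscale 0 B h)) < 1 / 2 ^ 0" "norm (dval s (dmul h h @ dscale 2 0 h)) < 1 / 2 ^ (B + 5)"
    by (rule small_imp_norm_less[OF _ sm(1)], use b in simp)
      (rule small_imp_norm_less[OF _ sm(2)], use b in simp)
  have "norm (dval s h) \<le> 2 ^ B" using n(1) by (simp add: divide_less_eq)
  moreover have "star (dval s h) = dval s h" by (simp add: h_def dval_dsym star_simps add.commute)
  ultimately show ?thesis using that[of B] n(2) b l by simp
qed

text \<open>Such a \<open>P\<close> is the limit of the refined codes and therefore unique, which
  \<open>projection_fequiv_letter_proj\<close> relies on.\<close>

definition letter_proj :: "nat \<Rightarrow> 'a fmat" where
  "letter_proj i = (SOME P. fproj P \<and> supported (letter_size i) (letter_size i) P \<and>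
     (\<forall>k. norm (P - dval s ((drefine ^^ k) (letter_code i))) \<le> 1 / 2 ^ k))"

lemma letter_proj:
  "fproj (letter_proj i)" "supported (letter_size i) (letter_size i) (letter_proj i)"
  "norm (letter_proj i - dval s ((drefine ^^ k) (letter_code i))) \<le> 1 / 2 ^ k"
proof -
  obtain B where B: "below (letter_size i) (letter_code i)"
    "star (dval s (letter_code i)) = dval s (letter_code i)"
    "norm (dval s (letter_code i)) \<le> 2 ^ B"
    "norm (dval s (letter_code i) * dval s (letter_code i) - dval s (letter_code i)) \<le> 1 / 2 ^ (B + 5)"
    by (rule letter_code_bounds)
  obtain P where P: "fproj P" "supported (letter_size i) (letter_size i) P"
    "\<And>k. norm (P - (refine_proj ^^ k) (dval s (letter_code i))) \<le> 8 * 2 ^ B * (1 / 2 ^ (B + 5)) / 2 ^ k"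
    by (rule refine_proj_limit[OF B(2) supported_dval[OF B(1)] _ B(3) B(4)])
      (auto simp: power_add)
  have "norm (P - dval s ((drefine ^^ k) (letter_code i))) \<le> 1 / 2 ^ k" for k
  proof -
    have "8 * 2 ^ B * (1 / 2 ^ (B + 5)) / 2 ^ k \<le> (1 :: real) / 2 ^ k"
      by (intro divide_right_mono) (auto simp: power_add)
    then show ?thesis using P(3)[of k] by (simp add: dval_drefine_funpow)
  qed
  then have "\<exists>P. fproj P \<and> supported (letter_size i) (letter_size i) P \<and>
      (\<forall>k. norm (P - dval s ((drefine ^^ k) (letter_code i))) \<le> 1 / 2 ^ k)"
    using P by blast
  from someI_ex[OF this]
  show "fproj (letter_proj i)" "supported (letter_size i) (letter_size i) (letter_proj i)"
    "norm (letter_proj i - dval s ((drefine ^^ k) (letter_code i))) \<le> 1 / 2 ^ k"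
    unfolding letter_proj_def by blast+
qed

primrec word_proj :: "nat list \<Rightarrow> 'a fmat" where
  "word_proj [] = 0"
| "word_proj (i # w) = letter_proj i + shift (letter_size i) (letter_size i) (word_proj w)"

lemma word_proj_append:
  "word_proj (w @ w') = word_proj w + shift (word_size w) (word_size w) (word_proj w')"
proof (induction w)
  case Nil
  have "shift 0 0 X = X" for X :: "'a fmat" by (rule fmat_eqI) (simp add: ent_shift)
  then show ?case by simp
qed (simp add: shift_add shift_shift add.assoc)

lemma fproj_word_proj: "fproj (word_proj w)"
proof (induction w)
  case (Cons i w)
  then show ?case using fproj_block[OF letter_proj(2) letter_proj(1)] by simp
qed (simp add: fproj_def)

lemma supported_word_proj: "supported (word_size w) (word_size w) (word_proj w)"
proof (induction w)
  case (Cons i w)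
  have "supported (letter_size i + word_size w) (letter_size i + word_size w) (letter_proj i)"
    by (rule supported_mono[OF letter_proj(2)]) auto
  from supported_add[OF this supported_shift[OF Cons]] show ?case by simp
qed (simp add: supported_zero)

lemma word_size_pos: "w \<noteq> [] \<Longrightarrow> 1 \<le> word_size w"
  by (cases w) (auto simp: letter_size_def)

lemma below_word_code: "below (word_size w) (word_code w k)"
proof -
  have "below (word_size w) (foldr (\<lambda>i T. (drefine ^^ m) (letter_code i) @ dshift (letter_size i) T) w [])" for m
  proof (induction w)
    case (Cons i w)
    have "below (letter_size i) ((drefine ^^ m) (letter_code i))"
      by (rule letter_code_bounds[of i]) (rule below_drefine_funpow)
    then have "below (letter_size i + word_size w) ((drefine ^^ m) (letter_code i))"
      by (rule below_mono) simp
    then show ?case using below_dshift[OF Cons] by simp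
  qed simp
  then show ?thesis by (simp add: word_code_def)
qed

lemma norm_word_proj_minus_code: "norm (word_proj w - dval s (word_code w k)) < 1 / 2 ^ k"
proof -
  have "norm (word_proj w - dval s (foldr (\<lambda>i T. (drefine ^^ m) (letter_code i) @ dshift (letter_size i) T) w []))
      \<le> real (length w) * (1 / 2 ^ m)" for m
  proof (induction w)
    case (Cons i w)
    define W where "W = foldr (\<lambda>i T. (drefine ^^ m) (letter_code i) @ dshift (letter_size i) T) w []"
    have "norm ((letter_proj i - dval s ((drefine ^^ m) (letter_code i)))
        + shift (letter_size i) (letter_size i) (word_proj w - dval s W)) \<le> 1 / 2 ^ m + real (length w) * (1 / 2 ^ m)"
      using Cons letter_proj(3)[of i m] unfolding W_def[symmetric]
      by (intro order_trans[OF norm_triangle_ineq] add_mono) auto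
    then show ?case by (simp add: shift_diff algebra_simps add_divide_distrib flip: W_def)
  qed simp
  then have "norm (word_proj w - dval s (word_code w k)) \<le> real (length w) * (1 / 2 ^ (k + length w))"
    by (simp add: word_code_def)
  also have "\<dots> = (real (length w) / 2 ^ length w) * (1 / 2 ^ k)" by (simp add: power_add)
  also have "\<dots> < 1 * (1 / 2 ^ k)"
  proof (rule mult_strict_right_mono)
    have "real (length w) < 2 ^ length w"
      by (metis less_exp of_nat_less_iff of_nat_numeral of_nat_power)
    then show "real (length w) / 2 ^ length w < 1" by (simp add: divide_less_eq)
  qed simp
  finally show ?thesis by simp
qed

lemma word_code_tendsto: "(\<lambda>k. dval s (word_code w k)) \<longlonglongrightarrow> word_proj w"
proof -
  have "(\<lambda>k. norm (dval s (word_code w k) - word_proj w)) \<longlonglongrightarrow> 0"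
  proof -
    have "(\<lambda>k. 1 / 2 ^ k :: real) \<longlonglongrightarrow> 0" by real_asymp
    then show ?thesis
      by (rule tendsto_sandwich[rotated 3, where f = "\<lambda>_. 0"])
        (use norm_word_proj_minus_code in \<open>auto simp: norm_minus_commute less_imp_le\<close>)
  qed
  then show ?thesis by (rule LIM_zero_cancel[OF tendsto_norm_zero_cancel])
qed

section \<open>Certificates of equivalence\<close>

text \<open>The first three tests bound the norms of \<open>X\<close>, \<open>Y\<close> and
  \<open>T\<close> by \<open>2 ^ B\<close>. The last two put the defects below 1/4, which leaves
  room for replacing \<open>X\<close> and \<open>Y\<close> by the exact projections before 1 is
  reached.\<close>

definition certifies :: "nat \<Rightarrow> dterm list \<Rightarrow> dterm list \<Rightarrow> nat \<Rightarrow> nat \<Rightarrow> dterm list \<Rightarrow> bool" where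
  "certifies n X Y B K T \<longleftrightarrow> small 0 n K (dscale 0 B X) \<and> small 0 n K (dscale 0 B Y) \<and>
     small 0 n K (dscale 0 B T) \<and> small 2 n K (compression_defect X (dadj T) Y T) \<and>
     small 2 n K (compression_defect Y T X (dadj T))"

text \<open>The certificate is \<open>(T, B, K)\<close>. The words are computed to within
  \<open>1 / 2 ^ (5 * B + 10)\<close>, which outweighs the factor \<open>b ^ 4\<close> of
  \<open>compression_perturb\<close> at \<open>b = 2 ^ B\<close>.\<close>

definition word_certifies :: "nat list \<times> nat list \<Rightarrow> dterm list \<times> nat \<times> nat \<Rightarrow> bool" where
  "word_certifies ws c \<longleftrightarrow> certifies (word_size (fst ws) + word_size (snd ws))
     (word_code (fst ws) (5 * fst (snd c) + 10)) (word_code (snd ws) (5 * fst (snd c) + 10))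
     (fst (snd c)) (snd (snd c)) (clip (word_size (fst ws) + word_size (snd ws)) (fst c))"

lemma dcd_word_certifies: "dcd (\<lambda>p. word_certifies (fst p) (snd p))"
  unfolding word_certifies_def certifies_def by (intro cmp_intros)

lemma word_certifies_imp_fequiv:
  assumes "word_certifies (w, w') (T, B, K)"
  shows "fequiv (word_proj w) (word_proj w')"
proof -
  define n where "n = word_size w + word_size w'"
  define X where "X = word_code w (5 * B + 10)"
  define Y where "Y = word_code w' (5 * B + 10)"
  define V where "V = clip n T"
  have cert: "certifies n X Y B K V"
    using assms by (simp add: word_certifies_def n_def X_def Y_def V_def)
  have bel: "below n X" "below n Y" "below n V"
    using below_mono[OF below_word_code] below_clip by (auto simp: n_def X_def Y_def V_def)
  let ?X = "dval s X" and ?Y = "dval s Y" and ?V = "dval s V"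
  let ?p = "word_proj w" and ?q = "word_proj w'"
  have nb: "norm (dval s Z) \<le> 2 ^ B" if "below n Z" "small 0 n K (dscale 0 B Z)" for Z
    using small_imp_norm_less[OF below_dscale[OF that(1)] that(2)] by (simp add: divide_less_eq)
  have n: "norm ?X \<le> 2 ^ B" "norm ?Y \<le> 2 ^ B" "norm ?V \<le> 2 ^ B"
    using cert bel nb by (auto simp: certifies_def)
  have b': "below n (compression_defect X (dadj V) Y V)" "below n (compression_defect Y V X (dadj V))"
    using bel by (simp_all add: compression_defect_def)
  have small: "norm (?X * star ?V * ?Y * ?V * ?X - ?X) < 1 / 4" "norm (?Y * ?V * ?X * star ?V * ?Y - ?Y) < 1 / 4"
    using cert small_imp_norm_less[OF b'(1), of 2 K] small_imp_norm_less[OF b'(2), of 2 K]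
    by (auto simp: certifies_def dval_compression_defect)
  define \<delta> where "\<delta> = 1 / (2 :: real) ^ (5 * B + 10)"
  have d: "norm (?p - ?X) \<le> \<delta>" "norm (?q - ?Y) \<le> \<delta>"
    using norm_word_proj_minus_code less_imp_le by (auto simp: X_def Y_def \<delta>_def)
  have d1: "\<delta> \<le> 1" "(1::real) \<le> 2 ^ B" by (auto simp: \<delta>_def)
  have "8 * \<delta> * (2 ^ B) ^ 4 = 8 / (2 ^ B * 2 ^ 10)"
  proof -
    have "(2 :: real) ^ (5 * B + 10) = (2 ^ B) ^ 4 * (2 ^ B * 2 ^ 10)"
      by (simp add: power_add mult.commute[of 5] power_mult) (simp add: power_numeral_reduce)
    then show ?thesis by (simp add: \<delta>_def)
  qed
  also have "\<dots> \<le> 8 / (1 * 2 ^ 10)" by (intro divide_left_mono mult_right_mono) auto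
  also have "\<dots> \<le> 1 / 4" by simp
  finally have d4: "8 * \<delta> * (2 ^ B) ^ 4 \<le> 1 / 4" .
  have 1: "norm (?p * star ?V * ?q * ?V * ?p - ?p) < 1"
    by (rule compression_perturb[OF n(1,2,3) _ d d1 d4 small(1)]) (simp add: n)
  have 2: "norm (?q * ?V * ?p * star ?V * ?q - ?q) < 1"
    by (rule compression_perturb[OF n(2,1) _ n(3) d(2,1) d1 d4 small(2)]) (simp add: n)
  have pp: "?p * ?p = ?p" "star ?p = ?p" and qq: "?q * ?q = ?q" "star ?q = ?q"
    using fproj_word_proj by (auto simp: fproj_def)
  show ?thesis
  proof (rule fequiv_approx[OF fproj_word_proj fproj_word_proj, of _ "?q * ?V * ?p"])
    show "?q * (?q * ?V * ?p) = ?q * ?V * ?p" "?q * ?V * ?p * ?p = ?q * ?V * ?p"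
      by (simp_all add: mult.assoc pp fproj_mult_left[OF fproj_word_proj])
    have "star (?q * ?V * ?p) * (?q * ?V * ?p) = ?p * star ?V * ?q * ?V * ?p"
      by (simp add: star_mult pp(2) qq(2) mult.assoc fproj_mult_left[OF fproj_word_proj])
    then show "norm (star (?q * ?V * ?p) * (?q * ?V * ?p) - ?p) < 1" using 1 by simp
    have "?q * ?V * ?p * star (?q * ?V * ?p) = ?q * ?V * ?p * star ?V * ?q"
      by (simp add: star_mult pp(2) qq(2) mult.assoc fproj_mult_left[OF fproj_word_proj])
    then show "norm (?q * ?V * ?p * star (?q * ?V * ?p) - ?q) < 1" using 2 by simp
  qed
qed

lemma eventually_norm_dscale_small:
  assumes "(\<lambda>B. dval s (X B)) \<longlonglongrightarrow> x"
  shows "\<forall>\<^sub>F B in sequentially. norm (dval s (dscale 0 B (X B))) < 1 / 2 ^ m"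
proof -
  have "(\<lambda>B. (1 / 2 ^ B) *\<^sub>R dval s (X B)) \<longlonglongrightarrow> 0 *\<^sub>R x"
  proof (rule tendsto_scaleR[OF _ assms])
    show "(\<lambda>B. 1 / 2 ^ B :: real) \<longlonglongrightarrow> 0" by real_asymp
  qed
  then have "(\<lambda>B. norm (dval s (dscale 0 B (X B)))) \<longlonglongrightarrow> norm (0 :: 'a fmat)"
    unfolding dval_dscale_half scaleR_zero_left by (rule tendsto_norm)
  then show ?thesis by (rule order_tendstoD(2)) simp
qed

text \<open>One index \<open>B\<close> drives the precision of the words, the approximation of
  \<open>v\<close> and the norm bound \<open>2 ^ B\<close>. The sequences converge, so for large
  \<open>B\<close> the bound holds while the defects are already small; the stage \<open>K\<close>
  is chosen last.\<close>

lemma fequiv_imp_word_certifies: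
  assumes "fequiv (word_proj w) (word_proj w')"
  shows "\<exists>c. word_certifies (w, w') c"
proof -
  let ?p = "word_proj w" and ?q = "word_proj w'"
  define n where "n = word_size w + word_size w'"
  obtain v where "star v * v = ?p" "v * star v = ?q" using assms by (auto simp: fequiv_def)
  from fequiv_partial_isometry[OF fproj_word_proj fproj_word_proj this] obtain v where
    v: "star v * v = ?p" "v * star v = ?q" "v = ?q * v" "v = v * ?p" by blast
  have pp: "?p * ?p = ?p" and qq: "?q * ?q = ?q" using fproj_word_proj by (auto simp: fproj_def)
  have "supported n n v"
  proof -
    have "supported n n ?p" "supported n n ?q"
      by (auto intro: supported_mono[OF supported_word_proj] simp: n_def)
    moreover obtain K where "supported K K v" using supported_exists by blast
    ultimately have "supported n n (?q * v * ?p)" using supported_mult by blast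
    then show ?thesis using v by metis
  qed
  then obtain T where T: "\<And>k. below n (T k)" "(\<lambda>k. dval s (T k)) \<longlonglongrightarrow> v"
    using dval_dense[OF pres] by metis
  define X where "X B = word_code w (5 * B + 10)" for B
  define Y where "Y B = word_code w' (5 * B + 10)" for B
  have lim: "filterlim (\<lambda>B::nat. 5 * B + 10) at_top sequentially"
    by (rule filterlim_subseq) (auto simp: strict_mono_def)
  have X: "(\<lambda>B. dval s (X B)) \<longlonglongrightarrow> ?p" unfolding X_def by (rule filterlim_compose[OF word_code_tendsto lim])
  have Y: "(\<lambda>B. dval s (Y B)) \<longlonglongrightarrow> ?q" unfolding Y_def by (rule filterlim_compose[OF word_code_tendsto lim])
  have T': "(\<lambda>B. dval s (dadj (T B))) \<longlonglongrightarrow> star v" using tendsto_star[OF T(2)] by simp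
  have "?p * star v * ?q * v * ?p - ?p = 0"
  proof -
    have *: "?p * star v * ?q * v * ?p = ?p * (star v * (?q * v)) * ?p" by (simp only: mult.assoc)
    show ?thesis unfolding * by (simp only: v(3)[symmetric] v(1) pp diff_self)
  qed
  then have D1: "(\<lambda>B. dval s (compression_defect (X B) (dadj (T B)) (Y B) (T B))) \<longlonglongrightarrow> 0"
    unfolding dval_compression_defect using tendsto_diff[OF tendsto_mult[OF tendsto_mult[OF tendsto_mult[OF tendsto_mult[OF X T'] Y] T(2)] X] X]
    by simp
  have "?q * v * ?p * star v * ?q - ?q = 0"
  proof -
    have *: "?q * v * ?p * star v * ?q = ?q * ((v * ?p) * star v) * ?q" by (simp only: mult.assoc)
    show ?thesis unfolding * by (simp only: v(4)[symmetric] v(2) qq diff_self)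
  qed
  then have D2: "(\<lambda>B. dval s (compression_defect (Y B) (T B) (X B) (dadj (T B)))) \<longlonglongrightarrow> 0"
    unfolding dval_compression_defect using tendsto_diff[OF tendsto_mult[OF tendsto_mult[OF tendsto_mult[OF tendsto_mult[OF Y T(2)] X] T'] Y] Y]
    by simp
  have ev0: "\<forall>\<^sub>F B in sequentially. norm (dval s (Z B)) < 1 / 2 ^ m"
    if "(\<lambda>B. dval s (Z B)) \<longlonglongrightarrow> 0" for Z m
    using order_tendstoD(2)[OF tendsto_norm[OF that], of "1 / 2 ^ m"] by simp
  have "\<forall>\<^sub>F B in sequentially. norm (dval s (dscale 0 B (X B))) < 1 / 2 ^ (0 + 2 * n) \<and>
      norm (dval s (dscale 0 B (Y B))) < 1 / 2 ^ (0 + 2 * n) \<and>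
      norm (dval s (dscale 0 B (T B))) < 1 / 2 ^ (0 + 2 * n) \<and>
      norm (dval s (compression_defect (X B) (dadj (T B)) (Y B) (T B))) < 1 / 2 ^ (2 + 2 * n) \<and>
      norm (dval s (compression_defect (Y B) (T B) (X B) (dadj (T B)))) < 1 / 2 ^ (2 + 2 * n)"
    by (intro eventually_conj eventually_norm_dscale_small[OF X] eventually_norm_dscale_small[OF Y]
        eventually_norm_dscale_small[OF T(2)] ev0[OF D1] ev0[OF D2])
  then obtain B where "norm (dval s (dscale 0 B (X B))) < 1 / 2 ^ (0 + 2 * n)"
      "norm (dval s (dscale 0 B (Y B))) < 1 / 2 ^ (0 + 2 * n)"
      "norm (dval s (dscale 0 B (T B))) < 1 / 2 ^ (0 + 2 * n)"
      "norm (dval s (compression_defect (X B) (dadj (T B)) (Y B) (T B))) < 1 / 2 ^ (2 + 2 * n)"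
      "norm (dval s (compression_defect (Y B) (T B) (X B) (dadj (T B)))) < 1 / 2 ^ (2 + 2 * n)"
    using eventually_happens'[OF sequentially_bot] by blast
  then have "\<forall>\<^sub>F K in sequentially. certifies n (X B) (Y B) B K (T B)"
    unfolding certifies_def by (intro eventually_conj eventually_small)
  then obtain K where "certifies n (X B) (Y B) B K (T B)"
    using eventually_happens'[OF sequentially_bot] by blast
  then have "word_certifies (w, w') (T B, B, K)"
    using clip_below[OF T(1)] by (simp add: word_certifies_def n_def X_def Y_def)
  then show ?thesis by blast
qed

section \<open>Every projection is represented by a letter\<close>

lemma projection_fequiv_letter_proj:
  assumes p: "fproj p" "supported n n p" and n: "1 \<le> n"
  obtains i where "letter_size i = n" "fequiv p (letter_proj i)"
proof -
  obtain T where T: "\<And>k. below n (T k)" "(\<lambda>k. dval s (T k)) \<longlonglongrightarrow> p"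
    using dval_dense[OF pres p(2)] by metis
  define h where "h k = dval s (dsym (T k))" for k
  have pp: "p * p = p" "star p = p" using p by (auto simp: fproj_def)
  have h: "h \<longlonglongrightarrow> p"
  proof -
    have "h \<longlonglongrightarrow> (1/2) *\<^sub>R (p + star p)"
      unfolding h_def dval_dsym by (intro tendsto_intros tendsto_star T)
    moreover have "(1/2) *\<^sub>R (p + star p) = p" by (simp add: pp flip: scaleR_2)
    ultimately show ?thesis by simp
  qed
  define N where "N = norm p + 1"
  have N: "N \<ge> 1" by (simp add: N_def)
  \<comment> \<open>The distances from \<open>p\<close> to \<open>h k\<close> and from
    \<open>h k\<close> to its limit will both be below \<open>\<epsilon>\<close>, and
    \<open>2 * \<epsilon> * N\<^sup>2 = 1\<close> is what \<open>fequiv_close\<close>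
    allows.\<close>
  define \<epsilon> where "\<epsilon> = 1 / (2 * N\<^sup>2)"
  have \<epsilon>: "\<epsilon> > 0" using N by (simp add: \<epsilon>_def)
  \<comment> \<open>\<open>B\<close> is fixed before \<open>k\<close>, because both tolerances for
    the defect of \<open>h k\<close> depend on it.\<close>
  have "eventually (\<lambda>B. N / 2 ^ B < 1 / 2 ^ (2 * n)) sequentially"
  proof (rule order_tendstoD(2))
    show "(\<lambda>B. N / 2 ^ B) \<longlonglongrightarrow> 0" by real_asymp
  qed simp
  then obtain B where B: "N / 2 ^ B < 1 / 2 ^ (2 * n)"
    using eventually_happens'[OF sequentially_bot] by blast
  have ev: "\<forall>\<^sub>F k in sequentially. norm (h k) < N"
    using order_tendstoD(2)[OF tendsto_norm[OF h], of N] by (simp add: N_def)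
  have ev': "\<forall>\<^sub>F k in sequentially. norm (h k - p) < e" if "e > 0" for e
    using tendstoD[OF h that] by (simp add: dist_norm)
  have "(\<lambda>k. h k * h k - h k) \<longlonglongrightarrow> p * p - p" by (intro tendsto_intros h)
  then have "(\<lambda>k. norm (h k * h k - h k)) \<longlonglongrightarrow> 0" by (intro tendsto_norm_zero) (simp add: pp)
  then have ev'': "\<forall>\<^sub>F k in sequentially. norm (h k * h k - h k) < e" if "e > 0" for e
    using that order_tendstoD(2) by blast
  have pos: "0 < \<epsilon> / (8 * 2 ^ B)" "(0::real) < 1 / 2 ^ (B + 5 + 2 * n)" using \<epsilon> by simp_all
  \<comment> \<open>The first bound on the defect keeps the limit within \<open>\<epsilon>\<close>
    of \<open>h k\<close>; the second is for the certificate.\<close>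
  have "\<forall>\<^sub>F k in sequentially. norm (h k) < N \<and> norm (h k - p) < \<epsilon> \<and>
      norm (h k * h k - h k) < \<epsilon> / (8 * 2 ^ B) \<and> norm (h k * h k - h k) < 1 / 2 ^ (B + 5 + 2 * n)"
    by (intro eventually_conj ev ev'[OF \<epsilon>] ev''[OF pos(1)] ev''[OF pos(2)])
  then obtain k where k: "norm (h k) < N" "norm (h k - p) < \<epsilon>"
      "norm (h k * h k - h k) < \<epsilon> / (8 * 2 ^ B)" "norm (h k * h k - h k) < 1 / 2 ^ (B + 5 + 2 * n)"
    using eventually_happens'[OF sequentially_bot] by blast
  have "norm (dval s (dscale 0 B (dsym (T k)))) = norm (h k) / 2 ^ B" by (simp add: h_def)
  also have "\<dots> \<le> N / 2 ^ B" using k(1) by (intro divide_right_mono) auto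
  finally have 1: "norm (dval s (dscale 0 B (dsym (T k)))) < 1 / 2 ^ (0 + 2 * n)" using B by simp
  have 2: "norm (dval s (dmul (dsym (T k)) (dsym (T k)) @ dscale 2 0 (dsym (T k)))) < 1 / 2 ^ ((B + 5) + 2 * n)"
    using k(4) by (simp add: h_def)
  have "\<forall>\<^sub>F K in sequentially. small 0 n K (dscale 0 B (dsym (T k))) \<and>
      small (B + 5) n K (dmul (dsym (T k)) (dsym (T k)) @ dscale 2 0 (dsym (T k)))"
    by (intro eventually_conj eventually_small 1 2)
  then obtain K where K: "small 0 n K (dscale 0 B (dsym (T k)))"
      "small (B + 5) n K (dmul (dsym (T k)) (dsym (T k)) @ dscale 2 0 (dsym (T k)))"
    using eventually_happens'[OF sequentially_bot] by blast
  define i where "i = enc (n - 1, T k, B, K)"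
  have di: "dec i = (n - 1, T k, B, K)" by (simp add: i_def)
  have sz: "letter_size i = n" using n by (simp add: letter_size_def di)
  have "data_ok (dec i)" using n K by (simp add: data_ok_def di clip_below[OF T(1)])
  then have lc: "letter_code i = dsym (T k)" using n by (simp add: letter_code_def di clip_below[OF T(1)])
  have hk: "star (h k) = h k" "supported n n (h k)"
    unfolding h_def using supported_dval[of n "dsym (T k)"] T(1)
    by (auto simp: dval_dsym star_simps add.commute dsym_def)
  have "N / 2 ^ B < 1" using B by (rule less_le_trans) simp
  then have nh: "norm (h k) \<le> 2 ^ B" using k(1) by (simp add: divide_less_eq)
  \<comment> \<open>The limit is formed again with the true defect as \<open>\<delta>\<close>. This
    puts it as close to \<open>h k\<close> as wanted, whereas the certified defect gives only a
    fixed distance; uniqueness of limits identifies the two.\<close>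
  have "16 * 2 ^ B * norm (h k * h k - h k) \<le> 16 * 2 ^ B * (1 / 2 ^ (B + 5 + 2 * n))"
    using k(4) by (intro mult_left_mono) auto
  also have "\<dots> = 1 / (2 * 2 ^ (2 * n))" by (simp add: power_add)
  also have "\<dots> \<le> 1"
  proof -
    have "1 \<le> (2::real) ^ (2 * n)" by simp
    then have "1 \<le> 2 * (2::real) ^ (2 * n)" by linarith
    then show ?thesis by (subst divide_le_eq_1_pos) auto
  qed
  finally obtain P where P: "fproj P" "supported n n P"
    "\<And>m. norm (P - (refine_proj ^^ m) (h k)) \<le> 8 * 2 ^ B * norm (h k * h k - h k) / 2 ^ m"
    using refine_proj_limit[OF hk _ nh order_refl] by (metis one_le_power one_le_numeral)
  have lim: "(\<lambda>m. (refine_proj ^^ m) (h k)) \<longlonglongrightarrow> Q"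
    if Q: "\<And>m. norm (Q - (refine_proj ^^ m) (h k)) \<le> C / 2 ^ m" for Q C
  proof -
    have "(\<lambda>m. C / 2 ^ m) \<longlonglongrightarrow> 0" by real_asymp
    then have "(\<lambda>m. norm ((refine_proj ^^ m) (h k) - Q)) \<longlonglongrightarrow> 0"
      by (rule tendsto_sandwich[rotated 3, where f = "\<lambda>_. 0"]) (use Q in \<open>auto simp: norm_minus_commute\<close>)
    then show ?thesis by (rule LIM_zero_cancel[OF tendsto_norm_zero_cancel])
  qed
  have "norm (letter_proj i - (refine_proj ^^ m) (h k)) \<le> 1 / 2 ^ m" for m
    using letter_proj(3)[of i m] by (simp add: lc dval_drefine_funpow h_def)
  then have "letter_proj i = P" using lim P(3) LIMSEQ_unique by metis
  moreover have "norm (P - h k) \<le> 8 * 2 ^ B * norm (h k * h k - h k)" using P(3)[of 0] by simp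
  moreover have "8 * 2 ^ B * norm (h k * h k - h k) < \<epsilon>" using k(3) by (simp add: field_simps)
  ultimately have "norm (p - letter_proj i) < 2 * \<epsilon>"
    using norm_triangle_ineq4[of "P - h k" "p - h k"] k(2) by (simp add: norm_minus_commute)
  then have "norm (p - letter_proj i) * (norm p + 1)\<^sup>2 < 2 * \<epsilon> * N\<^sup>2"
    using N by (simp add: N_def[symmetric])
  also have "\<dots> = 1" using N by (simp add: \<epsilon>_def)
  finally have "fequiv p (letter_proj i)" by (intro fequiv_close p letter_proj)
  then show ?thesis using that sz by blast
qed

section \<open>The presentation and its support\<close>

definition word_class :: "nat list \<Rightarrow> 'a mat set" where
  "word_class w = mvn_class (corner (word_size w) (word_size w) (word_proj w))"

lemma emb_word: "emb (corner (word_size w) (word_size w) (word_proj w)) = word_proj w"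
  by (rule emb_corner[OF supported_word_proj])

lemma word_projections: "w \<noteq> [] \<Longrightarrow> corner (word_size w) (word_size w) (word_proj w) \<in> projections"
  using word_size_pos[of w]
  by (simp add: projections_iff emb_word fproj_word_proj del: One_nat_def)

lemma word_class_eq_iff:
  "w \<noteq> [] \<Longrightarrow> w' \<noteq> [] \<Longrightarrow> word_class w = word_class w' \<longleftrightarrow> fequiv (word_proj w) (word_proj w')"
  unfolding word_class_def by (simp add: mvn_class_eq_iff word_projections emb_word)

lemma semigroup_presentation_word_class:
  "semigroup_presentation mvn_semigroup mvn_add word_class"
  unfolding semigroup_presentation_def
proof (intro conjI ballI)
  show "word_class ` D_omega = mvn_semigroup"
  proof
    show "word_class ` D_omega \<subseteq> mvn_semigroup"
      unfolding word_class_def mvn_class_def mvn_semigroup_def D_omega_def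
      by (auto intro!: quotientI word_projections)
    show "mvn_semigroup \<subseteq> word_class ` D_omega"
    proof
      fix C assume "C \<in> (mvn_semigroup :: 'a mat set set)"
      then obtain p where p: "p \<in> projections" "C = mvn_class p"
        by (auto simp: mvn_semigroup_def mvn_class_def quotient_def)
      then obtain i where i: "letter_size i = dim_row p" "fequiv (emb p) (letter_proj i)"
        using projection_fequiv_letter_proj[of "emb p" "dim_row p"] supported_emb[of p]
        by (metis projections_iff)
      have "C = word_class [i]"
        unfolding word_class_def p(2)
        using p(1) i word_projections[of "[i]"] emb_word[of "[i]"]
        by (subst mvn_class_eq_iff) (auto simp: shift_zero)
      then show "C \<in> word_class ` D_omega" by (auto simp: D_omega_def)
    qed
  qed
  fix w w' assume "w \<in> D_omega" "w' \<in> D_omega"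
  then have w: "w \<noteq> []" "w' \<noteq> []" by (auto simp: D_omega_def)
  let ?c = "\<lambda>w. corner (word_size w) (word_size w) (word_proj w)"
  have "?c (w @ w') = diag_sum (?c w) (?c w')"
    by (rule emb_inject)
      (unfold emb_word emb_diag_sum, auto simp: word_proj_append word_size_append)
  then show "word_class (w @ w') = mvn_add (word_class w) (word_class w')"
    unfolding word_class_def using mvn_add_class word_projections w by metis
qed

lemma ce_set_word_class:
  "ce_set {prod_encode (list_encode w, list_encode w') | w w'.
     w \<in> D_omega \<and> w' \<in> D_omega \<and> word_class w = word_class w'}"
proof -
  have enc: "enc w = list_encode w" for w :: "nat list" by (simp add: enc_list_def enc_nat_def[abs_def])
  have "dcd (\<lambda>p. fst (fst p) \<noteq> [] \<and> snd (fst p) \<noteq> [] \<and> word_certifies (fst p) (snd p))"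
    by (intro cmp_intros dcd_word_certifies)
  then have "ce_set {enc ws | ws. \<exists>c. fst ws \<noteq> [] \<and> snd ws \<noteq> [] \<and> word_certifies ws c}"
    by (rule ce_set_enc_exists)
  moreover have "{enc ws | ws. \<exists>c. fst ws \<noteq> [] \<and> snd ws \<noteq> [] \<and> word_certifies ws c}
    = {prod_encode (list_encode w, list_encode w') | w w'.
       w \<in> D_omega \<and> w' \<in> D_omega \<and> word_class w = word_class w'}"
  proof -
    have "(\<exists>c. word_certifies (w, w') c) \<longleftrightarrow> word_class w = word_class w'" if "w \<noteq> []" "w' \<noteq> []" for w w'
      using word_class_eq_iff[OF that] word_certifies_imp_fequiv fequiv_imp_word_certifies
      by (metis prod_cases3)
    moreover have "{enc ws | ws. \<exists>c. fst ws \<noteq> [] \<and> snd ws \<noteq> [] \<and> word_certifies ws c}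
        = {enc (w, w') | w w'. w \<noteq> [] \<and> w' \<noteq> [] \<and> (\<exists>c. word_certifies (w, w') c)}" by auto
    ultimately show ?thesis by (simp add: D_omega_def enc_prod_def enc cong: conj_cong)
  qed
  ultimately show ?thesis by simp
qed

lemma computably_supported_word_class: "computably_supported word_class s"
proof -
  have "cmp (\<lambda>p. mat_code (word_size (fst p)) (word_code (fst p) (snd p)))" by (intro cmp_intros)
  \<comment> \<open>\<open>smn\<close> turns approximations that are uniform in the word into an
    index that depends computably on it.\<close>
  then obtain E where E: "cmp E"
    "\<And>w. \<exists>c. E w = prog_code c \<and> (\<forall>k. evaluates c k (mat_code (word_size w) (word_code w k)))"
    by (rule smn[of "\<lambda>w k. mat_code (word_size w) (word_code w k)"]) blast
  have "cmp (\<lambda>w. (word_size w, E w))" by (intro cmp_intros E(1))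
  then obtain c where "\<And>x. evaluates c x (enc (word_size (dec x), E (dec x)))"
    by (auto simp: cmp_def computable_def)
  then have c: "evaluates c (enc w) (prod_encode (word_size w, E w))" for w
    by (metis dec_enc enc_nat_def enc_prod_def fst_conv snd_conv)
  show ?thesis unfolding computably_supported_def
  proof (intro exI[of _ c] ballI)
    fix w assume "w \<in> D_omega"
    then have w: "w \<noteq> []" by (simp add: D_omega_def)
    let ?n = "word_size w"
    define p where "p = corner ?n ?n (word_proj w)"
    have ep: "emb p = word_proj w" "p \<in> carrier_mat ?n ?n" by (simp_all add: p_def emb_word)
    have "point_index (mat_ops ?n) (mat_special ?n s) (E w) p"
    proof -
      obtain d where d: "E w = prog_code d" "\<And>k. evaluates d k (mat_code ?n (word_code w k))"
        using E(2) by blast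
      have "op_norm (mat_ops ?n) (op_add (mat_ops ?n) p (op_scale (mat_ops ?n) (- 1)
          (rational_point (mat_ops ?n) (mat_special ?n s) (mat_code ?n (word_code w k))))) < 1 / 2 ^ k" for k
        using mat_norm_diff_le[OF ep(2) below_word_code, of s k] norm_word_proj_minus_code[of w k]
        unfolding ep(1) by (rule le_less_trans)
      then show ?thesis unfolding point_index_def using d by blast
    qed
    moreover have "p \<in> mat_projections ?n" by (simp add: mat_projections_iff ep fproj_word_proj)
    moreover have "evaluates c (list_encode w) (prod_encode (?n, E w))"
      using c[of w] by (simp add: enc_list_def enc_nat_def[abs_def])
    ultimately show "\<exists>n e. evaluates c (list_encode w) (prod_encode (n, e)) \<and> n \<ge> 1 \<and>
        (\<exists>p\<in>mat_projections n. point_index (mat_ops n) (mat_special n s) e p \<and> word_class w = mvn_class p)"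
      using word_size_pos[OF w] unfolding word_class_def p_def by blast
  qed
qed

end

theorem theorem2p9:
  fixes s :: "nat \<Rightarrow> 'a::unital_cstar_algebra"
  assumes "ce_cstar_presentation s"
  shows "\<exists>\<nu> :: nat list \<Rightarrow> 'a mat set.
    ce_semigroup_presentation mvn_semigroup mvn_add \<nu> \<and> computably_supported \<nu> s"
proof -
  obtain f where "ce_presented s f"
    using assms by (auto simp: ce_cstar_presentation_def ce_presented_def Let_def)
  then interpret ce_presented s f .
  show ?thesis
    using semigroup_presentation_word_class ce_set_word_class computably_supported_word_class
    by (intro exI[of _ word_class]) (simp add: ce_semigroup_presentation_def)
qed

end
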